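(* Let $m\ge 1$, let $n\ge 2m+1$ be odd, and let $L$ be a uniformly elliptic operator of order $2m$ on $\mathbb{R}^n$ with constant coefficients involving only the highest order derivatives, with symbol $Q$. Then the fundamental solution $K_L$ is given, for $x\ne y$, by $$K_{L}(x,y)=\frac{(-1)^{\frac{n-2m-1}{2}}}{2^n\pi^{n-1}|x-y|^{n-2m}}\int_{\{|\xi|=1,\ (x-y)\cdot\xi=0\}}\nabla^{n-2m-1}\frac{1}{Q(\xi)}\left(\left(\frac{x-y}{|x-y|}\right)^{\otimes (n-2m-1)}\right)d\mathcal{H}^{n-2}(\xi).$$
   Context: Operators: $L=(-1)^m Q\left(\frac{\partial}{\partial x_1},\dots,\frac{\partial}{\partial x_n}\right)$, where $Q(\xi)=\sum_{i_1,\dots,i_{2m}=1}^n A_{i_1,\dots,i_{2m}}\xi_{i_1}\cdots\xi_{i_{2m}}$ is a real $2m$-homogeneous polynomial on $\mathbb{R}^n$, called the symbol of $L$. Uniform ellipticity: there is $\lambda>0$ with $Q(\xi)\ge\lambda|\xi|^{2m}$ for all $\xi\in\mathbb{R}^n$. Fundamental solution: for odd $n>2m$, $K_L$ denotes John's fundamental solution $$K_L(x,y)=-\frac{1}{4(2\pi)^{n-1}}(-\Delta_y)^{\frac{n+1-2m}{2}}\int_{|\xi|=1}\frac{|(x-y)\cdot\xi|}{Q(\xi)}\,d\mathcal{H}^{n-1}(\xi),\qquad x\neq y.$$ It satisfies $\int_{\mathbb{R}^n}K_L(x,y)L\psi(y)\,dy=\psi(x)$ for all $\psi\in C_0^\infty(\mathbb{R}^n)$.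 Notation: $\mathcal{H}^k$ is the $k$-dimensional Hausdorff measure. For a function $f$ and a vector $v\in\mathbb{R}^n$, $\nabla^j f(\xi)(v^{\otimes j})=\sum_{h_1,\dots,h_j=1}^n\frac{\partial^j f}{\partial\xi_{h_1}\cdots\partial\xi_{h_j}}(\xi)\,v_{h_1}\cdots v_{h_j}$ (for $j=0$ this is $f(\xi)$); $\nabla^j\frac{1}{Q(\xi)}$ denotes $\nabla^j f(\xi)$ for the function $f=1/Q$ on $\mathbb{R}^n\setminus\{0\}$. *)

theory Defs
  imports "HOL-Analysis.Analysis"
begin

definition partial_derivative :: "'n::finite \<Rightarrow> (real^'n \<Rightarrow> real) \<Rightarrow> real^'n \<Rightarrow> real" where
  "partial_derivative i f x = deriv (\<lambda>t. f (x + t *\<^sub>R axis i 1)) 0"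

text \<open>A multi-index $(h_1,\dots,h_j)$ is a list of length $j$, and all sums over multi-indices
  run over lists of the appropriate length.\<close>

definition iterated_partial :: "'n::finite list \<Rightarrow> (real^'n \<Rightarrow> real) \<Rightarrow> real^'n \<Rightarrow> real" where
  "iterated_partial hs f = foldr partial_derivative hs f"

definition laplacian :: "(real^'n::finite \<Rightarrow> real) \<Rightarrow> real^'n \<Rightarrow> real" where
  "laplacian f x = (\<Sum>i\<in>UNIV. partial_derivative i (partial_derivative i f) x)"

text \<open>$\nabla^j f(\xi)(v^{\otimes j})$\<close>

definition nabla_pow :: "nat \<Rightarrow> (real^'n::finite \<Rightarrow> real) \<Rightarrow> real^'n \<Rightarrow> real^'n \<Rightarrow> real" where
  "nabla_pow j f \<xi> v =
     (\<Sum>hs | length hs = j. iterated_partial hs f \<xi> * (\<Prod>h\<leftarrow>hs. v $ h))"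

text \<open>Differentiability of every iterated partial derivative on the whole space is the same as
  being $C^\infty$.\<close>

definition smooth :: "(real^'n::finite \<Rightarrow> real) \<Rightarrow> bool" where
  "smooth f \<longleftrightarrow> (\<forall>hs. iterated_partial hs f differentiable_on UNIV)"

text \<open>\<open>has_symbol m L Q\<close>: there are real coefficients $A_{i_1,\dots,i_{2m}}$ for which $Q$ is the
  associated $2m$-homogeneous polynomial and $L = (-1)^m Q(\partial)$ on smooth functions.\<close>

definition has_symbol ::
  "nat \<Rightarrow> ((real^'n::finite \<Rightarrow> real) \<Rightarrow> real^'n \<Rightarrow> real) \<Rightarrow> (real^'n \<Rightarrow> real) \<Rightarrow> bool" where
  "has_symbol m L Q \<longleftrightarrow>
     (\<exists>A :: 'n list \<Rightarrow> real.
        (\<forall>\<xi>. Q \<xi> = (\<Sum>is | length is = 2 * m. A is * (\<Prod>i\<leftarrow>is. \<xi> $ i))) \<and>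
        (\<forall>\<psi>. smooth \<psi> \<longrightarrow>
           (\<forall>x. L \<psi> x = (-1) ^ m * (\<Sum>is | length is = 2 * m. A is * iterated_partial is \<psi> x))))"

definition uniformly_elliptic :: "nat \<Rightarrow> (real^'n::finite \<Rightarrow> real) \<Rightarrow> bool" where
  "uniformly_elliptic m Q \<longleftrightarrow> (\<exists>l>0. \<forall>\<xi>. Q \<xi> \<ge> l * norm \<xi> ^ (2 * m))"

text \<open>The $k$-dimensional Hausdorff measure, normalised by the volume of the $k$-dimensional unit
  ball, so that it agrees with Lebesgue measure on $\mathbb{R}^k$ and with surface area on
  $k$-dimensional submanifolds. The empty set is treated separately
  because $0^0 = 1$; points then have measure $1$ when $k = 0$. Boundedness is required of the
  covering sets because \<^const>\<open>diameter\<close> is meaningless on unbounded ones.\<close>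

definition hausdorff_gauge :: "nat \<Rightarrow> 'a::metric_space set \<Rightarrow> ennreal" where
  "hausdorff_gauge k C =
     (if C = {} then 0 else ennreal (unit_ball_vol (real k) * (diameter C / 2) ^ k))"

definition hausdorff_content :: "nat \<Rightarrow> real \<Rightarrow> 'a::metric_space set \<Rightarrow> ennreal" where
  "hausdorff_content k \<delta> E =
     (INF C \<in> {C :: nat \<Rightarrow> 'a set. E \<subseteq> (\<Union>i. C i) \<and> (\<forall>i. bounded (C i) \<and> diameter (C i) \<le> \<delta>)}.
        \<Sum>i. hausdorff_gauge k (C i))"

definition hausdorff_outer_measure :: "nat \<Rightarrow> 'a::metric_space set \<Rightarrow> ennreal" where
  "hausdorff_outer_measure k E = (SUP \<delta>\<in>{0<..}. hausdorff_content k \<delta> E)"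

text \<open>This is a metric outer measure, hence countably additive on Borel sets, so the use of
  \<^const>\<open>measure_of\<close> is not degenerate.\<close>

definition hausdorff_measure :: "nat \<Rightarrow> 'a::metric_space measure" where
  "hausdorff_measure k = measure_of UNIV (sets borel) (hausdorff_outer_measure k)"

text \<open>John's fundamental solution $K_L$ of the operator $L$ of order $2m$ with symbol $Q$;
  the powers of $-\Delta$ act on the variable $y$.\<close>

definition john_fundamental_solution ::
  "nat \<Rightarrow> (real^'n::finite \<Rightarrow> real) \<Rightarrow> real^'n \<Rightarrow> real^'n \<Rightarrow> real" where
  "john_fundamental_solution m Q x y =
     - 1 / (4 * (2 * pi) ^ (CARD('n) - 1)) *
       ((\<lambda>f z. - laplacian f z) ^^ ((CARD('n) + 1 - 2 * m) div 2))
         (\<lambda>z. LINT \<xi>:{\<xi>. norm \<xi> = 1}|hausdorff_measure (CARD('n) - 1). \<bar>(x - z) \<bullet> \<xi>\<bar> / Q \<xi>) y"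

end

theory Submission
  imports Defs "HOL-Probability.Sinc_Integral"
begin

text \<open>
  Put $v = x - y$ and $e = v / |v|$. Multiplying the integrand $|v\cdot\xi| / Q(\xi)$ by a power of
  $|\xi|$ makes it homogeneous of degree $-n$, so its integral over the unit sphere equals the
  integral over any other surface enclosing the origin, here over the cylinder
  $\{\eta + s e : |\eta| = 1, \eta \perp e\}$. The power is $|\xi|^{-2(j+1)}$ with
  $n = 2m + 2j + 1$, and since every Laplacian of $\delta^{(k)}(v\cdot\xi)$ in $v$ produces a factor
  $|\xi|^2$, the $j + 1$ Laplacians cancel it exactly: what remains is
  $2\int\int \delta^{(2j)}(v\cdot\xi) / Q(\xi) \, ds \, d\eta$, whose inner integral is
  $|v|^{-2j-1}\,\partial_e^{2j} (1/Q)(\eta)$.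

  The change of surface needs $\mathcal{H}^{n-1}$ and $\mathcal{H}^{n-2}$ on spheres including their
  normalisation. This reduces, by charts that are nearly isometric on small caps, to
  $\mathcal{H}^k$ being Lebesgue measure on $k$-dimensional space, that is to Vitali's
  covering theorem and the isodiametric inequality.
\<close>

section \<open>Hausdorff outer measures are metric outer measures\<close>

text \<open>No distribution is ever formed. Two derivatives of |s - t| against a continuous weight g
  produce 2 g(t) by the fundamental theorem of calculus; from then on the parameter sits in the
  point of evaluation, and each further derivative is an ordinary derivative of a rational function
  along e. This needs |s| g to be integrable on every line of the cylinder. It is, because g has
  degree -(2m + 2j + 2), which is at most -4 for m >= 1. The Laplacians act on z in a neighbourhood
  of y, so the surface must not move with z: e is frozen at (x - y) / |x - y| and the formula is
  derived on the open half-space of all z with positive \<open>height z\<close>. At z = y every line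
  of the cylinder meets the hyperplane at s = 0, that is, on the equator itself. Surface measure is
  replaced by \<open>cone_measure\<close>, which comes from Lebesgue measure on a spherical shell.
  Homogeneous integrands then move between surfaces by scaling and Fubini alone, without an area
  formula. The final constant is -1 / (4 (2 pi)^(n-1)) times 2 (-1)^(j+1): the 2 is the jump of sgn,
  the sign comes from j + 1 negated Laplacians.\<close>

lemma hausdorff_gauge_empty [simp]: "hausdorff_gauge k {} = 0"
  by (simp add: hausdorff_gauge_def)

lemma hausdorff_content_empty:
  assumes "\<delta> > 0"
  shows "hausdorff_content k \<delta> ({} :: 'a::metric_space set) = 0"
proof -
  have "hausdorff_content k \<delta> ({} :: 'a set) \<le> (\<Sum>i::nat. hausdorff_gauge k ({} :: 'a set))"
    unfolding hausdorff_content_def using assms by (intro INF_lower2[where i="\<lambda>_. {}"]) auto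
  then show ?thesis by simp
qed

lemma hausdorff_content_le:
  assumes "E \<subseteq> (\<Union>i. C i)" "\<And>i. bounded (C i)" "\<And>i. diameter (C i) \<le> \<delta>"
  shows "hausdorff_content k \<delta> E \<le> (\<Sum>i. hausdorff_gauge k (C i))"
  unfolding hausdorff_content_def using assms by (intro INF_lower) auto

lemma hausdorff_content_mono:
  assumes "E \<subseteq> F"
  shows "hausdorff_content k \<delta> E \<le> hausdorff_content k \<delta> F"
  unfolding hausdorff_content_def using assms by (intro INF_superset_mono) auto

lemma hausdorff_content_antimono:
  assumes "\<delta> \<le> \<delta>'"
  shows "hausdorff_content k \<delta>' E \<le> hausdorff_content k \<delta> E"
  unfolding hausdorff_content_def using assms by (intro INF_superset_mono) (auto intro: order_trans)

lemma hausdorff_content_subadditive: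
  "hausdorff_content k \<delta> (\<Union>i. A i) \<le> (\<Sum>i. hausdorff_content k \<delta> (A i))"
proof (rule ennreal_le_epsilon)
  fix e :: real assume fin: "(\<Sum>i. hausdorff_content k \<delta> (A i)) < top" and e: "0 < e"
  have "\<exists>B. A n \<subseteq> (\<Union>i. B i) \<and> (\<forall>i. bounded (B i) \<and> diameter (B i) \<le> \<delta>) \<and>
      (\<Sum>i. hausdorff_gauge k (B i)) < hausdorff_content k \<delta> (A n) + e * (1/2)^Suc n" for n
  proof -
    have "hausdorff_content k \<delta> (A n) < hausdorff_content k \<delta> (A n) + e * (1/2)^Suc n"
      using e fin by (auto simp add: less_top dest!: ennreal_suminf_lessD)
    then show ?thesis
      by (subst (asm) (1) hausdorff_content_def) (auto simp: INF_less_iff)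
  qed
  then obtain B where B: "\<And>n. A n \<subseteq> (\<Union>i. B n i)" "\<And>n i. bounded (B n i)"
      "\<And>n i. diameter (B n i) \<le> \<delta>"
      "\<And>n. (\<Sum>i. hausdorff_gauge k (B n i)) < hausdorff_content k \<delta> (A n) + e * (1/2)^Suc n"
    by metis
  define C where "C = case_prod B o prod_decode"
  have "(\<Union>i. A i) \<subseteq> (\<Union>i. C i)"
    using B(1) by (auto simp add: C_def subset_eq) (metis prod.case prod_encode_inverse)
  then have "hausdorff_content k \<delta> (\<Union>i. A i) \<le> (\<Sum>i. hausdorff_gauge k (C i))"
    using B by (intro hausdorff_content_le) (auto simp: C_def split_def)
  also have "\<dots> = (\<Sum>n. \<Sum>i. hausdorff_gauge k (B n i))"
    using suminf_ennreal_2dimen[where f="\<lambda>(n,i). hausdorff_gauge k (B n i)", OF refl]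
    unfolding C_def comp_def by (simp only: split_def fst_conv snd_conv)
  also have "\<dots> \<le> (\<Sum>n. hausdorff_content k \<delta> (A n) + e * (1/2) ^ Suc n)"
    using B(4) by (intro suminf_le allI) (auto intro: less_imp_le)
  also have "\<dots> = (\<Sum>n. hausdorff_content k \<delta> (A n)) + (\<Sum>n. ennreal e * ennreal ((1/2) ^ Suc n))"
    using e by (subst suminf_add[symmetric])
      (auto simp del: ennreal_suminf_cmult simp add: ennreal_mult[symmetric])
  also have "\<dots> = (\<Sum>n. hausdorff_content k \<delta> (A n)) + e"
    unfolding ennreal_suminf_cmult
    by (subst suminf_ennreal_eq[OF zero_le_power power_half_series]) auto
  finally show "hausdorff_content k \<delta> (\<Union>i. A i) \<le> (\<Sum>n. hausdorff_content k \<delta> (A n)) + e" .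
qed

lemma hausdorff_content_le_outer:
  "\<delta> > 0 \<Longrightarrow> hausdorff_content k \<delta> E \<le> hausdorff_outer_measure k E"
  unfolding hausdorff_outer_measure_def by (intro SUP_upper) auto

lemma hausdorff_outer_empty [simp]: "hausdorff_outer_measure k {} = 0"
  unfolding hausdorff_outer_measure_def by (simp add: hausdorff_content_empty)

lemma hausdorff_outer_mono:
  "E \<subseteq> F \<Longrightarrow> hausdorff_outer_measure k E \<le> hausdorff_outer_measure k F"
  unfolding hausdorff_outer_measure_def by (intro SUP_mono) (auto intro: hausdorff_content_mono)

lemma hausdorff_outer_subadditive:
  "hausdorff_outer_measure k (\<Union>i. A i) \<le> (\<Sum>i. hausdorff_outer_measure k (A i))"
proof -
  have "hausdorff_content k \<delta> (\<Union>i. A i) \<le> (\<Sum>i. hausdorff_outer_measure k (A i))" if "\<delta> > 0" for \<delta>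
    using that by (intro order_trans[OF hausdorff_content_subadditive] suminf_le)
      (auto intro: hausdorff_content_le_outer)
  then show ?thesis
    by (subst hausdorff_outer_measure_def) (auto intro: SUP_least)
qed

lemma hausdorff_outer_Un:
  "hausdorff_outer_measure k (A \<union> B) \<le> hausdorff_outer_measure k A + hausdorff_outer_measure k B"
proof -
  have "hausdorff_outer_measure k (\<Union>i. binaryset A B i) \<le> (\<Sum>i. hausdorff_outer_measure k (binaryset A B i))"
    by (rule hausdorff_outer_subadditive)
  then show ?thesis
    using suminf_binaryset_eq[of "hausdorff_outer_measure k" A B] by (simp add: UN_binaryset_eq)
qed

text \<open>A covering set of diameter below \<open>d\<close> cannot meet both \<open>A\<close> and
  \<open>B\<close>, so every sufficiently fine cover of the union splits into a cover of
  \<open>A\<close> and a cover of \<open>B\<close>.\<close>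

lemma hausdorff_outer_metric:
  fixes A B :: "'a::metric_space set"
  assumes d: "d > 0" and sep: "\<And>a b. a \<in> A \<Longrightarrow> b \<in> B \<Longrightarrow> d \<le> dist a b"
  shows "hausdorff_outer_measure k (A \<union> B) = hausdorff_outer_measure k A + hausdorff_outer_measure k B"
proof (rule antisym[OF hausdorff_outer_Un])
  have split: "hausdorff_content k \<delta> A + hausdorff_content k \<delta> B \<le> hausdorff_content k \<delta> (A \<union> B)"
    if "\<delta> < d" for \<delta>
    unfolding hausdorff_content_def[of k \<delta> "A \<union> B"]
  proof (rule INF_greatest, safe)
    fix C :: "nat \<Rightarrow> 'a set"
    assume C: "A \<union> B \<subseteq> (\<Union>i. C i)" "\<forall>i. bounded (C i) \<and> diameter (C i) \<le> \<delta>"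
    define CA where "CA i = (if C i \<inter> A = {} then {} else C i)" for i
    define CB where "CB i = (if C i \<inter> B = {} then {} else C i)" for i
    have disj: "CA i = {} \<or> CB i = {}" for i
    proof (rule ccontr)
      assume "\<not> (CA i = {} \<or> CB i = {})"
      then obtain a b where "a \<in> C i" "a \<in> A" "b \<in> C i" "b \<in> B"
        by (auto simp: CA_def CB_def split: if_splits)
      then have "d \<le> dist a b" "dist a b \<le> diameter (C i)"
        using sep C(2) by (auto intro: diameter_bounded_bound)
      then show False using C(2) \<open>\<delta> < d\<close> by (metis not_le order_trans)
    qed
    have le: "hausdorff_gauge k (CA i) + hausdorff_gauge k (CB i) \<le> hausdorff_gauge k (C i)" for i
      using disj[of i] by (cases "C i \<inter> A = {}"; cases "C i \<inter> B = {}") (auto simp: CA_def CB_def)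
    have "\<delta> \<ge> 0" using C(2) diameter_ge_0 order_trans by blast
    have "A \<subseteq> (\<Union>i. CA i)" "B \<subseteq> (\<Union>i. CB i)"
      using C(1) unfolding CA_def CB_def by (fastforce split: if_splits)+
    then have "hausdorff_content k \<delta> A \<le> (\<Sum>i. hausdorff_gauge k (CA i))"
      using C \<open>\<delta> \<ge> 0\<close> by (intro hausdorff_content_le) (auto simp: CA_def)
    moreover have "hausdorff_content k \<delta> B \<le> (\<Sum>i. hausdorff_gauge k (CB i))"
      using C \<open>\<delta> \<ge> 0\<close> \<open>B \<subseteq> (\<Union>i. CB i)\<close> by (intro hausdorff_content_le) (auto simp: CB_def)
    ultimately have "hausdorff_content k \<delta> A + hausdorff_content k \<delta> B
        \<le> (\<Sum>i. hausdorff_gauge k (CA i)) + (\<Sum>i. hausdorff_gauge k (CB i))"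
      by (rule add_mono)
    also have "\<dots> = (\<Sum>i. hausdorff_gauge k (CA i) + hausdorff_gauge k (CB i))"
      by (rule suminf_add) auto
    also have "\<dots> \<le> (\<Sum>i. hausdorff_gauge k (C i))"
      by (intro suminf_le le) auto
    finally show "hausdorff_content k \<delta> A + hausdorff_content k \<delta> B \<le> (\<Sum>i. hausdorff_gauge k (C i))" .
  qed
  have "hausdorff_content k \<delta>1 A + hausdorff_content k \<delta>2 B \<le> hausdorff_outer_measure k (A \<union> B)"
    if "\<delta>1 > 0" "\<delta>2 > 0" for \<delta>1 \<delta>2
  proof -
    \<comment> \<open>The two suprema run over independent scales; a common finer scale dominates
      both, and d/2 keeps it strictly below the separation.\<close>
    define \<delta> where "\<delta> = min (min \<delta>1 \<delta>2) (d/2)"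
    have \<delta>: "0 < \<delta>" "\<delta> < d" "\<delta> \<le> \<delta>1" "\<delta> \<le> \<delta>2" using that d by (auto simp: \<delta>_def)
    have "hausdorff_content k \<delta>1 A + hausdorff_content k \<delta>2 B
        \<le> hausdorff_content k \<delta> A + hausdorff_content k \<delta> B"
      using \<delta> by (intro add_mono hausdorff_content_antimono)
    also have "\<dots> \<le> hausdorff_outer_measure k (A \<union> B)"
      using split[OF \<delta>(2)] hausdorff_content_le_outer[OF \<delta>(1)] order_trans by blast
    finally show ?thesis .
  qed
  then have "(SUP \<delta>1\<in>{0<..}. SUP \<delta>2\<in>{0<..}. hausdorff_content k \<delta>1 A + hausdorff_content k \<delta>2 B)
      \<le> hausdorff_outer_measure k (A \<union> B)"
    by (intro SUP_least) auto
  then show "hausdorff_outer_measure k A + hausdorff_outer_measure k B \<le> hausdorff_outer_measure k (A \<union> B)"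
    unfolding hausdorff_outer_measure_def
    by (subst (asm) ennreal_SUP_add_right[symmetric], simp) (subst (asm) ennreal_SUP_add_left, auto)
qed

text \<open>The gap may shrink as the index grows, but finitely many gaps have a positive minimum,
  so each new set is at positive distance from the union of the earlier ones.\<close>

lemma hausdorff_outer_separated_sum:
  fixes R :: "nat \<Rightarrow> 'a::metric_space set" and \<epsilon> :: "nat \<Rightarrow> real"
  assumes sep: "\<And>i j a b. i < j \<Longrightarrow> a \<in> R i \<Longrightarrow> b \<in> R j \<Longrightarrow> \<epsilon> i \<le> dist a b"
    and pos: "\<And>i. \<epsilon> i > 0"
  shows "(\<Sum>i<N. hausdorff_outer_measure k (R i)) = hausdorff_outer_measure k (\<Union>i<N. R i)"
proof (induction N)
  case (Suc N)
  have "hausdorff_outer_measure k ((\<Union>i<N. R i) \<union> R N)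
      = hausdorff_outer_measure k (\<Union>i<N. R i) + hausdorff_outer_measure k (R N)"
  proof (cases "N = 0")
    case False
    then show ?thesis
      by (intro hausdorff_outer_metric[where d="Min (\<epsilon> ` {..<N})"])
        (auto simp: pos Min_le_iff lessThan_empty_iff intro: sep)
  qed auto
  then show ?case using Suc by (simp add: lessThan_Suc Un_commute)
qed auto

text \<open>Caratheodory's criterion for closed sets. The points \<open>A n\<close> at distance at
  least \<open>r n\<close> from \<open>F\<close> are metrically separated from \<open>F\<close>;
  what they miss of \<open>X - F\<close> is a tail of the shells \<open>R i\<close>. Shells of equal
  parity are separated from each other, so the measures of all shells sum to at most twice that of
  \<open>X\<close> and the tails vanish.\<close>

lemma hausdorff_outer_closed_split:
  fixes F X :: "'a::metric_space set"
  assumes "closed F"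
  shows "hausdorff_outer_measure k (X \<inter> F) + hausdorff_outer_measure k (X - F) = hausdorff_outer_measure k X"
\<comment> \<open>\<open>infdist\<close> to the empty set is 0 by convention, so the shells make
  sense only for nonempty \<open>F\<close>; finite measure is needed for the cancellation at the
  end.\<close>
proof (cases "F = {} \<or> hausdorff_outer_measure k X = top")
  case True
  then show ?thesis
    using hausdorff_outer_Un[of k "X \<inter> F" "X - F"] by (auto simp: Int_Diff_Un top_unique)
next
  case False
  then have ne: "F \<noteq> {}" and fin: "hausdorff_outer_measure k X < top" by (auto simp: less_top)
  let ?H = "hausdorff_outer_measure k"
  define r where "r n = 1 / real (n + 1)" for n
  have r: "r n > 0" "m < n \<Longrightarrow> r n < r m" for m n
    by (auto simp: r_def field_simps)
  define A where "A n = {x\<in>X. r n \<le> infdist x F}" for n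
  define R where "R n = {x\<in>X. r (n+1) \<le> infdist x F \<and> infdist x F < r n}" for n
  have gap: "r (n + 1) - r m \<le> dist x y" if "x \<in> R n" "y \<in> R m" for x y m n
    using that infdist_triangle[of x F y] by (auto simp: R_def dist_commute)
  have gap': "r (n + 1) - r (n + 2) \<le> dist x y" if "x \<in> R n" "y \<in> R m" "n + 2 \<le> m" for x y m n
    using gap[OF that(1,2)] that(3) r(2)[of "n+2" m] by (cases "m = n + 2") auto
  \<comment> \<open>The cases c = 0 and c = 1 are the shells of even and of odd index. Neighbouring
    shells may touch, hence the step of two.\<close>
  have even: "(\<Sum>i<N. ?H (R (2 * i + c))) \<le> ?H X" for N c
  proof -
    have "(\<Sum>i<N. ?H (R (2 * i + c))) = ?H (\<Union>i<N. R (2 * i + c))"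
    proof (rule hausdorff_outer_separated_sum[where \<epsilon>="\<lambda>i. r (2 * i + c + 1) - r (2 * i + c + 2)"])
      fix i j a b assume "i < j" "a \<in> R (2 * i + c)" "b \<in> R (2 * j + c)"
      then show "r (2 * i + c + 1) - r (2 * i + c + 2) \<le> dist a b"
        by (intro gap'[of a _ b "2 * j + c"]) auto
    qed (simp add: r(2))
    also have "\<dots> \<le> ?H X" by (rule hausdorff_outer_mono) (auto simp: R_def)
    finally show ?thesis .
  qed
  have part: "(\<Sum>i<2*N. ?H (R i)) = (\<Sum>i<N. ?H (R (2*i+0))) + (\<Sum>i<N. ?H (R (2*i+1)))" for N
    by (induction N) (auto simp: algebra_simps)
  have "(\<Sum>i<N. ?H (R i)) \<le> ?H X + ?H X" for N
  proof -
    have "(\<Sum>i<N. ?H (R i)) \<le> (\<Sum>i<2*N. ?H (R i))" by (rule sum_mono2) auto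
    also have "\<dots> \<le> ?H X + ?H X" unfolding part by (intro add_mono even)
    finally show ?thesis .
  qed
  then have "(\<Sum>i. ?H (R i)) \<le> ?H X + ?H X" by (intro suminf_le_const) auto
  then have total: "(\<Sum>i. ?H (R i)) < top" using fin by (metis ennreal_add_less_top le_less_trans)
  have sub: "X - F \<subseteq> A n \<union> (\<Union>i. R (i + n))" for n
  proof
    fix x assume x: "x \<in> X - F"
    then have "infdist x F > 0"
      using assms ne by (metis DiffD2 in_closed_iff_infdist_zero infdist_nonneg less_eq_real_def)
    then obtain l where "r l < infdist x F"
      unfolding r_def by (metis nat_approx_posE Suc_eq_plus1)
    then have ex: "\<exists>l. r l \<le> infdist x F" by (auto intro: less_imp_le)
    define l where "l = (LEAST l. r l \<le> infdist x F)"
    have l: "r l \<le> infdist x F" unfolding l_def using ex by (rule LeastI_ex)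
    have l': "infdist x F < r i" if "i < l" for i using not_less_Least[of i "\<lambda>l. r l \<le> infdist x F"] that
      unfolding l_def by auto
    show "x \<in> A n \<union> (\<Union>i. R (i + n))"
    proof (cases "l \<le> n")
      case True
      then have "r n \<le> infdist x F" using l r(2)[of l n] by (cases "l = n") auto
      then show ?thesis using x by (auto simp: A_def)
    next
      case False
      then have "x \<in> R ((l - 1 - n) + n)" using x l l'[of "l - 1"] by (auto simp: R_def)
      then show ?thesis by blast
    qed
  qed
  \<comment> \<open>Adding the first \<open>n\<close> shells completes the tail to the full series.
    Subtraction in \<open>ennreal\<close> is avoided this way, and the finite series is cancelled
    only after the supremum over \<open>n\<close>.\<close>
  have step: "?H (X \<inter> F) + ?H (X - F) + (\<Sum>i<n. ?H (R i)) \<le> ?H X + (\<Sum>i. ?H (R i))" for n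
  proof -
    have "?H (X - F) \<le> ?H (A n) + ?H (\<Union>i. R (i + n))"
      using hausdorff_outer_mono[OF sub] hausdorff_outer_Un order_trans by blast
    also have "\<dots> \<le> ?H (A n) + (\<Sum>i. ?H (R (i + n)))"
      by (intro add_left_mono hausdorff_outer_subadditive)
    finally have "?H (X \<inter> F) + ?H (X - F) + (\<Sum>i<n. ?H (R i))
        \<le> ?H (X \<inter> F) + (?H (A n) + (\<Sum>i. ?H (R (i + n)))) + (\<Sum>i<n. ?H (R i))"
      by (intro add_mono) auto
    also have "\<dots> = (?H (X \<inter> F) + ?H (A n)) + (\<Sum>i. ?H (R i))"
      using suminf_offset[of "\<lambda>i. ?H (R i)" n] by (simp add: ac_simps)
    also have "?H (X \<inter> F) + ?H (A n) = ?H (X \<inter> F \<union> A n)"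
    proof (rule hausdorff_outer_metric[symmetric, OF r(1)[of n]])
      fix a b assume "a \<in> X \<inter> F" "b \<in> A n"
      then show "r n \<le> dist a b"
        using infdist_le[of a F b] by (auto simp: A_def dist_commute)
    qed
    also have "\<dots> \<le> ?H X" by (rule hausdorff_outer_mono) (auto simp: A_def)
    finally show ?thesis by (simp add: add_right_mono)
  qed
  have "?H (X \<inter> F) + ?H (X - F) + (\<Sum>i. ?H (R i)) \<le> ?H X + (\<Sum>i. ?H (R i))"
  proof -
    have "?H (X \<inter> F) + ?H (X - F) + (\<Sum>i. ?H (R i)) = (SUP n. ?H (X \<inter> F) + ?H (X - F) + (\<Sum>i<n. ?H (R i)))"
      by (subst suminf_eq_SUP) (auto simp: ennreal_SUP_add_right)
    then show ?thesis using step by (auto intro: SUP_least)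
  qed
  then have "(\<Sum>i. ?H (R i)) + (?H (X \<inter> F) + ?H (X - F)) \<le> (\<Sum>i. ?H (R i)) + ?H X"
    by (simp only: add.commute)
  then have "?H (X \<inter> F) + ?H (X - F) \<le> ?H X"
    using total unfolding ennreal_add_left_cancel_le by auto
  then show ?thesis
    using hausdorff_outer_Un[of k "X \<inter> F" "X - F"] by (auto simp: Int_Diff_Un)
qed

lemma sets_hausdorff_measure [simp, measurable_cong]: "sets (hausdorff_measure k) = sets borel"
  unfolding hausdorff_measure_def by (simp add: sets.sigma_sets_eq[of borel, simplified])

lemma space_hausdorff_measure [simp]: "space (hausdorff_measure k) = UNIV"
  by (simp add: hausdorff_measure_def space_measure_of_conv)

text \<open>Caratheodory's theorem: the sets that split every set additively form a sigma-algebra on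
  which the outer measure is countably additive. By \<open>hausdorff_outer_closed_split\<close> it
  contains the closed sets, hence all Borel sets, and \<open>measure_of\<close> returns the given
  set function.\<close>

lemma emeasure_hausdorff_measure:
  fixes A :: "'a::metric_space set"
  assumes "A \<in> sets borel"
  shows "emeasure (hausdorff_measure k) A = hausdorff_outer_measure k A"
proof -
  let ?H = "hausdorff_outer_measure k :: 'a set \<Rightarrow> ennreal"
  interpret P: sigma_algebra "UNIV :: 'a set" "Pow UNIV" by (rule sigma_algebra_Pow)
  define L where "L = lambda_system UNIV (Pow UNIV) ?H"
  have "outer_measure_space (Pow UNIV) ?H"
    unfolding outer_measure_space_def positive_def increasing_def countably_subadditive_def
    by (auto intro: hausdorff_outer_mono hausdorff_outer_subadditive)
  then have ms: "measure_space UNIV L ?H"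
    unfolding L_def by (rule P.caratheodory_lemma)
  then interpret L: sigma_algebra UNIV L by (simp add: measure_space_def)
  have "{F. closed F} \<subseteq> L"
    unfolding L_def P.lambda_system_eq by (auto simp: hausdorff_outer_closed_split)
  then have "sigma_sets UNIV (Collect closed) \<subseteq> L"
    by (rule L.sigma_sets_subset)
  then have sub: "sets borel \<subseteq> L"
    by (simp add: borel_eq_closed)
  have "countably_additive (sets borel) ?H" "positive (sets borel) ?H"
    using ms sub by (auto simp: measure_space_def countably_additive_def positive_def)
  then show ?thesis
    using assms unfolding hausdorff_measure_def
    by (intro emeasure_measure_of_sigma) (auto simp: sets.sigma_algebra_axioms[of borel, simplified])
qed

section \<open>Hausdorff measure under Lipschitz maps and isometries\<close>

lemma hausdorff_outer_lipschitz:
  fixes f :: "'a::metric_space \<Rightarrow> 'b::metric_space"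
  assumes L: "L > 0" and lip: "\<And>x y. x \<in> E \<Longrightarrow> y \<in> E \<Longrightarrow> dist (f x) (f y) \<le> L * dist x y"
  shows "hausdorff_outer_measure k (f ` E) \<le> ennreal (L ^ k) * hausdorff_outer_measure k E"
proof -
  have "hausdorff_content k \<delta> (f ` E) \<le> ennreal (L ^ k) * hausdorff_outer_measure k E" if "\<delta> > 0" for \<delta>
  proof -
    have "hausdorff_content k \<delta> (f ` E) \<le> ennreal (L ^ k) * (\<Sum>i. hausdorff_gauge k (C i))"
      if C: "E \<subseteq> (\<Union>i. C i)" "\<forall>i. bounded (C i) \<and> diameter (C i) \<le> \<delta> / L" for C :: "nat \<Rightarrow> 'a set"
    proof -
      \<comment> \<open>The Lipschitz bound holds on \<open>E\<close> only, so the covering sets are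
        cut down to \<open>E\<close> before they are mapped.\<close>
      define D where "D i = f ` (C i \<inter> E)" for i
      have bd: "dist x y \<le> L * diameter (C i)" if xy: "x \<in> D i" "y \<in> D i" for x y i
      proof -
        obtain u v where uv: "x = f u" "y = f v" "u \<in> C i" "v \<in> C i" "u \<in> E" "v \<in> E"
          using xy unfolding D_def by blast
        then have "dist u v \<le> diameter (C i)" using C(2) by (auto intro: diameter_bounded_bound)
        then show ?thesis using lip[OF uv(5,6)] uv L by (smt (verit) mult_left_mono)
      qed
      have D: "bounded (D i)" for i
        using bd[of _ i] by (auto simp: bounded_two_points)
      have Dd: "diameter (D i) \<le> L * diameter (C i)" for i
        using bd[of _ i] L C(2) diameter_ge_0[of "C i"] by (auto simp: diameter_def[of "D i"] intro!: cSUP_least)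
      have "diameter (D i) \<le> \<delta>" for i
      proof -
        have "L * diameter (C i) \<le> L * (\<delta> / L)" using C(2) L by (intro mult_left_mono) auto
        then show ?thesis using Dd[of i] L by simp
      qed
      then have "hausdorff_content k \<delta> (f ` E) \<le> (\<Sum>i. hausdorff_gauge k (D i))"
        using C(1) D by (intro hausdorff_content_le) (auto simp: D_def subset_eq; blast)
      also have "\<dots> \<le> (\<Sum>i. ennreal (L ^ k) * hausdorff_gauge k (C i))"
      proof (intro suminf_le)
        fix i
        show "hausdorff_gauge k (D i) \<le> ennreal (L ^ k) * hausdorff_gauge k (C i)"
        proof (cases "D i = {}")
          case False
          have "(diameter (D i) / 2) ^ k \<le> (L * diameter (C i) / 2) ^ k"
            using Dd[of i] D diameter_ge_0 by (intro power_mono) auto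
          then have "unit_ball_vol (real k) * (diameter (D i) / 2) ^ k
              \<le> unit_ball_vol (real k) * (L * diameter (C i) / 2) ^ k"
            by (intro mult_left_mono) auto
          also have "\<dots> = L ^ k * (unit_ball_vol (real k) * (diameter (C i) / 2) ^ k)"
            by (simp add: power_mult_distrib power_divide)
          finally have "unit_ball_vol (real k) * (diameter (D i) / 2) ^ k
              \<le> L ^ k * (unit_ball_vol (real k) * (diameter (C i) / 2) ^ k)" .
          moreover have "C i \<noteq> {}" using False by (auto simp: D_def)
          ultimately show ?thesis
            using False L by (simp add: hausdorff_gauge_def ennreal_mult'[symmetric] ennreal_leI)
        qed simp
      qed auto
      finally show ?thesis by simp
    qed
    note le = this
    \<comment> \<open>Moving the factor to the left by its inverse leaves a bare infimum on the
      right, to which \<open>INF_greatest\<close> applies.\<close>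
    have inv: "ennreal (inverse (L ^ k)) * (ennreal (L ^ k) * s) = s"
      "ennreal (L ^ k) * (ennreal (inverse (L ^ k)) * s) = s" for s
      using L by (simp_all add: mult.assoc[symmetric] ennreal_mult'[symmetric])
    have "ennreal (inverse (L ^ k)) * hausdorff_content k \<delta> (f ` E) \<le> hausdorff_content k (\<delta> / L) E"
      unfolding hausdorff_content_def[of k "\<delta> / L"]
    proof (rule INF_greatest, safe)
      fix C :: "nat \<Rightarrow> 'a set"
      assume "E \<subseteq> (\<Union>i. C i)" "\<forall>i. bounded (C i) \<and> diameter (C i) \<le> \<delta> / L"
      from mult_left_mono[OF le[OF this], of "ennreal (inverse (L ^ k))"]
      show "ennreal (inverse (L ^ k)) * hausdorff_content k \<delta> (f ` E) \<le> (\<Sum>i. hausdorff_gauge k (C i))"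
        unfolding inv by simp
    qed
    from mult_left_mono[OF this, of "ennreal (L ^ k)"]
    have "hausdorff_content k \<delta> (f ` E) \<le> ennreal (L ^ k) * hausdorff_content k (\<delta> / L) E"
      unfolding inv by simp
    also have "\<dots> \<le> ennreal (L ^ k) * hausdorff_outer_measure k E"
      using that L by (intro mult_left_mono hausdorff_content_le_outer) auto
    finally show ?thesis .
  qed
  then show ?thesis by (subst hausdorff_outer_measure_def) (auto intro: SUP_least)
qed

corollary hausdorff_outer_isometry:
  fixes f :: "'a::metric_space \<Rightarrow> 'b::metric_space"
  assumes "\<And>x y. x \<in> E \<Longrightarrow> y \<in> E \<Longrightarrow> dist (f x) (f y) = dist x y"
  shows "hausdorff_outer_measure k (f ` E) = hausdorff_outer_measure k E"
proof (rule antisym)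
  show "hausdorff_outer_measure k (f ` E) \<le> hausdorff_outer_measure k E"
    using hausdorff_outer_lipschitz[of 1 E f k] assms by simp
  have inj: "inj_on f E" using assms by (auto simp: inj_on_def) (metis dist_eq_0_iff)
  have "hausdorff_outer_measure k (inv_into E f ` (f ` E)) \<le> hausdorff_outer_measure k (f ` E)"
    using hausdorff_outer_lipschitz[of 1 "f ` E" "inv_into E f" k] assms inj
    by (force simp: inv_into_f_f)
  then show "hausdorff_outer_measure k E \<le> hausdorff_outer_measure k (f ` E)"
    using inj by (simp add: image_inv_into_cancel[OF refl])
qed

section \<open>Hausdorff measure of full dimension is at most Lebesgue measure\<close>

lemma hausdorff_gauge_cball:
  fixes a :: "'a::euclidean_space"
  assumes "r > 0"
  shows "hausdorff_gauge DIM('a) (cball a r) = emeasure lborel (cball a r)"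
  using assms by (simp add: hausdorff_gauge_def emeasure_cball)

text \<open>Disjoint balls inside \<open>U\<close> have total volume at most that of
  \<open>U\<close>, and enlarging them by \<open>c\<close> multiplies each gauge by the same power
  of \<open>c\<close>. The case c = 5 serves the Vitali covering lemma for null sets, c = 1 the
  Vitali covering theorem.\<close>

lemma hausdorff_content_le_balls:
  fixes E U :: "'a::euclidean_space set" and a :: "'i \<Rightarrow> 'a"
  assumes J: "countable J" "pairwise (\<lambda>i j. disjnt (cball (a i) (r i)) (cball (a j) (r j))) J"
    and r: "\<And>j. j \<in> J \<Longrightarrow> 0 < r j \<and> 2 * (c * r j) \<le> \<delta>" and c: "c > 0" and "\<delta> > 0"
    and sub: "\<And>j. j \<in> J \<Longrightarrow> cball (a j) (r j) \<subseteq> U" "U \<in> sets borel"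
    and E: "E \<subseteq> (\<Union>j\<in>J. cball (a j) (c * r j))"
  shows "hausdorff_content DIM('a) \<delta> E \<le> ennreal (c ^ DIM('a)) * emeasure lborel U"
proof -
  \<comment> \<open>A cover must be a sequence, while \<open>J\<close> may be finite; indices
    outside \<open>I\<close> receive the empty set, whose gauge is 0.\<close>
  define I where "I = to_nat_on J ` J"
  define g where "g = from_nat_into J"
  have gJ: "g i \<in> J" if "i \<in> I" for i using that J(1) by (auto simp: I_def g_def)
  have ginj: "g i \<noteq> g i'" if "i \<in> I" "i' \<in> I" "i \<noteq> i'" for i i'
    using that J(1) by (auto simp: I_def g_def)
  have gsurj: "\<exists>i\<in>I. g i = j" if "j \<in> J" for j
    using that J(1) by (auto simp: I_def g_def intro!: bexI[of _ j])
  define B where "B i = (if i \<in> I then cball (a (g i)) (r (g i)) else {})" for i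
  define C where "C i = (if i \<in> I then cball (a (g i)) (c * r (g i)) else {})" for i
  have dB: "disjoint_family B"
    using J(2) gJ ginj by (auto simp: disjoint_family_on_def B_def pairwise_def disjnt_def)
  have CB: "hausdorff_gauge DIM('a) (C i) = ennreal (c ^ DIM('a)) * emeasure lborel (B i)" for i
  proof (cases "i \<in> I")
    case True
    then have "0 < r (g i)" using gJ r by blast
    then show ?thesis using True c
      by (simp add: C_def B_def hausdorff_gauge_cball emeasure_cball power_mult_distrib
          ennreal_mult'[symmetric] ac_simps)
  qed (simp add: C_def B_def)
  have "hausdorff_content DIM('a) \<delta> E \<le> (\<Sum>i. hausdorff_gauge DIM('a) (C i))"
  proof (rule hausdorff_content_le)
    show "E \<subseteq> (\<Union>i. C i)" using E gsurj by (fastforce simp: C_def)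
    show "diameter (C i) \<le> \<delta>" for i
      using gJ[of i] r[of "g i"] c \<open>\<delta> > 0\<close> by (auto simp: C_def)
  qed (auto simp: C_def)
  also have "\<dots> = ennreal (c ^ DIM('a)) * emeasure lborel (\<Union>i. B i)"
    unfolding CB ennreal_suminf_cmult
    by (subst suminf_emeasure[OF _ dB]) (auto simp: B_def)
  also have "\<dots> \<le> ennreal (c ^ DIM('a)) * emeasure lborel U"
    using sub gJ by (intro mult_left_mono emeasure_mono) (auto simp: B_def split: if_splits)
  finally show ?thesis .
qed

text \<open>Vitali's theorem leaves a null set uncovered, so null sets need a bound of their own:
  enclose the set in an open set of tiny measure and cover it there by fivefold enlargements of
  disjoint balls.\<close>

lemma hausdorff_content_negligible:
  fixes N :: "'a::euclidean_space set"
  assumes N: "negligible N" and "\<delta> > 0"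
  shows "hausdorff_content DIM('a) \<delta> N = 0"
proof -
  have le: "hausdorff_content DIM('a) \<delta> N \<le> ennreal e" if "e > 0" for e
  proof -
    define e' where "e' = e / 5 ^ DIM('a)"
    have e': "e' > 0" using that by (simp add: e'_def)
    obtain V where V: "open V" "N \<subseteq> V" "emeasure lebesgue (V - N) < ennreal e'"
      by (rule sets_lebesgue_outer_open[OF negligible_imp_sets[OF N] e'])
    have "emeasure lebesgue V \<le> emeasure lebesgue (V - N) + emeasure lebesgue N"
    proof -
      have "V \<in> sets lebesgue" "N \<in> sets lebesgue"
        using N V(1) by (auto simp: borel_open negligible_imp_sets)
      then show ?thesis
        using emeasure_subadditive[of "V - N" lebesgue N] V(2) by (simp add: Un_absorb2)
    qed
    also have "emeasure lebesgue N = 0" using N unfolding negligible_iff_null_sets by (rule null_setsD1)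
    finally have Ve: "emeasure lborel V < ennreal e'" using V by simp
    \<comment> \<open>After the fivefold enlargement the diameter 2 * 5 * r must still be at most
      \<open>\<delta>\<close>.\<close>
    have "\<exists>r. 0 < r \<and> r \<le> \<delta> / 10 \<and> cball x r \<subseteq> V" if x: "x \<in> V" for x
    proof -
      obtain s where "s > 0" "cball x s \<subseteq> V" using V(1) x open_contains_cball by blast
      then show ?thesis using \<open>\<delta> > 0\<close> by (intro exI[of _ "min s (\<delta>/10)"]) auto
    qed
    then obtain r where r: "\<And>x. x \<in> V \<Longrightarrow> 0 < r x \<and> r x \<le> \<delta> / 10 \<and> cball x (r x) \<subseteq> V" by metis
    have rV: "0 < r i \<and> r i \<le> \<delta> / 10" if "i \<in> V" for i using r that by blast
    obtain C where C: "countable C" "C \<subseteq> V"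
        "pairwise (\<lambda>i j. disjnt (cball i (r i)) (cball j (r j))) C"
        "\<And>i. i \<in> V \<Longrightarrow> \<exists>j. j \<in> C \<and> \<not> disjnt (cball i (r i)) (cball j (r j)) \<and> cball i (r i) \<subseteq> ball j (5 * r j)"
    proof (rule Vitali_covering_lemma_cballs_balls[of V r "\<delta>/10" "\<lambda>x. x", OF rV])
      fix C assume "countable C" "C \<subseteq> V"
        "pairwise (\<lambda>i j. disjnt (cball i (r i)) (cball j (r j))) C"
        "\<And>i. i \<in> V \<Longrightarrow> \<exists>j. j \<in> C \<and> \<not> disjnt (cball i (r i)) (cball j (r j)) \<and> cball i (r i) \<subseteq> ball j (5 * r j)"
      then show thesis by (intro that[of C]) auto
    qed
    have cov: "N \<subseteq> (\<Union>j\<in>C. cball j (5 * r j))"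
    proof
      fix x assume "x \<in> N"
      then have "x \<in> V" using V by auto
      with C(4)[OF this] r[OF this] have "\<exists>j\<in>C. x \<in> ball j (5 * r j)"
        by (meson centre_in_cball less_imp_le subsetD)
      then show "x \<in> (\<Union>j\<in>C. cball j (5 * r j))" by force
    qed
    have "hausdorff_content DIM('a) \<delta> N \<le> ennreal (5 ^ DIM('a)) * emeasure lborel V"
    proof (rule hausdorff_content_le_balls[OF C(1,3) _ _ \<open>\<delta> > 0\<close> _ _ cov])
      show "0 < r j \<and> 2 * (5 * r j) \<le> \<delta>" "cball j (r j) \<subseteq> V" if "j \<in> C" for j
        using r[of j] C(2) that by auto
    qed (use V(1) in auto)
    also have "\<dots> \<le> ennreal (5 ^ DIM('a)) * ennreal e'"
      using Ve by (intro mult_left_mono) auto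
    also have "\<dots> = ennreal e" using that by (simp add: e'_def ennreal_mult'[symmetric])
    finally show ?thesis .
  qed
  then show ?thesis
    by (metis add_0 ennreal_le_epsilon le_zero_eq)
qed

text \<open>Small disjoint balls inside an open set of nearly the same measure fill \<open>A\<close>
  up to a null set, and the gauge of a ball is exactly its volume.\<close>

lemma hausdorff_outer_le_lborel:
  fixes A :: "'a::euclidean_space set"
  assumes A: "A \<in> sets borel"
  shows "hausdorff_outer_measure DIM('a) A \<le> emeasure lborel A"
proof -
  have "hausdorff_content DIM('a) \<delta> A \<le> emeasure lborel A" if "\<delta> > 0" for \<delta>
  proof (rule ennreal_le_epsilon)
    fix e :: real assume fin: "emeasure lborel A < top" and e: "0 < e"
    obtain U where U: "open U" "A \<subseteq> U" "emeasure lebesgue (U - A) < ennreal e"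
    proof (rule sets_lebesgue_outer_open)
      show "A \<in> sets lebesgue" using A by simp
    qed (rule e)
    have "emeasure lborel U = emeasure lborel (U - A) + emeasure lborel A"
      using U A by (subst plus_emeasure) (auto simp: Un_absorb2)
    also have "\<dots> \<le> emeasure lborel A + ennreal e"
      using U A by (simp add: add.commute add_left_mono less_imp_le)
    finally have Ue: "emeasure lborel U \<le> emeasure lborel A + ennreal e" .
    define K where "K = {(x, r). 0 < r \<and> 2 * r \<le> \<delta> \<and> cball x r \<subseteq> U}"
    have Kpos: "0 < snd i" if "i \<in> K" for i using that by (auto simp: K_def)
    have Kfine: "\<exists>i. i \<in> K \<and> x \<in> cball (fst i) (snd i) \<and> snd i < d" if xd: "x \<in> A" "0 < d" for x d
    proof -
      obtain s where "s > 0" "cball x s \<subseteq> U" using U xd open_contains_cball by blast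
      then have "(x, min (min s (\<delta>/2)) (d/2)) \<in> K" using \<open>\<delta> > 0\<close> xd subset_cball[of "min (min s (\<delta>/2)) (d/2)" s x]
        by (auto simp: K_def)
      then show ?thesis using \<open>\<delta> > 0\<close> \<open>s > 0\<close> xd(2)
        by (intro exI[where x="(x, min (min s (\<delta>/2)) (d/2))"]) simp
    qed
    obtain C where C: "countable C" "C \<subseteq> K"
        "pairwise (\<lambda>i j. disjnt (cball (fst i) (snd i)) (cball (fst j) (snd j))) C"
        "negligible (A - (\<Union>i\<in>C. cball (fst i) (snd i)))"
      using Vitali_covering_theorem_cballs[of K snd A fst, OF Kpos Kfine] by blast
    let ?N = "A - (\<Union>i\<in>C. cball (fst i) (snd i))"
    have "hausdorff_content DIM('a) \<delta> (A \<inter> (\<Union>i\<in>C. cball (fst i) (snd i))) \<le> ennreal (1 ^ DIM('a)) * emeasure lborel U"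
    proof (rule hausdorff_content_le_balls[OF C(1,3) _ _ \<open>\<delta> > 0\<close>])
      show "0 < snd j \<and> 2 * (1 * snd j) \<le> \<delta>" "cball (fst j) (snd j) \<subseteq> U" if "j \<in> C" for j
        using subsetD[OF C(2) that] by (auto simp: K_def split_def)
    qed (use U(1) in auto)
    moreover have "hausdorff_content DIM('a) \<delta> A
        \<le> hausdorff_content DIM('a) \<delta> (A \<inter> (\<Union>i\<in>C. cball (fst i) (snd i))) + hausdorff_content DIM('a) \<delta> ?N"
    proof -
      let ?D = "binaryset (A \<inter> (\<Union>i\<in>C. cball (fst i) (snd i))) ?N"
      have "hausdorff_content DIM('a) \<delta> (\<Union>i. ?D i) \<le> (\<Sum>i. hausdorff_content DIM('a) \<delta> (?D i))"
        by (rule hausdorff_content_subadditive)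
      then show ?thesis
        using suminf_binaryset_eq[of "hausdorff_content DIM('a) \<delta>" "A \<inter> (\<Union>i\<in>C. cball (fst i) (snd i))" ?N] that
        by (simp add: UN_binaryset_eq hausdorff_content_empty Int_Diff_Un)
    qed
    ultimately show "hausdorff_content DIM('a) \<delta> A \<le> emeasure lborel A + ennreal e"
      using hausdorff_content_negligible[OF C(4) \<open>\<delta> > 0\<close>] Ue by simp
  qed
  then show ?thesis unfolding hausdorff_outer_measure_def by (auto intro: SUP_least)
qed

section \<open>The isodiametric inequality by Steiner symmetrization\<close>

text \<open>The base point is arbitrary, not restricted to the hyperplane orthogonal to
  \<open>i\<close>; moving it along \<open>i\<close> only translates the fibre.\<close>

definition fibre :: "'a::euclidean_space \<Rightarrow> 'a set \<Rightarrow> 'a \<Rightarrow> real set" where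
  "fibre i A x = {t. x + t *\<^sub>R i \<in> A}"

text \<open>Every line parallel to \<open>i\<close> keeps the open interval centred at height 0
  whose length is that of its fibre; the factor 2 compares half-width with length. The strict
  inequality drops lines with null fibre and is exploited in \<open>steiner_dist_le\<close>.\<close>

definition steiner :: "'a::euclidean_space \<Rightarrow> 'a set \<Rightarrow> 'a set" where
  "steiner i A = {x. ennreal (2 * \<bar>x \<bullet> i\<bar>) < emeasure lborel (fibre i A x)}"

lemma fibre_borel [measurable]:
  assumes [measurable]: "A \<in> sets borel"
  shows "fibre i A x \<in> sets borel"
proof -
  have "(\<lambda>t. x + t *\<^sub>R i) -` A \<inter> space borel \<in> sets borel" by measurable
  then show ?thesis by (simp add: fibre_def vimage_def)
qed

lemma emeasure_fibre:
  assumes [measurable]: "A \<in> sets borel"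
  shows "emeasure lborel (fibre i A x) = (\<integral>\<^sup>+t. indicator A (x + t *\<^sub>R i) \<partial>lborel)"
proof -
  have "(\<integral>\<^sup>+t. indicator A (x + t *\<^sub>R i) \<partial>lborel) = (\<integral>\<^sup>+t. indicator (fibre i A x) t \<partial>lborel)"
    by (intro nn_integral_cong) (auto simp: fibre_def indicator_def)
  then show ?thesis using fibre_borel[OF assms] by simp
qed

lemma emeasure_fibre_measurable [measurable]:
  assumes [measurable]: "A \<in> sets borel"
  shows "(\<lambda>x. emeasure lborel (fibre i A x)) \<in> borel_measurable borel"
  unfolding emeasure_fibre[OF assms] by measurable

lemma steiner_borel [measurable]:
  assumes [measurable]: "A \<in> sets borel"
  shows "steiner i A \<in> sets borel"
  unfolding steiner_def by measurable

text \<open>Translating by \<^term>\<open>t *\<^sub>R i\<close> under Fubini's theorem, the slab \<open>0 \<le> x \<bullet> i < 1\<close> stands in for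
  the hyperplane orthogonal to \<open>i\<close>, so no product decomposition of the space is needed.\<close>
lemma emeasure_eq_fibres:
  fixes A :: "'a::euclidean_space set"
  assumes i: "i \<in> Basis" and A[measurable]: "A \<in> sets borel"
  shows "emeasure lborel A
    = (\<integral>\<^sup>+x. indicator {x. 0 \<le> x \<bullet> i \<and> x \<bullet> i < 1} x * emeasure lborel (fibre i A x) \<partial>lborel)"
proof -
  let ?I = "indicator {x. 0 \<le> x \<bullet> i \<and> x \<bullet> i < 1} :: 'a \<Rightarrow> ennreal"
  have "(\<integral>\<^sup>+x. ?I x * emeasure lborel (fibre i A x) \<partial>lborel)
      = (\<integral>\<^sup>+x. (\<integral>\<^sup>+t. ?I x * indicator A (x + t *\<^sub>R i) \<partial>lborel) \<partial>lborel)"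
    by (simp add: emeasure_fibre nn_integral_cmult)
  also have "\<dots> = (\<integral>\<^sup>+t. (\<integral>\<^sup>+x. ?I x * indicator A (x + t *\<^sub>R i) \<partial>lborel) \<partial>lborel)"
    by (rule lborel_pair.Fubini'[symmetric]) measurable
  also have "\<dots> = (\<integral>\<^sup>+t. (\<integral>\<^sup>+x. ?I (x - t *\<^sub>R i) * indicator A x \<partial>lborel) \<partial>lborel)"
  proof (rule nn_integral_cong)
    fix t :: real
    have "(\<integral>\<^sup>+x. ?I (x - t *\<^sub>R i) * indicator A x \<partial>lborel)
        = (\<integral>\<^sup>+x. ?I (x - t *\<^sub>R i) * indicator A x \<partial>distr lborel borel ((+) (t *\<^sub>R i)))"
      by (simp add: lborel_distr_plus)
    also have "\<dots> = (\<integral>\<^sup>+x. ?I x * indicator A (x + t *\<^sub>R i) \<partial>lborel)"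
      by (subst nn_integral_distr) (auto simp: add.commute)
    finally show "(\<integral>\<^sup>+x. ?I x * indicator A (x + t *\<^sub>R i) \<partial>lborel)
      = (\<integral>\<^sup>+x. ?I (x - t *\<^sub>R i) * indicator A x \<partial>lborel)" ..
  qed
  also have "\<dots> = (\<integral>\<^sup>+x. (\<integral>\<^sup>+t. ?I (x - t *\<^sub>R i) * indicator A x \<partial>lborel) \<partial>lborel)"
    by (rule lborel_pair.Fubini') measurable
  also have "\<dots> = (\<integral>\<^sup>+x. indicator A x \<partial>lborel)"
  proof (rule nn_integral_cong)
    fix x :: 'a
    have "(\<integral>\<^sup>+t. ?I (x - t *\<^sub>R i) \<partial>lborel) = (\<integral>\<^sup>+t. indicator {x \<bullet> i - 1 <.. x \<bullet> i} t \<partial>lborel)"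
      using i by (intro nn_integral_cong) (auto simp: indicator_def inner_diff_left)
    then show "(\<integral>\<^sup>+t. ?I (x - t *\<^sub>R i) * indicator A x \<partial>lborel) = indicator A x"
      by (simp add: nn_integral_multc)
  qed
  finally show ?thesis by simp
qed

lemma emeasure_fibre_translate [simp]:
  assumes [measurable]: "A \<in> sets borel"
  shows "emeasure lborel (fibre i A (x + s *\<^sub>R i)) = emeasure lborel (fibre i A x)"
proof -
  have "(\<integral>\<^sup>+t. indicator A (x + t *\<^sub>R i) \<partial>lborel) = (\<integral>\<^sup>+t. indicator A (x + t *\<^sub>R i) \<partial>distr lborel borel ((+) s))"
    by (simp add: lborel_distr_plus)
  also have "\<dots> = (\<integral>\<^sup>+t. indicator A (x + s *\<^sub>R i + t *\<^sub>R i) \<partial>lborel)"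
    by (subst nn_integral_distr) (auto simp: algebra_simps)
  finally show ?thesis by (simp add: emeasure_fibre)
qed

lemma emeasure_fibre_steiner:
  fixes A :: "'a::euclidean_space set"
  assumes i: "i \<in> Basis" and A[measurable]: "A \<in> sets borel"
  shows "emeasure lborel (fibre i (steiner i A) x) = emeasure lborel (fibre i A x)"
proof -
  let ?l = "emeasure lborel (fibre i A x)"
  have eq: "fibre i (steiner i A) x = {t. ennreal (2 * \<bar>x \<bullet> i + t\<bar>) < ?l}"
    using i by (simp add: fibre_def steiner_def emeasure_fibre_translate[unfolded fibre_def] inner_add_left)
  show ?thesis
  proof (cases ?l)
    case (real r)
    have "fibre i (steiner i A) x = {- (x \<bullet> i) - r/2 <..< - (x \<bullet> i) + r/2}"
    proof (intro set_eqI)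
      fix t :: real
      have "2 * \<bar>x \<bullet> i + t\<bar> < r \<longleftrightarrow> - (x \<bullet> i) - r/2 < t \<and> t < - (x \<bullet> i) + r/2"
        unfolding abs_if by (auto split: if_splits)
      then show "t \<in> fibre i (steiner i A) x \<longleftrightarrow> t \<in> {- (x \<bullet> i) - r/2 <..< - (x \<bullet> i) + r/2}"
        using real unfolding eq by (simp add: ennreal_less_iff)
    qed
    then show ?thesis using real by simp
  next
    case top
    then show ?thesis unfolding eq by simp
  qed
qed

lemma emeasure_steiner:
  fixes A :: "'a::euclidean_space set"
  assumes i: "i \<in> Basis" and A[measurable]: "A \<in> sets borel"
  shows "emeasure lborel (steiner i A) = emeasure lborel A"
  using emeasure_eq_fibres[OF i A] emeasure_eq_fibres[OF i steiner_borel[OF A], of i] emeasure_fibre_steiner[OF i A]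
  by simp

definition reflect :: "'a::euclidean_space \<Rightarrow> 'a \<Rightarrow> 'a" where
  "reflect i x = x - (2 * (x \<bullet> i)) *\<^sub>R i"

lemma steiner_reflect_self:
  assumes i: "i \<in> Basis" and A: "A \<in> sets borel"
  shows "reflect i x \<in> steiner i A \<longleftrightarrow> x \<in> steiner i A"
  using emeasure_fibre_translate[OF A, of i x "- (2 * (x \<bullet> i))"] i
  by (simp add: steiner_def reflect_def inner_diff_left)

text \<open>Reflection in \<open>j\<close> permutes the lines parallel to \<open>i\<close> and
  preserves heights above the hyperplane. Symmetries gained in earlier directions thus survive later
  symmetrizations.\<close>

lemma steiner_reflect_other:
  assumes "i \<in> Basis" "j \<in> Basis" "i \<noteq> j" and inv: "\<And>x. reflect j x \<in> A \<longleftrightarrow> x \<in> A"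
  shows "reflect j x \<in> steiner i A \<longleftrightarrow> x \<in> steiner i A"
proof -
  have ij: "i \<bullet> j = 0" "j \<bullet> i = 0" using assms by (auto simp: inner_Basis)
  have "reflect j x + t *\<^sub>R i = reflect j (x + t *\<^sub>R i)" for t
    using ij by (simp add: reflect_def algebra_simps)
  then have "fibre i A (reflect j x) = fibre i A x" by (simp add: fibre_def inv)
  moreover have "reflect j x \<bullet> i = x \<bullet> i" using ij by (simp add: reflect_def inner_diff_left)
  ultimately show ?thesis by (simp add: steiner_def)
qed

text \<open>Two points of the symmetrized set have fibres of the original set that are long enough
  to contain a pair of points at least as far apart in direction \<open>i\<close>, while all other
  coordinates are unchanged.\<close>

lemma steiner_dist_le:
  fixes A :: "'a::euclidean_space set"
  assumes i: "i \<in> Basis" and A[measurable]: "A \<in> sets borel"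
    and d: "\<And>x y. x \<in> A \<Longrightarrow> y \<in> A \<Longrightarrow> dist x y \<le> d"
    and x: "x \<in> steiner i A" and y: "y \<in> steiner i A"
  shows "dist x y \<le> d"
proof -
  define S where "S = fibre i A x"
  define T where "T = fibre i A y"
  \<comment> \<open>A fibre of measure greater than this bound does not fit into an interval of that
    length. Strictness yields actual points of the fibre, although its supremum and infimum need not
    be attained.\<close>
  have long: "\<exists>a b. a \<in> fibre i A z \<and> b \<in> fibre i A z \<and> 2 * \<bar>z \<bullet> i\<bar> < b - a" if "z \<in> steiner i A" for z
  proof (rule ccontr)
    assume "\<not> ?thesis"
    then have small: "b - a \<le> 2 * \<bar>z \<bullet> i\<bar>" if "a \<in> fibre i A z" "b \<in> fibre i A z" for a b
      using that by force
    have pos: "ennreal (2 * \<bar>z \<bullet> i\<bar>) < emeasure lborel (fibre i A z)"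
      using \<open>z \<in> steiner i A\<close> by (simp add: steiner_def)
    then have ne: "fibre i A z \<noteq> {}" by auto
    then obtain t0 where t0: "t0 \<in> fibre i A z" by auto
    have bb: "bdd_below (fibre i A z)"
      using small[OF _ t0] by (intro bdd_belowI[of _ "t0 - 2 * \<bar>z \<bullet> i\<bar>"]) fastforce
    define a where "a = Inf (fibre i A z)"
    have "fibre i A z \<subseteq> {a..a + 2 * \<bar>z \<bullet> i\<bar>}"
    proof
      fix b assume b: "b \<in> fibre i A z"
      have "a \<le> b" unfolding a_def by (rule cInf_lower[OF b bb])
      moreover have "b - 2 * \<bar>z \<bullet> i\<bar> \<le> a"
        unfolding a_def using small[OF _ b] by (intro cInf_greatest[OF ne]) force
      ultimately show "b \<in> {a..a + 2 * \<bar>z \<bullet> i\<bar>}" by auto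
    qed
    then have "emeasure lborel (fibre i A z) \<le> emeasure lborel {a..a + 2 * \<bar>z \<bullet> i\<bar>}"
      by (intro emeasure_mono) auto
    then show False using pos by (simp add: not_less[symmetric])
  qed
  obtain a b where ab: "a \<in> S" "b \<in> S" "2 * \<bar>x \<bullet> i\<bar> < b - a" using long[OF x] unfolding S_def by blast
  obtain a' b' where ab': "a' \<in> T" "b' \<in> T" "2 * \<bar>y \<bullet> i\<bar> < b' - a'" using long[OF y] unfolding T_def by blast
  have key: "dist x y \<le> dist (x + s *\<^sub>R i) (y + t *\<^sub>R i)"
    if "\<bar>x \<bullet> i - y \<bullet> i\<bar> \<le> \<bar>(x \<bullet> i + s) - (y \<bullet> i + t)\<bar>" for s t
    unfolding euclidean_dist_l2[of x y] euclidean_dist_l2[of "x + s *\<^sub>R i"]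
  proof (rule L2_set_mono)
    fix b :: 'a assume "b \<in> Basis"
    then show "dist (x \<bullet> b) (y \<bullet> b) \<le> dist ((x + s *\<^sub>R i) \<bullet> b) ((y + t *\<^sub>R i) \<bullet> b)"
      using i that by (cases "b = i") (auto simp: dist_real_def inner_add_left inner_Basis)
  qed auto
  have sd: "dist (x + s *\<^sub>R i) (y + t *\<^sub>R i) \<le> d" if "s \<in> S" "t \<in> T" for s t
    using that d by (auto simp: S_def T_def fibre_def)
  let ?X = "x \<bullet> i" and ?Y = "y \<bullet> i"
  \<comment> \<open>The numbers (X + b) - (Y + a') and (Y + b') - (X + a) add up to (b - a) + (b' -
    a'), which exceeds 2 (|X| + |Y|), so one of them exceeds |X - Y|.\<close>
  have "\<bar>?X - ?Y\<bar> \<le> \<bar>(?X + b) - (?Y + a')\<bar> \<or> \<bar>?X - ?Y\<bar> \<le> \<bar>(?X + a) - (?Y + b')\<bar>"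
    using ab(3) ab'(3) by linarith
  then show ?thesis using key sd ab ab' by (meson order_trans)
qed

lemma steiner_iterate:
  fixes A I :: "'a::euclidean_space set"
  assumes A: "A \<in> sets borel" and d: "\<And>x y. x \<in> A \<Longrightarrow> y \<in> A \<Longrightarrow> dist x y \<le> d"
    and I: "finite I" "I \<subseteq> Basis"
  shows "\<exists>B \<in> sets borel. emeasure lborel B = emeasure lborel A
    \<and> (\<forall>x\<in>B. \<forall>y\<in>B. dist x y \<le> d) \<and> (\<forall>i\<in>I. \<forall>x. reflect i x \<in> B \<longleftrightarrow> x \<in> B)"
  using I
proof (induction I rule: finite_induct)
  case empty
  show ?case by (rule bexI[OF _ A]) (use d in auto)
next
  case (insert i I)
  then obtain B where B: "B \<in> sets borel" "emeasure lborel B = emeasure lborel A"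
      "\<And>x y. x \<in> B \<Longrightarrow> y \<in> B \<Longrightarrow> dist x y \<le> d" "\<And>j x. j \<in> I \<Longrightarrow> reflect j x \<in> B \<longleftrightarrow> x \<in> B"
    by auto
  have i: "i \<in> Basis" using insert by auto
  show ?case
  proof (intro bexI conjI ballI allI)
    show "emeasure lborel (steiner i B) = emeasure lborel A" using emeasure_steiner[OF i B(1)] B(2) by simp
    show "dist x y \<le> d" if "x \<in> steiner i B" "y \<in> steiner i B" for x y
      using steiner_dist_le[OF i B(1,3) that] by blast
    show "reflect j x \<in> steiner i B \<longleftrightarrow> x \<in> steiner i B" if "j \<in> insert i I" for j x
    proof (cases "j = i")
      case True then show ?thesis using steiner_reflect_self[OF i B(1)] by simp
    next
      case False
      then show ?thesis using that insert.prems i by (intro steiner_reflect_other B(4)) auto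
    qed
  qed (use B in auto)
qed

text \<open>The product of the reflections in all coordinate hyperplanes is the reflection in the
  origin.\<close>

lemma reflect_all:
  fixes B :: "'a::euclidean_space set"
  assumes "\<And>i x. i \<in> Basis \<Longrightarrow> reflect i x \<in> B \<longleftrightarrow> x \<in> B"
  shows "- x \<in> B \<longleftrightarrow> x \<in> B"
proof -
  have "x - (\<Sum>i\<in>I. (2 * (x \<bullet> i)) *\<^sub>R i) \<in> B \<longleftrightarrow> x \<in> B" if "finite I" "I \<subseteq> Basis" for I
    using that
  proof (induction I rule: finite_induct)
    case (insert i I)
    let ?y = "x - (\<Sum>i\<in>I. (2 * (x \<bullet> i)) *\<^sub>R i)"
    have "(\<Sum>j\<in>I. (2 * (x \<bullet> j)) *\<^sub>R j) \<bullet> i = (\<Sum>j\<in>I. 2 * (x \<bullet> j) * (j \<bullet> i))"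
      by (simp add: inner_sum_left)
    also have "\<dots> = 0"
    proof (intro sum.neutral ballI)
      fix j assume "j \<in> I"
      then have "j \<bullet> i = 0" using insert inner_not_same_Basis[of j i] by auto
      then show "2 * (x \<bullet> j) * (j \<bullet> i) = 0" by simp
    qed
    finally have "reflect i ?y = x - (\<Sum>i\<in>insert i I. (2 * (x \<bullet> i)) *\<^sub>R i)"
      using insert by (simp add: reflect_def inner_diff_left algebra_simps)
    moreover have "i \<in> Basis" "?y \<in> B \<longleftrightarrow> x \<in> B" using insert by auto
    ultimately show ?case using assms[of i ?y] by simp
  qed simp
  from this[of Basis] have "x - (\<Sum>i\<in>Basis. (2 * (x \<bullet> i)) *\<^sub>R i) \<in> B \<longleftrightarrow> x \<in> B" by simp
  moreover have "(\<Sum>i\<in>Basis. (2 * (x \<bullet> i)) *\<^sub>R i) = 2 *\<^sub>R x"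
    by (simp add: scaleR_scaleR[symmetric] scaleR_sum_right[symmetric] euclidean_representation del: scaleR_scaleR)
  ultimately show ?thesis by (simp add: scaleR_2)
qed

text \<open>A set of diameter \<open>d\<close> need not lie in a ball of radius d/2, but one that is
  symmetric about the origin does, since x and -x are at distance 2 |x|. Symmetrizing in every
  coordinate direction produces such a set with the same volume and no larger diameter.\<close>

lemma isodiametric:
  fixes A :: "'a::euclidean_space set"
  assumes A: "A \<in> sets borel" and d: "\<And>x y. x \<in> A \<Longrightarrow> y \<in> A \<Longrightarrow> dist x y \<le> d" and "d \<ge> 0"
  shows "emeasure lborel A \<le> ennreal (unit_ball_vol DIM('a) * (d / 2) ^ DIM('a))"
proof -
  have "\<exists>B \<in> sets (borel :: 'a measure). emeasure lborel B = emeasure lborel A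
    \<and> (\<forall>x\<in>B. \<forall>y\<in>B. dist x y \<le> d) \<and> (\<forall>i\<in>Basis. \<forall>x. reflect i x \<in> B \<longleftrightarrow> x \<in> B)"
    by (rule steiner_iterate[OF A d]) auto
  then obtain B :: "'a set" where B: "B \<in> sets borel" "emeasure lborel B = emeasure lborel A"
      "\<forall>x\<in>B. \<forall>y\<in>B. dist x y \<le> d" "\<forall>i\<in>Basis. \<forall>x. reflect i x \<in> B \<longleftrightarrow> x \<in> B"
    by auto
  have "B \<subseteq> cball 0 (d / 2)"
  proof
    fix x assume x: "x \<in> B"
    then have "dist x (- x) \<le> d" using B(3) reflect_all[of B x] B(4) by blast
    also have "dist x (- x) = 2 * norm x" by (simp add: dist_norm flip: scaleR_2)
    finally show "x \<in> cball 0 (d / 2)" by simp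
  qed
  then have "emeasure lborel B \<le> emeasure lborel (cball (0::'a) (d / 2))" by (rule emeasure_mono) simp
  then show ?thesis using B(2) \<open>d \<ge> 0\<close> by (simp add: emeasure_cball)
qed

text \<open>By the isodiametric inequality the gauge of each covering set dominates its volume. Any
  scale suffices for this lower bound; 1 is taken.\<close>

lemma hausdorff_outer_eq_lborel:
  fixes A :: "'a::euclidean_space set"
  assumes A: "A \<in> sets borel"
  shows "hausdorff_outer_measure DIM('a) A = emeasure lborel A"
proof (rule antisym[OF hausdorff_outer_le_lborel[OF A]])
  have "emeasure lborel A \<le> hausdorff_content DIM('a) 1 A"
    unfolding hausdorff_content_def
  proof (rule INF_greatest, safe)
    fix C :: "nat \<Rightarrow> 'a set" assume C: "A \<subseteq> (\<Union>i. C i)" "\<forall>i. bounded (C i) \<and> diameter (C i) \<le> 1"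
    \<comment> \<open>Covering sets need not be measurable; passing to closures makes them so
      without changing diameters.\<close>
    have "emeasure lborel A \<le> emeasure lborel (\<Union>i. closure (C i))"
      using C(1) closure_subset by (intro emeasure_mono) (auto, blast)
    also have "\<dots> \<le> (\<Sum>i. emeasure lborel (closure (C i)))"
      by (rule emeasure_subadditive_countably) auto
    also have "\<dots> \<le> (\<Sum>i. hausdorff_gauge DIM('a) (C i))"
    proof (intro suminf_le)
      fix i
      show "emeasure lborel (closure (C i)) \<le> hausdorff_gauge DIM('a) (C i)"
      proof (cases "C i = {}")
        case False
        have "bounded (closure (C i))" using C(2) by (simp add: bounded_closure)
        then have "emeasure lborel (closure (C i))
            \<le> ennreal (unit_ball_vol DIM('a) * (diameter (closure (C i)) / 2) ^ DIM('a))"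
          by (intro isodiametric) (auto intro: diameter_bounded_bound diameter_ge_0)
        then show ?thesis using False C(2) by (simp add: hausdorff_gauge_def diameter_closure)
      qed simp
    qed auto
    finally show "emeasure lborel A \<le> (\<Sum>i. hausdorff_gauge DIM('a) (C i))" .
  qed
  also have "\<dots> \<le> hausdorff_outer_measure DIM('a) A" by (rule hausdorff_content_le_outer) simp
  finally show "emeasure lborel A \<le> hausdorff_outer_measure DIM('a) A" .
qed

text \<open>Lebesgue measure is a Hausdorff measure and hence determined by the metric. This reaches
  isometries between different types, for which the rules on linear maps of one space do not
  speak.\<close>

lemma lborel_isometry:
  fixes T :: "'a::euclidean_space \<Rightarrow> 'b::euclidean_space"
  assumes dist: "\<And>x y. dist (T x) (T y) = dist x y" and "surj T" and dim: "DIM('a) = DIM('b)"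
  shows "distr lborel borel T = lborel"
proof (rule measure_eqI)
  fix A :: "'b set" assume "A \<in> sets (distr lborel borel T)"
  then have A: "A \<in> sets borel" by simp
  have "continuous_on UNIV T"
    using dist by (auto simp: continuous_on_iff)
  then have [measurable]: "T \<in> borel_measurable borel" by (rule borel_measurable_continuous_onI)
  have TA: "T -` A \<in> sets borel" using A measurable_sets[of T borel borel A] by simp
  have "emeasure (distr lborel borel T) A = emeasure lborel (T -` A)"
    using A by (simp add: emeasure_distr)
  also have "\<dots> = hausdorff_outer_measure DIM('b) (T -` A)"
    using hausdorff_outer_eq_lborel[OF TA] dim by simp
  also have "\<dots> = hausdorff_outer_measure DIM('b) (T ` (T -` A))"
    by (rule hausdorff_outer_isometry[symmetric]) (rule dist)
  also have "T ` (T -` A) = A" using \<open>surj T\<close> by (simp add: surj_image_vimage_eq)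
  also have "hausdorff_outer_measure DIM('b) A = emeasure lborel A" by (rule hausdorff_outer_eq_lborel[OF A])
  finally show "emeasure (distr lborel borel T) A = emeasure lborel A" .
qed simp

section \<open>Cone measure on the unit sphere\<close>

text \<open>One index fewer, so that \<open>real ^ 'n punctured\<close> can parametrise a hyperplane of \<open>real ^ 'n\<close>; on a
  one-element type nothing is removed.\<close>
typedef 'n punctured = "{x :: 'n. x \<noteq> undefined \<or> (UNIV :: 'n set) = {undefined}}"
  by auto

instance punctured :: (finite) finite
proof
  have "finite (Rep_punctured ` (UNIV :: 'a punctured set))" by simp
  then show "finite (UNIV :: 'a punctured set)"
    by (rule finite_imageD) (simp add: inj_on_def Rep_punctured_inject)
qed

lemma card_punctured:
  assumes "CARD('n::finite) \<ge> 2"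
  shows "CARD('n) = CARD('n punctured) + 1"
proof -
  have "(UNIV :: 'n set) \<noteq> {undefined}"
    using assms by (metis card_1_singleton_iff One_nat_def Suc_1 Suc_n_not_le_n)
  then have "{x :: 'n. x \<noteq> undefined \<or> (UNIV :: 'n set) = {undefined}} = UNIV - {undefined}" by blast
  then have "CARD('n punctured) = card (UNIV - {undefined :: 'n})"
    using type_definition.card[OF type_definition_punctured[where 'n='n]] by simp
  then show ?thesis using assms by simp
qed

definition hyperplane_isometry :: "('b::euclidean_space \<Rightarrow> 'a::euclidean_space) \<Rightarrow> 'a \<Rightarrow> bool" where
  "hyperplane_isometry \<iota> e \<longleftrightarrow> norm e = 1 \<and> linear \<iota> \<and> (\<forall>y. norm (\<iota> y) = norm y)
     \<and> range \<iota> = {x. x \<bullet> e = 0} \<and> DIM('a) = DIM('b) + 1"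

lemma hyperplane_isometry_exists:
  fixes e :: "'a::euclidean_space"
  assumes "norm e = 1" "DIM('a) = DIM('b::euclidean_space) + 1"
  shows "\<exists>\<iota> :: 'b \<Rightarrow> 'a. hyperplane_isometry \<iota> e"
proof -
  have "dim (UNIV :: 'b set) = dim {x. e \<bullet> x = 0}"
    using assms by (subst dim_hyperplane) auto
  then obtain f :: "'b \<Rightarrow> 'a" and g where "linear f" "f ` UNIV = {x. e \<bullet> x = 0}" "\<And>x. x \<in> UNIV \<Longrightarrow> norm (f x) = norm x"
    using isometries_subspaces[OF subspace_UNIV subspace_hyperplane[of e]] by metis
  then show ?thesis
    using assms unfolding hyperplane_isometry_def by (auto simp: inner_commute)
qed

context
  fixes \<iota> :: "'b::euclidean_space \<Rightarrow> 'a::euclidean_space" and e :: 'a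
  assumes iso: "hyperplane_isometry \<iota> e"
begin

lemma hyp_iso_norm: "norm e = 1" "norm (\<iota> y) = norm y"
  and hyp_iso_linear: "linear \<iota>" and hyp_iso_range: "range \<iota> = {x. x \<bullet> e = 0}"
  and hyp_iso_dim: "DIM('a) = DIM('b) + 1"
  using iso by (auto simp: hyperplane_isometry_def)

lemma hyp_iso_orth: "\<iota> y \<bullet> e = 0" "e \<bullet> \<iota> y = 0"
  using hyp_iso_range by (auto simp: inner_commute)

lemma hyp_iso_ee: "e \<bullet> e = 1"
  by (simp add: dot_square_norm hyp_iso_norm)

lemma hyp_iso_measurable: "\<iota> \<in> borel_measurable borel"
  using hyp_iso_linear by (intro borel_measurable_continuous_onI linear_continuous_on) (simp add: linear_linear)

lemma hyp_iso_scale: "\<iota> (c *\<^sub>R y) = c *\<^sub>R \<iota> y"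
  using hyp_iso_linear by (rule linear_cmul)

lemma hyp_iso_norm_sum: "(norm (\<iota> y + s *\<^sub>R e))\<^sup>2 = (norm y)\<^sup>2 + s\<^sup>2"
proof -
  have "(norm (\<iota> y + s *\<^sub>R e))\<^sup>2 = (norm (\<iota> y))\<^sup>2 + (norm (s *\<^sub>R e))\<^sup>2"
    by (rule norm_add_Pythagorean) (simp add: orthogonal_def hyp_iso_orth)
  then show ?thesis by (simp add: hyp_iso_norm)
qed

lemma hyp_iso_dist: "dist (\<iota> y + s *\<^sub>R e) (\<iota> z + t *\<^sub>R e) = dist (y, s) (z, t)"
proof -
  have "(\<iota> y + s *\<^sub>R e) - (\<iota> z + t *\<^sub>R e) = \<iota> (y - z) + (s - t) *\<^sub>R e"
    using hyp_iso_linear by (simp add: linear_diff algebra_simps)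
  then have "(dist (\<iota> y + s *\<^sub>R e) (\<iota> z + t *\<^sub>R e))\<^sup>2 = (dist y z)\<^sup>2 + (dist s t)\<^sup>2"
    using hyp_iso_norm_sum[of "y - z" "s - t"] by (simp add: dist_norm)
  then show ?thesis by (simp add: dist_Pair_Pair real_sqrt_unique)
qed

lemma hyp_iso_surj: "\<exists>y. x = \<iota> y + (x \<bullet> e) *\<^sub>R e"
proof -
  have "x - (x \<bullet> e) *\<^sub>R e \<in> range \<iota>" unfolding hyp_iso_range by (simp add: inner_diff_left hyp_iso_ee)
  then show ?thesis by (auto simp: algebra_simps)
qed

text \<open>By Pythagoras (\<open>hyp_iso_dist\<close>) the map is an isometry from the product,
  whose product metric is Euclidean, so orthogonal coordinates preserve Lebesgue measure and Fubini
  becomes available.\<close>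

lemma hyp_iso_distr: "distr lborel borel (\<lambda>z. \<iota> (fst z) + snd z *\<^sub>R e) = (lborel :: 'a measure)"
proof (rule lborel_isometry)
  show "surj (\<lambda>z. \<iota> (fst z) + snd z *\<^sub>R e)"
    unfolding surj_def using hyp_iso_surj by (metis fst_conv snd_conv)
  show "DIM('b \<times> real) = DIM('a)" using hyp_iso_dim by simp
qed (simp add: hyp_iso_dist)

lemma hyp_iso_nn_integral:
  assumes [measurable]: "f \<in> borel_measurable borel"
  shows "(\<integral>\<^sup>+x. f x \<partial>lborel) = (\<integral>\<^sup>+y. \<integral>\<^sup>+s. f (\<iota> y + s *\<^sub>R e) \<partial>lborel \<partial>lborel)" (is ?a)
    and "(\<integral>\<^sup>+x. f x \<partial>lborel) = (\<integral>\<^sup>+s. \<integral>\<^sup>+y. f (\<iota> y + s *\<^sub>R e) \<partial>lborel \<partial>lborel)" (is ?b)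
proof -
  note [measurable] = hyp_iso_measurable
  have "(\<integral>\<^sup>+x. f x \<partial>lborel) = (\<integral>\<^sup>+x. f x \<partial>distr lborel borel (\<lambda>z. \<iota> (fst z) + snd z *\<^sub>R e))"
    by (simp add: hyp_iso_distr)
  also have "\<dots> = (\<integral>\<^sup>+z. f (\<iota> (fst z) + snd z *\<^sub>R e) \<partial>lborel)"
    by (rule nn_integral_distr) (simp_all add: borel_prod[symmetric])
  also have "\<dots> = (\<integral>\<^sup>+z. f (\<iota> (fst z) + snd z *\<^sub>R e) \<partial>(lborel \<Otimes>\<^sub>M lborel))"
    by (simp add: lborel_prod)
  also have "\<dots> = (\<integral>\<^sup>+y. \<integral>\<^sup>+s. f (\<iota> y + s *\<^sub>R e) \<partial>lborel \<partial>lborel)"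
    by (subst lborel.nn_integral_fst[symmetric]) (auto simp: split_def)
  finally show ?a .
  also have "\<dots> = (\<integral>\<^sup>+s. \<integral>\<^sup>+y. f (\<iota> y + s *\<^sub>R e) \<partial>lborel \<partial>lborel)"
    by (rule lborel_pair.Fubini'[symmetric]) measurable
  finally show ?b .
qed

end

section \<open>Scaling, and changing the gauge of a homogeneous integrand\<close>

lemma nn_integral_lborel_scale:
  fixes F :: "'a::euclidean_space \<Rightarrow> ennreal"
  assumes [measurable]: "F \<in> borel_measurable borel" and "c > 0"
  shows "(\<integral>\<^sup>+x. F x \<partial>lborel) = ennreal (c ^ DIM('a)) * (\<integral>\<^sup>+x. F (c *\<^sub>R x) \<partial>lborel)"
proof -
  have "(\<integral>\<^sup>+x. F x \<partial>lborel) = (\<integral>\<^sup>+x. F x \<partial>density (distr lborel borel (\<lambda>x. 0 + c *\<^sub>R x)) (\<lambda>_. \<bar>c\<bar>^DIM('a)))"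
    using lborel_affine[of c "0::'a"] \<open>c > 0\<close> by simp
  also have "\<dots> = ennreal (c ^ DIM('a)) * (\<integral>\<^sup>+x. F (c *\<^sub>R x) \<partial>lborel)"
    using \<open>c > 0\<close> by (simp add: nn_integral_density nn_integral_distr nn_integral_cmult)
  finally show ?thesis .
qed

text \<open>Both kinds of half-open interval occur: solved for l, the condition 1 <= l r < 2 is
  closed on the left and 1 <= r / l < 2 is closed on the right.\<close>

lemma nn_integral_inverse_Ioc:
  assumes "0 < a" "a \<le> b"
  shows "(\<integral>\<^sup>+l. indicator {0<..} l * ennreal (1 / l) * indicator {a<..b} l \<partial>lborel) = ennreal (ln (b / a))"
    and "(\<integral>\<^sup>+l. indicator {0<..} l * ennreal (1 / l) * indicator {a..<b} l \<partial>lborel) = ennreal (ln (b / a))"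
proof -
  have *: "(\<integral>\<^sup>+l. ennreal (1 / l) * indicator {a..b} l \<partial>lborel) = ennreal (ln b - ln a)"
    using assms by (intro nn_integral_FTC_Icc) (auto intro!: derivative_eq_intros)
  have ae: "AE l in lborel. l \<noteq> a" "AE l in lborel. l \<noteq> b"
    by (rule AE_lborel_singleton)+
  have "(\<integral>\<^sup>+l. indicator {0<..} l * ennreal (1 / l) * indicator {a<..b} l \<partial>lborel)
      = (\<integral>\<^sup>+l. ennreal (1 / l) * indicator {a..b} l \<partial>lborel)"
    using ae(1) assms by (intro nn_integral_cong_AE) (auto simp: indicator_def elim!: eventually_mono)
  then show "(\<integral>\<^sup>+l. indicator {0<..} l * ennreal (1 / l) * indicator {a<..b} l \<partial>lborel) = ennreal (ln (b / a))"
    using * assms by (simp add: ln_div)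
  have "(\<integral>\<^sup>+l. indicator {0<..} l * ennreal (1 / l) * indicator {a..<b} l \<partial>lborel)
      = (\<integral>\<^sup>+l. ennreal (1 / l) * indicator {a..b} l \<partial>lborel)"
    using ae(2) assms by (intro nn_integral_cong_AE) (auto simp: indicator_def elim!: eventually_mono)
  then show "(\<integral>\<^sup>+l. indicator {0<..} l * ennreal (1 / l) * indicator {a..<b} l \<partial>lborel) = ennreal (ln (b / a))"
    using * assms by (simp add: ln_div)
qed

text \<open>Both sides are multiplied by \<open>ln 2 = \<integral> 1[1 \<le> l r < 2] dl / l\<close>, which does not depend on \<open>r > 0\<close>;
  scaling the variable by \<open>l\<close> then exchanges the roles of the two gauges.\<close>
lemma homogeneous_gauge_invariance:
  fixes g :: "'a::euclidean_space \<Rightarrow> ennreal" and \<rho>1 \<rho>2 :: "'a \<Rightarrow> real"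
  assumes meas [measurable]: "g \<in> borel_measurable borel" "\<rho>1 \<in> borel_measurable borel" "\<rho>2 \<in> borel_measurable borel"
    and g: "\<And>c x. c > 0 \<Longrightarrow> g (c *\<^sub>R x) = ennreal (1 / c ^ DIM('a)) * g x"
    and \<rho>: "\<And>c x. c > 0 \<Longrightarrow> \<rho>1 (c *\<^sub>R x) = c * \<rho>1 x" "\<And>c x. c > 0 \<Longrightarrow> \<rho>2 (c *\<^sub>R x) = c * \<rho>2 x"
    and pos: "AE x in lborel. g x = 0 \<or> \<rho>1 x > 0 \<and> \<rho>2 x > 0"
  shows "(\<integral>\<^sup>+x. g x * indicator {1..<2} (\<rho>1 x) \<partial>lborel) = (\<integral>\<^sup>+x. g x * indicator {1..<2} (\<rho>2 x) \<partial>lborel)"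
proof -
  define w :: "real \<Rightarrow> ennreal" where "w l = indicator {0<..} l * ennreal (1 / l)" for l
  have [measurable]: "w \<in> borel_measurable borel" unfolding w_def by measurable
  let ?I = "indicator {1..<2} :: real \<Rightarrow> ennreal"
  have A: "(\<integral>\<^sup>+l. w l * ?I (l * r) \<partial>lborel) = ennreal (ln 2)" if "r > 0" for r
  proof -
    have "(\<integral>\<^sup>+l. w l * ?I (l * r) \<partial>lborel) = (\<integral>\<^sup>+l. w l * indicator {1/r..<2/r} l \<partial>lborel)"
      using that by (intro nn_integral_cong) (auto simp: indicator_def field_simps)
    then show ?thesis using that nn_integral_inverse_Ioc(2)[of "1/r" "2/r"] by (simp add: w_def field_simps)
  qed
  have B: "(\<integral>\<^sup>+l. w l * ?I (r / l) \<partial>lborel) = ennreal (ln 2)" if "r > 0" for r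
  proof -
    have "(\<integral>\<^sup>+l. w l * ?I (r / l) \<partial>lborel) = (\<integral>\<^sup>+l. w l * indicator {r/2<..r} l \<partial>lborel)"
      using that by (intro nn_integral_cong) (auto simp: indicator_def field_simps w_def split: if_splits)
    then show ?thesis using that nn_integral_inverse_Ioc(1)[of "r/2" "r"] by (simp add: w_def field_simps)
  qed
  have scale: "(\<integral>\<^sup>+x. g x * ?I (\<rho>1 x) * (w l * ?I (l * \<rho>2 x)) \<partial>lborel)
      = (\<integral>\<^sup>+x. g x * ?I (\<rho>2 x) * (w l * ?I (\<rho>1 x / l)) \<partial>lborel)" for l
  proof (cases "l > 0")
    case True
    have "(\<integral>\<^sup>+x. g x * ?I (\<rho>2 x) * (w l * ?I (\<rho>1 x / l)) \<partial>lborel)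
        = ennreal (l ^ DIM('a)) * (\<integral>\<^sup>+x. g (l *\<^sub>R x) * ?I (\<rho>2 (l *\<^sub>R x)) * (w l * ?I (\<rho>1 (l *\<^sub>R x) / l)) \<partial>lborel)"
      by (rule nn_integral_lborel_scale) (use True in measurable)
    also have "\<dots> = (\<integral>\<^sup>+x. ennreal (l ^ DIM('a)) * (g (l *\<^sub>R x) * ?I (\<rho>2 (l *\<^sub>R x)) * (w l * ?I (\<rho>1 (l *\<^sub>R x) / l))) \<partial>lborel)"
      by (rule nn_integral_cmult[symmetric]) measurable
    also have "\<dots> = (\<integral>\<^sup>+x. g x * ?I (\<rho>1 x) * (w l * ?I (l * \<rho>2 x)) \<partial>lborel)"
    proof (rule nn_integral_cong)
      fix x
      have cancel: "ennreal (l ^ DIM('a)) * (ennreal (1 / l ^ DIM('a)) * s) = s" for s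
        using True by (simp add: mult.assoc[symmetric] ennreal_mult'[symmetric])
      show "ennreal (l ^ DIM('a)) * (g (l *\<^sub>R x) * ?I (\<rho>2 (l *\<^sub>R x)) * (w l * ?I (\<rho>1 (l *\<^sub>R x) / l)))
          = g x * ?I (\<rho>1 x) * (w l * ?I (l * \<rho>2 x))"
        using True cancel[of "g x * (w l * (?I (\<rho>1 x) * ?I (l * \<rho>2 x)))"] by (simp add: g \<rho> ac_simps)
    qed
    finally show ?thesis ..
  qed (simp add: w_def)
  have "ennreal (ln 2) * (\<integral>\<^sup>+x. g x * ?I (\<rho>1 x) \<partial>lborel)
      = (\<integral>\<^sup>+x. g x * ?I (\<rho>1 x) * ennreal (ln 2) \<partial>lborel)"
    by (subst nn_integral_multc) (auto simp: mult.commute)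
  also have "\<dots> = (\<integral>\<^sup>+x. (\<integral>\<^sup>+l. g x * ?I (\<rho>1 x) * (w l * ?I (l * \<rho>2 x)) \<partial>lborel) \<partial>lborel)"
  proof (rule nn_integral_cong_AE, use pos in eventually_elim)
    fix x assume "g x = 0 \<or> \<rho>1 x > 0 \<and> \<rho>2 x > 0"
    then show "g x * ?I (\<rho>1 x) * ennreal (ln 2) = (\<integral>\<^sup>+l. g x * ?I (\<rho>1 x) * (w l * ?I (l * \<rho>2 x)) \<partial>lborel)"
      by (auto simp: nn_integral_cmult A)
  qed
  also have "\<dots> = (\<integral>\<^sup>+l. (\<integral>\<^sup>+x. g x * ?I (\<rho>1 x) * (w l * ?I (l * \<rho>2 x)) \<partial>lborel) \<partial>lborel)"
    by (rule lborel_pair.Fubini'[symmetric]) measurable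
  also have "\<dots> = (\<integral>\<^sup>+l. (\<integral>\<^sup>+x. g x * ?I (\<rho>2 x) * (w l * ?I (\<rho>1 x / l)) \<partial>lborel) \<partial>lborel)"
    unfolding scale ..
  also have "\<dots> = (\<integral>\<^sup>+x. (\<integral>\<^sup>+l. g x * ?I (\<rho>2 x) * (w l * ?I (\<rho>1 x / l)) \<partial>lborel) \<partial>lborel)"
    by (rule lborel_pair.Fubini') measurable
  also have "\<dots> = (\<integral>\<^sup>+x. g x * ?I (\<rho>2 x) * ennreal (ln 2) \<partial>lborel)"
  proof (rule nn_integral_cong_AE, use pos in eventually_elim)
    fix x assume "g x = 0 \<or> \<rho>1 x > 0 \<and> \<rho>2 x > 0"
    then show "(\<integral>\<^sup>+l. g x * ?I (\<rho>2 x) * (w l * ?I (\<rho>1 x / l)) \<partial>lborel) = g x * ?I (\<rho>2 x) * ennreal (ln 2)"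
      by (auto simp: nn_integral_cmult B)
  qed
  also have "\<dots> = ennreal (ln 2) * (\<integral>\<^sup>+x. g x * ?I (\<rho>2 x) \<partial>lborel)"
    by (subst nn_integral_multc) (auto simp: mult.commute)
  finally show ?thesis by (simp add: ennreal_mult_cancel_left)
qed

text \<open>Surface measure of the unit sphere in disguise: in polar coordinates the weight leaves
  dr / r along each ray, whose integral from 1 to 2 is ln 2.\<close>

definition cone_measure :: "'a::euclidean_space measure" where
  "cone_measure = distr (density lborel
     (\<lambda>x. indicator {1..<2} (norm x) * ennreal (1 / (ln 2 * norm x ^ DIM('a))))) borel (\<lambda>x. x /\<^sub>R norm x)"

lemma sets_cone_measure [simp, measurable_cong]: "sets cone_measure = sets borel"
  and space_cone_measure [simp]: "space cone_measure = UNIV"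
  by (simp_all add: cone_measure_def)

lemma nn_integral_cone_measure:
  fixes f :: "'a::euclidean_space \<Rightarrow> ennreal"
  assumes [measurable]: "f \<in> borel_measurable borel"
  shows "ennreal (ln 2) * (\<integral>\<^sup>+x. f x \<partial>cone_measure)
    = (\<integral>\<^sup>+x. ennreal (1 / norm x ^ DIM('a)) * f (x /\<^sub>R norm x) * indicator {1..<2} (norm x) \<partial>lborel)"
proof -
  have eq: "ennreal (ln 2) * ennreal (1 / (ln 2 * norm x ^ DIM('a))) = ennreal (1 / norm x ^ DIM('a))" for x :: 'a
    by (subst ennreal_mult'[symmetric]) auto
  have "ennreal (ln 2) * (\<integral>\<^sup>+x. f x \<partial>cone_measure) = (\<integral>\<^sup>+x. ennreal (ln 2) *
      (indicator {1..<2} (norm x) * ennreal (1 / (ln 2 * norm x ^ DIM('a))) * f (x /\<^sub>R norm x)) \<partial>lborel)"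
    unfolding cone_measure_def by (simp add: nn_integral_distr nn_integral_density nn_integral_cmult)
  also have "\<dots> = (\<integral>\<^sup>+x. ennreal (1 / norm x ^ DIM('a)) * f (x /\<^sub>R norm x) * indicator {1..<2} (norm x) \<partial>lborel)"
    unfolding eq[symmetric] by (intro nn_integral_cong) (simp add: ac_simps)
  finally show ?thesis .
qed

text \<open>For this degree of homogeneity the weight in \<open>cone_measure\<close> is exactly what
  undoing the radial projection costs.\<close>

lemma nn_integral_cone_measure_homogeneous:
  fixes h :: "'a::euclidean_space \<Rightarrow> ennreal"
  assumes [measurable]: "h \<in> borel_measurable borel"
    and hom: "\<And>c x. c > 0 \<Longrightarrow> h (c *\<^sub>R x) = ennreal (1 / c ^ DIM('a)) * h x"
  shows "ennreal (ln 2) * (\<integral>\<^sup>+x. h x \<partial>cone_measure)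
    = (\<integral>\<^sup>+x. h x * indicator {1..<2} (norm x) \<partial>lborel)"
  unfolding nn_integral_cone_measure[OF assms(1)]
proof (rule nn_integral_cong)
  fix x :: 'a
  show "ennreal (1 / norm x ^ DIM('a)) * h (x /\<^sub>R norm x) * indicator {1..<2} (norm x) = h x * indicator {1..<2} (norm x)"
  proof (cases "x = 0")
    case False
    have "h x = h (norm x *\<^sub>R (x /\<^sub>R norm x))" using False by simp
    also have "\<dots> = ennreal (1 / norm x ^ DIM('a)) * h (x /\<^sub>R norm x)"
      using False by (intro hom) simp
    finally show ?thesis by simp
  qed simp
qed

text \<open>On the half-space where \<open>x \<bullet> p\<close> is positive, the norm may be
  exchanged for the gauge \<open>x \<bullet> p\<close>. The shell becomes a slab whose slice at
  height s is the tangent plane at \<open>p\<close> scaled by s; each slice contributes 1 / s times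
  the same integral, and the resulting ln 2 cancels.\<close>

lemma cone_measure_gnomonic:
  fixes p :: "'a::euclidean_space" and \<iota> :: "'b::euclidean_space \<Rightarrow> 'a"
  assumes iso: "hyperplane_isometry \<iota> p" and A[measurable]: "A \<in> sets borel"
    and sub: "\<And>a. a \<in> A \<Longrightarrow> norm a = 1 \<and> a \<bullet> p > 0"
  shows "emeasure cone_measure A = (\<integral>\<^sup>+z. ennreal (1 / norm (\<iota> z + p) ^ DIM('a))
    * indicator A ((\<iota> z + p) /\<^sub>R norm (\<iota> z + p)) \<partial>lborel)"
proof -
  note [measurable] = hyp_iso_measurable[OF iso]
  define g :: "'a \<Rightarrow> ennreal" where "g x = ennreal (1 / norm x ^ DIM('a)) * indicator A (x /\<^sub>R norm x)" for x
  have [measurable]: "g \<in> borel_measurable borel" unfolding g_def by measurable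
  have hom: "g (c *\<^sub>R x) = ennreal (1 / c ^ DIM('a)) * g x" if "c > 0" for c x
  proof -
    have "(c *\<^sub>R x) /\<^sub>R norm (c *\<^sub>R x) = x /\<^sub>R norm x" using that by simp
    moreover have "ennreal (1 / norm (c *\<^sub>R x) ^ DIM('a)) = ennreal (1 / c ^ DIM('a)) * ennreal (1 / norm x ^ DIM('a))"
      using that by (subst ennreal_mult'[symmetric]) (auto simp: power_mult_distrib)
    ultimately show ?thesis unfolding g_def by (simp only: mult.assoc)
  qed
  have pos: "g x = 0 \<or> norm x > 0 \<and> x \<bullet> p > 0" for x
  proof (cases "x /\<^sub>R norm x \<in> A")
    case True
    have "x \<noteq> 0" using sub[OF True] by auto
    then show ?thesis using sub[OF True] by (auto simp: zero_less_mult_iff)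
  qed (simp add: g_def)
  have "ennreal (ln 2) * emeasure cone_measure A = ennreal (ln 2) * (\<integral>\<^sup>+x. indicator A x \<partial>cone_measure)"
    by simp
  also have "\<dots> = (\<integral>\<^sup>+x. g x * indicator {1..<2} (norm x) \<partial>lborel)"
    by (subst nn_integral_cone_measure) (auto simp: g_def)
  also have "\<dots> = (\<integral>\<^sup>+x. g x * indicator {1..<2} (x \<bullet> p) \<partial>lborel)"
    by (rule homogeneous_gauge_invariance) (use hom pos in auto)
  also have "\<dots> = (\<integral>\<^sup>+s. \<integral>\<^sup>+y. g (\<iota> y + s *\<^sub>R p) * indicator {1..<2} s \<partial>lborel \<partial>lborel)"
    by (subst hyp_iso_nn_integral(2)[OF iso]) (auto simp: inner_add_left hyp_iso_orth[OF iso] hyp_iso_ee[OF iso])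
  also have "\<dots> = (\<integral>\<^sup>+s. (indicator {0<..} s * ennreal (1 / s) * indicator {1..<2} s) * (\<integral>\<^sup>+y. g (\<iota> y + p) \<partial>lborel) \<partial>lborel)"
  proof (rule nn_integral_cong)
    fix s :: real
    show "(\<integral>\<^sup>+y. g (\<iota> y + s *\<^sub>R p) * indicator {1..<2} s \<partial>lborel)
      = (indicator {0<..} s * ennreal (1 / s) * indicator {1..<2} s) * (\<integral>\<^sup>+y. g (\<iota> y + p) \<partial>lborel)"
    proof (cases "s \<in> {1..<2}")
      case True
      then have s: "s > 0" by simp
      have "(\<integral>\<^sup>+y. g (\<iota> y + s *\<^sub>R p) \<partial>lborel) = ennreal (s ^ DIM('b)) * (\<integral>\<^sup>+y. g (\<iota> (s *\<^sub>R y) + s *\<^sub>R p) \<partial>lborel)"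
        by (rule nn_integral_lborel_scale[OF _ s]) measurable
      also have "(\<lambda>y. g (\<iota> (s *\<^sub>R y) + s *\<^sub>R p)) = (\<lambda>y. ennreal (1 / s ^ DIM('a)) * g (\<iota> y + p))"
        using hom[OF s] by (simp add: hyp_iso_scale[OF iso] flip: scaleR_add_right)
      also have "ennreal (s ^ DIM('b)) * (\<integral>\<^sup>+y. ennreal (1 / s ^ DIM('a)) * g (\<iota> y + p) \<partial>lborel)
          = ennreal (1 / s) * (\<integral>\<^sup>+y. g (\<iota> y + p) \<partial>lborel)"
        using s hyp_iso_dim[OF iso]
        by (simp add: nn_integral_cmult mult.assoc[symmetric] ennreal_mult'[symmetric])
      finally show ?thesis using True s by simp
    qed simp
  qed
  also have "\<dots> = ennreal (ln 2) * (\<integral>\<^sup>+y. g (\<iota> y + p) \<partial>lborel)"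
    by (subst nn_integral_multc) (use nn_integral_inverse_Ioc(2)[of 1 2] in auto)
  finally show ?thesis by (simp add: ennreal_mult_cancel_left g_def)
qed

text \<open>The norm is exchanged for the distance from the axis spanned by \<open>e\<close>.
  Integrating out the axis raises the degree of homogeneity by one, so \<open>\<Psi>\<close> has
  precisely the degree that turns the remaining integral into a cone measure one dimension
  lower.\<close>

lemma nn_integral_cone_measure_cylinder:
  fixes e :: "'a::euclidean_space" and \<iota> :: "'b::euclidean_space \<Rightarrow> 'a"
  assumes iso: "hyperplane_isometry \<iota> e" and h[measurable]: "h \<in> borel_measurable borel"
    and hom: "\<And>c x. c > 0 \<Longrightarrow> h (c *\<^sub>R x) = ennreal (1 / c ^ DIM('a)) * h x"
  shows "(\<integral>\<^sup>+x. h x \<partial>cone_measure) = (\<integral>\<^sup>+\<eta>. \<integral>\<^sup>+s. h (\<iota> \<eta> + s *\<^sub>R e) \<partial>lborel \<partial>cone_measure)"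
proof -
  note [measurable] = hyp_iso_measurable[OF iso]
  define \<Psi> where "\<Psi> y = (\<integral>\<^sup>+s. h (\<iota> y + s *\<^sub>R e) \<partial>lborel)" for y
  have [measurable]: "\<Psi> \<in> borel_measurable borel" unfolding \<Psi>_def by measurable
  have \<Psi>: "\<Psi> (r *\<^sub>R y) = ennreal (1 / r ^ DIM('b)) * \<Psi> y" if r: "r > 0" for r y
  proof -
    have "\<Psi> (r *\<^sub>R y) = ennreal (r ^ DIM(real)) * (\<integral>\<^sup>+s. h (\<iota> (r *\<^sub>R y) + (r *\<^sub>R s) *\<^sub>R e) \<partial>lborel)"
      unfolding \<Psi>_def by (rule nn_integral_lborel_scale[OF _ r]) measurable
    also have "(\<lambda>s. h (\<iota> (r *\<^sub>R y) + (r *\<^sub>R s) *\<^sub>R e)) = (\<lambda>s. ennreal (1 / r ^ DIM('a)) * h (\<iota> y + s *\<^sub>R e))"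
      using hom[OF r] by (simp add: hyp_iso_scale[OF iso] flip: scaleR_add_right scaleR_scaleR)
    also have "ennreal (r ^ DIM(real)) * (\<integral>\<^sup>+s. ennreal (1 / r ^ DIM('a)) * h (\<iota> y + s *\<^sub>R e) \<partial>lborel)
        = ennreal (1 / r ^ DIM('b)) * \<Psi> y"
      using r hyp_iso_dim[OF iso]
      by (simp add: nn_integral_cmult \<Psi>_def mult.assoc[symmetric] ennreal_mult'[symmetric])
    finally show ?thesis .
  qed
  let ?\<rho> = "\<lambda>x. norm (x - (x \<bullet> e) *\<^sub>R e)"
  \<comment> \<open>The new gauge vanishes on the axis, which is a null set because the dimension is
    at least 2.\<close>
  have "negligible (span {e})"
  proof (rule negligible_lowdim)
    have "dim (span {e}) \<le> 1" by (metis dim_span dim_le_card' card_1_singleton_iff finite.emptyI finite_insert One_nat_def dim_le_card)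
    then show "dim (span {e}) < DIM('a)" using hyp_iso_dim[OF iso] by (simp add: less_le_trans Suc_le_eq)
  qed
  then have "AE x in lebesgue. x \<notin> span {e}"
    using AE_not_in[of "span {e}" lebesgue] by (simp add: negligible_iff_null_sets)
  then have "AE x in lborel. x \<notin> span {e}"
    by (simp add: AE_completion_iff)
  then have pos: "AE x in lborel. h x = 0 \<or> norm x > 0 \<and> ?\<rho> x > 0"
  proof eventually_elim
    fix x assume "x \<notin> span {e}"
    then have "x \<noteq> 0" "x \<noteq> (x \<bullet> e) *\<^sub>R e" by (auto simp: span_zero) (metis span_base span_scale singletonI)
    then show "h x = 0 \<or> norm x > 0 \<and> ?\<rho> x > 0" by simp
  qed
  have "ennreal (ln 2) * (\<integral>\<^sup>+x. h x \<partial>cone_measure) = (\<integral>\<^sup>+x. h x * indicator {1..<2} (norm x) \<partial>lborel)"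
    by (rule nn_integral_cone_measure_homogeneous[OF h hom])
  also have "\<dots> = (\<integral>\<^sup>+x. h x * indicator {1..<2} (?\<rho> x) \<partial>lborel)"
  proof (rule homogeneous_gauge_invariance[OF _ _ _ hom _ _ pos])
    show "?\<rho> (c *\<^sub>R x) = c * ?\<rho> x" if "c > 0" for c x
      using that by (metis abs_of_pos inner_scaleR_left norm_scaleR scaleR_right_diff_distrib scaleR_scaleR)
  qed auto
  also have "\<dots> = (\<integral>\<^sup>+y. \<integral>\<^sup>+s. h (\<iota> y + s *\<^sub>R e) * indicator {1..<2} (norm y) \<partial>lborel \<partial>lborel)"
    by (subst hyp_iso_nn_integral(1)[OF iso])
      (auto simp: inner_add_left hyp_iso_orth[OF iso] hyp_iso_ee[OF iso] hyp_iso_norm[OF iso])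
  also have "\<dots> = (\<integral>\<^sup>+y. \<Psi> y * indicator {1..<2} (norm y) \<partial>lborel)"
    by (simp add: nn_integral_multc \<Psi>_def)
  also have "\<dots> = ennreal (ln 2) * (\<integral>\<^sup>+y. \<Psi> y \<partial>cone_measure)"
    by (rule nn_integral_cone_measure_homogeneous[OF _ \<Psi>, symmetric]) measurable
  finally show ?thesis by (simp add: ennreal_mult_cancel_left \<Psi>_def)
qed

section \<open>Hausdorff measure of subsets of the sphere\<close>

text \<open>With q the cosine of the angle, dist x y squared is (|x| - |y|)^2 + |x| |y| (2 - 2 q),
  and the normalized vectors have squared distance 2 - 2 q.\<close>

lemma dist_normalized_le:
  fixes x y :: "'a::euclidean_space"
  assumes "norm x \<ge> 1" "norm y \<ge> 1"
  shows "dist (x /\<^sub>R norm x) (y /\<^sub>R norm y) \<le> dist x y"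
proof -
  have ne: "norm x \<noteq> 0" "norm y \<noteq> 0" using assms by auto
  define q where "q = (x \<bullet> y) / (norm x * norm y)"
  have "norm x * norm y > 0" using assms by (intro mult_pos_pos) auto
  then have q: "q \<le> 1" using norm_cauchy_schwarz[of x y] by (simp add: q_def)
  have xy: "x \<bullet> y = norm x * norm y * q" using ne by (simp add: q_def)
  have "(dist (x /\<^sub>R norm x) (y /\<^sub>R norm y))\<^sup>2 = 2 - 2 * q"
    using ne by (simp add: dist_norm power2_norm_eq_inner inner_diff_left inner_diff_right inner_commute)
      (simp add: dot_square_norm power2_eq_square q_def field_simps)
  also have "\<dots> \<le> norm x * norm y * (2 - 2 * q)"
    using q mult_right_mono[of 1 "norm x * norm y" "2 - 2 * q"] mult_mono[OF assms] by simp
  also have "\<dots> \<le> (norm x - norm y)\<^sup>2 + norm x * norm y * (2 - 2 * q)" by simp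
  also have "\<dots> = (dist x y)\<^sup>2"
    by (simp add: dist_norm power2_norm_eq_inner inner_diff_left inner_diff_right inner_commute xy)
      (simp add: dot_square_norm power2_eq_square algebra_simps)
  finally show ?thesis by (rule power2_le_imp_le) simp
qed

text \<open>The inverse of the gnomonic chart on a cap around \<open>p\<close>. What matters is that
  the Lipschitz constant tends to 1 as \<open>c\<close> tends to 1, that is, as the cap
  shrinks.\<close>

lemma dist_central_projection_le:
  fixes a b p :: "'a::euclidean_space"
  assumes n: "norm a = 1" "norm b = 1" "norm p = 1" and c: "0 < c" "c < a \<bullet> p" "c < b \<bullet> p"
  shows "dist (a /\<^sub>R (a \<bullet> p)) (b /\<^sub>R (b \<bullet> p)) \<le> (1 / c + sqrt (2 - 2 * c) / c\<^sup>2) * dist a b"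
proof -
  have near: "norm (p - x) \<le> sqrt (2 - 2 * c)" if "norm x = 1" "c < x \<bullet> p" for x
  proof (rule real_le_rsqrt)
    show "(norm (p - x))\<^sup>2 \<le> 2 - 2 * c"
      using that n(3) dot_norm_neg[of x p] by (simp add: norm_minus_commute)
  qed
  \<comment> \<open>For unit vectors a - b is orthogonal to a + b, so \<open>p\<close> may be
    replaced by its difference from the midpoint, which is small on the cap.\<close>
  have "(a - b) \<bullet> p = (a - b) \<bullet> ((1/2) *\<^sub>R ((p - a) + (p - b)))"
    using n by (simp add: inner_diff_left inner_diff_right inner_add_right inner_commute dot_square_norm)
  then have "\<bar>(a - b) \<bullet> p\<bar> \<le> norm (a - b) * norm ((1/2) *\<^sub>R ((p - a) + (p - b)))"
    using Cauchy_Schwarz_ineq2 by metis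
  also have "norm ((1/2) *\<^sub>R ((p - a) + (p - b))) \<le> sqrt (2 - 2 * c)"
    using norm_triangle_ineq[of "p - a" "p - b"] near[OF n(1) c(2)] near[OF n(2) c(3)] by simp
  finally have diff: "\<bar>b \<bullet> p - a \<bullet> p\<bar> \<le> dist a b * sqrt (2 - 2 * c)"
    by (simp add: dist_norm mult_left_mono inner_diff_left abs_minus_commute)
  have pos: "a \<bullet> p > 0" "b \<bullet> p > 0" using c by auto
  have "(b \<bullet> p - a \<bullet> p) / ((a \<bullet> p) * (b \<bullet> p)) = 1 / (a \<bullet> p) - 1 / (b \<bullet> p)"
    using pos by (simp add: field_simps)
  then have "a /\<^sub>R (a \<bullet> p) - b /\<^sub>R (b \<bullet> p) = (1 / (a \<bullet> p)) *\<^sub>R (a - b) + ((b \<bullet> p - a \<bullet> p) / ((a \<bullet> p) * (b \<bullet> p))) *\<^sub>R b"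
    by (simp only: scaleR_diff_left) (simp add: scaleR_diff_right divide_inverse)
  then have "dist (a /\<^sub>R (a \<bullet> p)) (b /\<^sub>R (b \<bullet> p)) \<le> 1 / (a \<bullet> p) * dist a b + \<bar>b \<bullet> p - a \<bullet> p\<bar> / ((a \<bullet> p) * (b \<bullet> p))"
    using norm_triangle_ineq[of "(1 / (a \<bullet> p)) *\<^sub>R (a - b)" "((b \<bullet> p - a \<bullet> p) / ((a \<bullet> p) * (b \<bullet> p))) *\<^sub>R b"] pos n
    by (simp add: dist_norm abs_mult)
  also have "\<dots> \<le> 1 / c * dist a b + (dist a b * sqrt (2 - 2 * c)) / (c * c)"
  proof (intro add_mono mult_right_mono frac_le diff)
    show "c * c \<le> (a \<bullet> p) * (b \<bullet> p)" using c by (intro mult_mono) auto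
    have "a \<bullet> p \<le> 1" using Cauchy_Schwarz_ineq2[of a p] n by simp
    then show "0 \<le> dist a b * sqrt (2 - 2 * c)" using c by simp
  qed (use c in auto)
  also have "\<dots> = (1 / c + sqrt (2 - 2 * c) / c\<^sup>2) * dist a b"
    by (simp add: algebra_simps power2_eq_square)
  finally show ?thesis .
qed

text \<open>The chart \<open>\<gamma>\<close> from the tangent plane at \<open>p\<close> is
  1-Lipschitz, its inverse is Lipschitz by \<open>dist_central_projection_le\<close>, and the
  density of cone measure in the chart lies between \<open>c ^ DIM('a)\<close> and 1. In the plane,
  Hausdorff and Lebesgue measure agree.\<close>

lemma sphere_chart_comparison:
  fixes p :: "'a::euclidean_space" and \<iota> :: "'b::euclidean_space \<Rightarrow> 'a"
  assumes iso: "hyperplane_isometry \<iota> p" and A[measurable]: "A \<in> sets borel" and c: "0 < c" "c < 1"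
    and sub: "\<And>a. a \<in> A \<Longrightarrow> norm a = 1 \<and> c < a \<bullet> p"
  shows "hausdorff_outer_measure DIM('b) A \<le> ennreal (1 / c ^ DIM('a)) * emeasure cone_measure A"
    and "emeasure cone_measure A \<le> ennreal ((1 / c + sqrt (2 - 2 * c) / c\<^sup>2) ^ DIM('b)) * hausdorff_outer_measure DIM('b) A"
proof -
  note [measurable] = hyp_iso_measurable[OF iso]
  define N where "N z = norm (\<iota> z + p)" for z
  define \<gamma> where "\<gamma> z = (\<iota> z + p) /\<^sub>R N z" for z
  have [measurable]: "N \<in> borel_measurable borel" "\<gamma> \<in> borel_measurable borel"
    unfolding N_def \<gamma>_def by measurable
  have N1: "N z \<ge> 1" for z
    using hyp_iso_norm_sum[OF iso, of z 1] unfolding N_def by (intro power2_le_imp_le[of 1]) auto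
  have \<gamma>p: "\<gamma> z \<bullet> p = 1 / N z" for z
    by (simp add: \<gamma>_def inner_add_left hyp_iso_orth[OF iso] hyp_iso_ee[OF iso] divide_inverse)
  define B where "B = {z. \<gamma> z \<in> A}"
  have B[measurable]: "B \<in> sets borel" unfolding B_def by measurable
  have \<gamma>B: "\<gamma> ` B = A"
  proof
    show "A \<subseteq> \<gamma> ` B"
    proof
      fix a assume a: "a \<in> A"
      then have ap: "a \<bullet> p > 0" "norm a = 1" using sub[OF a] c by auto
      obtain z where z: "a /\<^sub>R (a \<bullet> p) = \<iota> z + ((a /\<^sub>R (a \<bullet> p)) \<bullet> p) *\<^sub>R p"
        using hyp_iso_surj[OF iso] by blast
      then have z': "\<iota> z + p = a /\<^sub>R (a \<bullet> p)" using ap by simp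
      have "\<gamma> z = a" using ap by (simp add: \<gamma>_def N_def z')
      then show "a \<in> \<gamma> ` B" using a by (auto simp: B_def intro!: image_eqI[of _ _ z])
    qed
  qed (auto simp: B_def)
  have NB: "N z \<le> 1 / c" if "z \<in> B" for z
    using sub[of "\<gamma> z"] that N1[of z] c unfolding \<gamma>p B_def by (auto simp: field_simps)
  have cone: "emeasure cone_measure A = (\<integral>\<^sup>+z. ennreal (1 / N z ^ DIM('a)) * indicator B z \<partial>lborel)"
  proof -
    have "a \<in> A \<Longrightarrow> norm a = 1 \<and> a \<bullet> p > 0" for a using sub[of a] c by auto
    then show ?thesis
      by (subst cone_measure_gnomonic[OF iso A]) (auto simp: N_def \<gamma>_def B_def indicator_def intro!: nn_integral_cong)
  qed
  have lb: "hausdorff_outer_measure DIM('b) B = emeasure lborel B"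
    by (rule hausdorff_outer_eq_lborel[OF B])
  have "hausdorff_outer_measure DIM('b) A \<le> ennreal (1 ^ DIM('b)) * hausdorff_outer_measure DIM('b) B"
    unfolding \<gamma>B[symmetric]
  proof (rule hausdorff_outer_lipschitz)
    fix x y
    have "dist (\<gamma> x) (\<gamma> y) \<le> dist (\<iota> x + p) (\<iota> y + p)"
      unfolding \<gamma>_def N_def using N1[of x] N1[of y] by (intro dist_normalized_le) (auto simp: N_def)
    also have "\<dots> = dist x y" using hyp_iso_dist[OF iso, of x 1 y 1] by (simp add: dist_Pair_Pair)
    finally show "dist (\<gamma> x) (\<gamma> y) \<le> 1 * dist x y" by simp
  qed simp
  also have "\<dots> = emeasure lborel B" by (simp add: lb)
  also have "\<dots> = (\<integral>\<^sup>+z. indicator B z \<partial>lborel)" by simp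
  also have "\<dots> \<le> (\<integral>\<^sup>+z. ennreal (1 / c ^ DIM('a)) * (ennreal (1 / N z ^ DIM('a)) * indicator B z) \<partial>lborel)"
  proof (rule nn_integral_mono)
    fix z
    show "indicator B z \<le> ennreal (1 / c ^ DIM('a)) * (ennreal (1 / N z ^ DIM('a)) * indicator B z)"
    proof (cases "z \<in> B")
      case True
      have "1 \<le> 1 / (c * N z)" using NB[OF True] N1[of z] c by (simp add: field_simps)
      then have "1 \<le> (1 / (c * N z)) ^ DIM('a)" by (rule one_le_power)
      also have "\<dots> = 1 / c ^ DIM('a) * (1 / N z ^ DIM('a))" by (simp add: power_divide power_mult_distrib)
      finally have "1 \<le> ennreal (1 / c ^ DIM('a) * (1 / N z ^ DIM('a)))" by (simp only: ennreal_ge_1)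
      also have "\<dots> = ennreal (1 / c ^ DIM('a)) * ennreal (1 / N z ^ DIM('a))"
        using c by (intro ennreal_mult') simp
      finally show ?thesis using True by simp
    qed simp
  qed
  also have "\<dots> = ennreal (1 / c ^ DIM('a)) * emeasure cone_measure A"
    unfolding cone by (rule nn_integral_cmult) measurable
  finally show "hausdorff_outer_measure DIM('b) A \<le> ennreal (1 / c ^ DIM('a)) * emeasure cone_measure A" .
  let ?L = "1 / c + sqrt (2 - 2 * c) / c\<^sup>2"
  have L: "?L > 0" using c by (intro add_pos_nonneg) auto
  have lip: "dist x y \<le> ?L * dist (\<gamma> x) (\<gamma> y)" if "x \<in> B" "y \<in> B" for x y
  proof -
    have eq: "\<gamma> z /\<^sub>R (\<gamma> z \<bullet> p) = \<iota> z + p" for z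
      using N1[of z] unfolding \<gamma>p by (simp add: \<gamma>_def)
    have "dist x y = dist (\<iota> x + p) (\<iota> y + p)" using hyp_iso_dist[OF iso, of x 1 y 1] by (simp add: dist_Pair_Pair)
    also have "\<dots> = dist (\<gamma> x /\<^sub>R (\<gamma> x \<bullet> p)) (\<gamma> y /\<^sub>R (\<gamma> y \<bullet> p))" unfolding eq ..
    also have "\<dots> \<le> ?L * dist (\<gamma> x) (\<gamma> y)"
      using sub[of "\<gamma> x"] sub[of "\<gamma> y"] that c hyp_iso_norm(1)[OF iso] by (intro dist_central_projection_le) (auto simp: B_def)
    finally show ?thesis .
  qed
  have inj: "inj_on \<gamma> B"
    using lip by (intro inj_onI) (metis dist_eq_0_iff dist_le_zero_iff mult_zero_right)
  have "emeasure cone_measure A \<le> (\<integral>\<^sup>+z. indicator B z \<partial>lborel)"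
    unfolding cone
  proof (rule nn_integral_mono)
    fix z
    have "1 / N z ^ DIM('a) \<le> 1" using N1[of z] by (simp add: one_le_power)
    then have "ennreal (1 / N z ^ DIM('a)) \<le> 1" by (simp add: ennreal_le_1)
    then show "ennreal (1 / N z ^ DIM('a)) * indicator B z \<le> indicator B z"
      by (auto simp: indicator_def)
  qed
  also have "\<dots> = hausdorff_outer_measure DIM('b) B" by (simp add: lb)
  also have "\<dots> = hausdorff_outer_measure DIM('b) (inv_into B \<gamma> ` A)"
    unfolding \<gamma>B[symmetric] using inj by simp
  also have "\<dots> \<le> ennreal (?L ^ DIM('b)) * hausdorff_outer_measure DIM('b) A"
    unfolding \<gamma>B[symmetric] using lip inj by (intro hausdorff_outer_lipschitz[OF L]) (auto simp: inv_into_f_f)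
  finally show "emeasure cone_measure A \<le> ennreal (?L ^ DIM('b)) * hausdorff_outer_measure DIM('b) A" .
qed

lemma ennreal_le_of_factor_limit:
  fixes a X :: ennreal and f :: "real \<Rightarrow> real"
  assumes le: "\<And>c. 0 < c \<Longrightarrow> c < 1 \<Longrightarrow> a \<le> ennreal (f c) * X" and f: "(f \<longlongrightarrow> 1) (at_left 1)"
  shows "a \<le> X"
proof (cases "X = top")
  case False
  have "((\<lambda>c. X * ennreal (f c)) \<longlongrightarrow> X * ennreal 1) (at_left 1)"
    using f False by (intro ennreal_tendsto_cmult tendsto_ennrealI) (auto simp: less_top)
  moreover have "eventually (\<lambda>c::real. 0 < c \<and> c < 1) (at_left 1)"
    using eventually_at_left_real[of 0 1] by (auto elim!: eventually_mono)
  then have "eventually (\<lambda>c. a \<le> X * ennreal (f c)) (at_left 1)"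
    by eventually_elim (use le in \<open>auto simp: mult.commute\<close>)
  ultimately show ?thesis using tendsto_lowerbound[of _ "X * ennreal 1" "at_left (1::real)" a] by simp
qed simp

text \<open>Finitely many caps cover the sphere. The chart constants depend on \<open>c\<close> but
  not on the cap, so the comparison survives summation over disjoint pieces of \<open>A\<close>;
  letting \<open>c\<close> tend to 1 then gives equality.\<close>

lemma hausdorff_measure_sphere:
  fixes A :: "'a::euclidean_space set"
  assumes A[measurable]: "A \<in> sets borel" and sub: "A \<subseteq> sphere 0 1" and dim: "DIM('a) = DIM('b::euclidean_space) + 1"
  shows "emeasure (hausdorff_measure DIM('b)) A = emeasure cone_measure A"
proof -
  let ?H = "hausdorff_measure DIM('b) :: 'a measure"
  let ?L = "\<lambda>c. 1 / c + sqrt (2 - 2 * c) / c\<^sup>2 :: real"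
  have both: "emeasure ?H A \<le> ennreal (1 / c ^ DIM('a)) * emeasure cone_measure A \<and>
      emeasure cone_measure A \<le> ennreal (?L c ^ DIM('b)) * emeasure ?H A" if c: "0 < c" "c < 1" for c
  proof -
    let ?cap = "\<lambda>p. {a. c < a \<bullet> p}"
    have "compact (sphere (0::'a) 1)" by simp
    moreover have "sphere (0::'a) 1 \<subseteq> (\<Union>p\<in>sphere 0 1. ?cap p)"
      using c by (auto simp: dot_square_norm intro!: bexI)
    ultimately obtain P where P: "P \<subseteq> sphere (0::'a) 1" "finite P" "sphere (0::'a) 1 \<subseteq> (\<Union>p\<in>P. ?cap p)"
      using compactE_image[of "sphere (0::'a) 1" "sphere 0 1" ?cap] open_halfspace_gt[of c]
      by (metis (no_types, lifting) Collect_cong inner_commute)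
    have "P \<noteq> {}" using P(3) by auto
    \<comment> \<open>The finite set of centres is listed as a sequence with repetitions;
      \<open>disjointed\<close> makes the pieces of repeated caps empty.\<close>
    define q where "q = from_nat_into P"
    have q: "q i \<in> P" for i using from_nat_into[OF \<open>P \<noteq> {}\<close>] by (simp add: q_def)
    have rq: "range q = P" unfolding q_def using \<open>P \<noteq> {}\<close> P(2) by (simp add: countable_finite range_from_nat_into)
    define B where "B i = A \<inter> ?cap (q i)" for i :: nat
    have [measurable]: "B i \<in> sets borel" for i unfolding B_def by measurable
    define D where "D = disjointed B"
    have D: "D i \<in> sets borel" for i
    proof -
      have "range (disjointed B) \<subseteq> sets borel" by (rule sets.range_disjointed_sets) auto
      then show ?thesis unfolding D_def by blast
    qed
    have dD: "disjoint_family D" unfolding D_def by (rule disjoint_family_disjointed)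
    have UD: "(\<Union>i. D i) = A"
    proof -
      have "A \<subseteq> (\<Union>p\<in>range q. ?cap p)" using sub P(3) unfolding rq by (rule subset_trans)
      then show ?thesis unfolding D_def UN_disjointed_eq B_def by blast
    qed
    have DB: "a \<in> D i \<Longrightarrow> norm a = 1 \<and> c < a \<bullet> q i" for a i
    proof -
      assume "a \<in> D i"
      then have "a \<in> A" "c < a \<bullet> q i" using disjointed_subset[of B i] by (auto simp: D_def B_def)
      then show "norm a = 1 \<and> c < a \<bullet> q i" using subsetD[OF sub] by auto
    qed
    have n1: "norm (q i) = 1" for i using subsetD[OF P(1) q[of i]] by simp
    have chart: "emeasure ?H (D i) \<le> ennreal (1 / c ^ DIM('a)) * emeasure cone_measure (D i)"
        "emeasure cone_measure (D i) \<le> ennreal (?L c ^ DIM('b)) * emeasure ?H (D i)" for i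
    proof -
      obtain \<iota> :: "'b \<Rightarrow> 'a" where \<iota>: "hyperplane_isometry \<iota> (q i)"
        using hyperplane_isometry_exists[OF n1 dim] by blast
      show "emeasure ?H (D i) \<le> ennreal (1 / c ^ DIM('a)) * emeasure cone_measure (D i)"
        "emeasure cone_measure (D i) \<le> ennreal (?L c ^ DIM('b)) * emeasure ?H (D i)"
        using sphere_chart_comparison[OF \<iota> D c DB] by (simp_all add: emeasure_hausdorff_measure[OF D])
    qed
    have "emeasure ?H A = (\<Sum>i. emeasure ?H (D i))" "emeasure cone_measure A = (\<Sum>i. emeasure cone_measure (D i))"
      using D by (subst suminf_emeasure[OF _ dD]; auto simp: UD)+
    moreover have "(\<Sum>i. emeasure ?H (D i)) \<le> (\<Sum>i. ennreal (1 / c ^ DIM('a)) * emeasure cone_measure (D i))"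
        "(\<Sum>i. emeasure cone_measure (D i)) \<le> (\<Sum>i. ennreal (?L c ^ DIM('b)) * emeasure ?H (D i))"
      by (intro suminf_le chart; auto)+
    ultimately show ?thesis by simp
  qed
  show ?thesis
  proof (rule antisym)
    show "emeasure ?H A \<le> emeasure cone_measure A"
      by (rule ennreal_le_of_factor_limit[OF conjunct1[OF both]]) (auto intro!: tendsto_eq_intros)
    show "emeasure cone_measure A \<le> emeasure ?H A"
      by (rule ennreal_le_of_factor_limit[OF conjunct2[OF both]]) (auto intro!: tendsto_eq_intros)
  qed
qed

lemma emeasure_cone_measure_finite: "emeasure (cone_measure :: 'a::euclidean_space measure) UNIV < \<infinity>"
proof -
  have "ennreal (ln 2) * emeasure (cone_measure :: 'a measure) UNIV
      = (\<integral>\<^sup>+x. ennreal (1 / norm x ^ DIM('a)) * indicator {1..<2} (norm (x::'a)) \<partial>lborel)"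
    using nn_integral_cone_measure[of "\<lambda>x::'a. 1"] by simp
  also have "\<dots> \<le> (\<integral>\<^sup>+x. indicator (ball 0 2) (x::'a) \<partial>lborel)"
  proof (rule nn_integral_mono)
    fix x :: 'a
    have "1 / norm x ^ DIM('a) \<le> 1" if "1 \<le> norm x" using one_le_power[OF that, of "DIM('a)"] by (simp add: divide_le_eq_1)
    then show "ennreal (1 / norm x ^ DIM('a)) * indicator {1..<2} (norm x) \<le> indicator (ball 0 2) x"
      by (auto simp: indicator_def ennreal_le_1)
  qed
  also have "\<dots> < \<infinity>" by (simp add: emeasure_ball)
  finally show ?thesis
    by (metis ennreal_mult_eq_top_iff infinity_ennreal_def ennreal_eq_0_iff ln_gt_zero less_irrefl less_top
        not_le one_less_numeral_iff semiring_norm(76))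
qed

lemma AE_cone_measure: "AE x in (cone_measure :: 'a::euclidean_space measure). norm x = 1"
  unfolding cone_measure_def
proof (subst AE_distr_iff)
  have "norm (x /\<^sub>R norm x) = 1" if "1 \<le> norm x" for x :: 'a
  proof -
    have "norm x \<noteq> 0" using that by linarith
    then show ?thesis by (simp add: left_inverse)
  qed
  then show "AE x in density lborel (\<lambda>x::'a. indicator {1..<2} (norm x) * ennreal (1 / (ln 2 * norm x ^ DIM('a)))).
      norm (x /\<^sub>R norm x) = 1"
    by (subst AE_density) (auto simp: indicator_def intro!: AE_I2)
qed auto

lemma emeasure_density_hausdorff_indicator:
  assumes "S \<in> sets borel" "A \<in> sets borel"
  shows "emeasure (density (hausdorff_measure k) (indicator S)) A = emeasure (hausdorff_measure k) (S \<inter> A)"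
proof -
  have "indicator S \<in> borel_measurable (hausdorff_measure k)" using assms by simp
  then show ?thesis using assms by (subst emeasure_density) (auto simp: indicator_inter_arith[symmetric])
qed

lemma density_hausdorff_sphere:
  assumes dim: "DIM('a::euclidean_space) = DIM('b::euclidean_space) + 1"
  shows "density (hausdorff_measure DIM('b)) (indicator (sphere (0::'a) 1)) = cone_measure"
proof (rule measure_eqI)
  fix A :: "'a set" assume "A \<in> sets (density (hausdorff_measure DIM('b)) (indicator (sphere (0::'a) 1)))"
  then have A: "A \<in> sets borel" by simp
  have "emeasure (density (hausdorff_measure DIM('b)) (indicator (sphere (0::'a) 1))) A
      = emeasure (hausdorff_measure DIM('b)) (sphere 0 1 \<inter> A)"
    using A by (intro emeasure_density_hausdorff_indicator) auto
  also have "\<dots> = emeasure cone_measure (sphere 0 1 \<inter> A)"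
    using A by (intro hausdorff_measure_sphere dim) auto
  also have "\<dots> = emeasure cone_measure A"
    using A AE_cone_measure by (intro emeasure_eq_AE) (auto elim!: eventually_mono)
  finally show "emeasure (density (hausdorff_measure DIM('b)) (indicator (sphere (0::'a) 1))) A = emeasure cone_measure A" .
qed simp

text \<open>Hausdorff measure is intrinsic to the metric, so the unit sphere of the smaller space
  and the equator orthogonal to \<open>e\<close> carry the same measure.\<close>

lemma distr_hausdorff_sphere_hyperplane:
  fixes e :: "'a::euclidean_space" and \<iota> :: "'b::euclidean_space \<Rightarrow> 'a"
  assumes iso: "hyperplane_isometry \<iota> e"
  shows "distr (density (hausdorff_measure k) (indicator (sphere 0 1))) borel \<iota>
    = density (hausdorff_measure k) (indicator {\<xi>. norm \<xi> = 1 \<and> e \<bullet> \<xi> = 0})"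
    (is "?l = density _ (indicator ?E)")
proof (rule measure_eqI)
  note [measurable] = hyp_iso_measurable[OF iso]
  have [measurable]: "?E \<in> sets borel" by measurable
  fix A :: "'a set" assume "A \<in> sets ?l"
  then have A[measurable]: "A \<in> sets borel" by simp
  have B[measurable]: "\<iota> -` A \<in> sets borel" using measurable_sets[OF hyp_iso_measurable[OF iso] A] by simp
  have img: "\<iota> ` (sphere 0 1 \<inter> \<iota> -` A) = ?E \<inter> A"
  proof
    show "?E \<inter> A \<subseteq> \<iota> ` (sphere 0 1 \<inter> \<iota> -` A)"
    proof
      fix x assume x: "x \<in> ?E \<inter> A"
      then have "x \<in> range \<iota>" unfolding hyp_iso_range[OF iso] by (simp add: inner_commute)
      then show "x \<in> \<iota> ` (sphere 0 1 \<inter> \<iota> -` A)" using x by (auto simp: hyp_iso_norm[OF iso])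
    qed
  qed (auto simp: hyp_iso_norm[OF iso] hyp_iso_orth[OF iso])
  have "emeasure ?l A = emeasure (hausdorff_measure k) (sphere 0 1 \<inter> \<iota> -` A)"
    using B by (simp add: emeasure_distr emeasure_density_hausdorff_indicator)
  also have "\<dots> = hausdorff_outer_measure k (sphere 0 1 \<inter> \<iota> -` A)"
    using B by (intro emeasure_hausdorff_measure) simp
  also have "\<dots> = hausdorff_outer_measure k (\<iota> ` (sphere 0 1 \<inter> \<iota> -` A))"
    using hyp_iso_dist[OF iso, of _ 0 _ 0] by (intro hausdorff_outer_isometry[symmetric]) (simp add: dist_Pair_Pair)
  also have "\<dots> = emeasure (hausdorff_measure k) (?E \<inter> A)"
    unfolding img by (rule emeasure_hausdorff_measure[symmetric]) simp
  also have "\<dots> = emeasure (density (hausdorff_measure k) (indicator ?E)) A"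
    by (intro emeasure_density_hausdorff_indicator[symmetric]) auto
  finally show "emeasure ?l A = emeasure (density (hausdorff_measure k) (indicator ?E)) A" .
qed simp

text \<open>Cone measures on both sides of the cylinder formula are translated into Hausdorff
  measures: directly on the full sphere, and through the isometric embedding on the equator.\<close>

lemma hausdorff_sphere_cylinder:
  fixes e :: "real^'n::finite"
  assumes n: "CARD('n) \<ge> 3" and e: "norm e = 1"
  defines "E \<equiv> {\<xi>. norm \<xi> = 1 \<and> e \<bullet> \<xi> = 0}"
  shows "emeasure (hausdorff_measure (CARD('n) - 2)) E < \<infinity>"
    and "\<And>h :: real^'n \<Rightarrow> ennreal. h \<in> borel_measurable borel \<Longrightarrow>
      (\<And>c x. c > 0 \<Longrightarrow> h (c *\<^sub>R x) = ennreal (1 / c ^ CARD('n)) * h x) \<Longrightarrow>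
      (\<integral>\<^sup>+\<xi>. h \<xi> * indicator {\<xi>. norm \<xi> = 1} \<xi> \<partial>hausdorff_measure (CARD('n) - 1))
      = (\<integral>\<^sup>+\<eta>. (\<integral>\<^sup>+s. h (\<eta> + s *\<^sub>R e) \<partial>lborel) * indicator E \<eta> \<partial>hausdorff_measure (CARD('n) - 2))"
proof -
  \<comment> \<open>Two index removals are required, for the hyperplane and for the tangent planes
    of its unit sphere; n >= 3 ensures that both really lower the cardinality.\<close>
  have c1: "CARD('n) = CARD('n punctured) + 1" using n by (intro card_punctured) simp
  have c2: "CARD('n punctured) = CARD('n punctured punctured) + 1" using n c1 by (intro card_punctured) simp
  have d1: "DIM(real^'n) = DIM(real^'n punctured) + 1" using c1 by simp
  have d2: "DIM(real^'n punctured) = DIM(real^'n punctured punctured) + 1" using c2 by simp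
  have k1: "DIM(real^'n punctured) = CARD('n) - 1" and k2: "DIM(real^'n punctured punctured) = CARD('n) - 2"
    using c1 c2 by auto
  obtain \<iota> :: "real^'n punctured \<Rightarrow> real^'n" where iso: "hyperplane_isometry \<iota> e"
    using hyperplane_isometry_exists[OF e d1] by blast
  note [measurable] = hyp_iso_measurable[OF iso]
  have E[measurable]: "E \<in> sets borel" unfolding E_def by measurable
  let ?H2 = "hausdorff_measure (CARD('n) - 2) :: (real^'n) measure"
  let ?C = "cone_measure :: (real^'n punctured) measure"
  have C: "density (hausdorff_measure (CARD('n) - 2)) (indicator (sphere 0 1)) = ?C"
    using density_hausdorff_sphere[OF d2] unfolding k2 .
  have D: "distr ?C borel \<iota> = density ?H2 (indicator E)"
    using distr_hausdorff_sphere_hyperplane[OF iso] unfolding E_def C[symmetric] .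
  have "emeasure ?H2 E = emeasure (density ?H2 (indicator E)) UNIV"
    by (simp add: emeasure_density)
  also have "\<dots> = emeasure ?C UNIV" unfolding D[symmetric] by (simp add: emeasure_distr)
  finally show "emeasure ?H2 E < \<infinity>" using emeasure_cone_measure_finite by simp
  fix h :: "real^'n \<Rightarrow> ennreal"
  assume h[measurable]: "h \<in> borel_measurable borel"
    and hom: "\<And>c x. c > 0 \<Longrightarrow> h (c *\<^sub>R x) = ennreal (1 / c ^ CARD('n)) * h x"
  have S: "density (hausdorff_measure (CARD('n) - 1)) (indicator {\<xi>. norm \<xi> = 1}) = (cone_measure :: (real^'n) measure)"
    using density_hausdorff_sphere[OF d1] unfolding k1 by (simp add: sphere_def)
  have "(\<integral>\<^sup>+\<xi>. h \<xi> * indicator {\<xi>. norm \<xi> = 1} \<xi> \<partial>hausdorff_measure (CARD('n) - 1)) = (\<integral>\<^sup>+\<xi>. h \<xi> \<partial>cone_measure)"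
    unfolding S[symmetric] by (subst nn_integral_density) (auto simp: mult.commute)
  also have "\<dots> = (\<integral>\<^sup>+\<eta>. \<integral>\<^sup>+s. h (\<iota> \<eta> + s *\<^sub>R e) \<partial>lborel \<partial>?C)"
    by (rule nn_integral_cone_measure_cylinder[OF iso h]) (simp add: hom)
  also have "\<dots> = (\<integral>\<^sup>+\<eta>. \<integral>\<^sup>+s. h (\<eta> + s *\<^sub>R e) \<partial>lborel \<partial>distr ?C borel \<iota>)"
    by (subst nn_integral_distr) auto
  also have "\<dots> = (\<integral>\<^sup>+\<eta>. (\<integral>\<^sup>+s. h (\<eta> + s *\<^sub>R e) \<partial>lborel) * indicator E \<eta> \<partial>?H2)"
    unfolding D by (subst nn_integral_density) (auto simp: mult.commute)
  finally show "(\<integral>\<^sup>+\<xi>. h \<xi> * indicator {\<xi>. norm \<xi> = 1} \<xi> \<partial>hausdorff_measure (CARD('n) - 1))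
      = (\<integral>\<^sup>+\<eta>. (\<integral>\<^sup>+s. h (\<eta> + s *\<^sub>R e) \<partial>lborel) * indicator E \<eta> \<partial>?H2)" .
qed

section \<open>Directional derivatives of rational functions\<close>

definition dirder :: "'a::real_normed_vector \<Rightarrow> ('a \<Rightarrow> real) \<Rightarrow> 'a \<Rightarrow> real" where
  "dirder a f x = deriv (\<lambda>t. f (x + t *\<^sub>R a)) 0"

lemma partial_derivative_eq_dirder: "partial_derivative i f = dirder (axis i 1) f"
  by (simp add: fun_eq_iff partial_derivative_def dirder_def)

lemma dirder_eqI: "((\<lambda>t. f (x + t *\<^sub>R a)) has_real_derivative D) (at 0) \<Longrightarrow> dirder a f x = D"
  unfolding dirder_def by (rule DERIV_imp_deriv)

lemma eventually_line_in_open: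
  fixes a x :: "'a::real_normed_vector"
  assumes "open U" "x \<in> U"
  shows "eventually (\<lambda>t. x + t *\<^sub>R a \<in> U) (nhds (0::real))"
proof -
  have "open ((\<lambda>t. x + t *\<^sub>R a) -` U)"
    by (rule open_vimage[OF assms(1)]) (intro continuous_intros)
  then show ?thesis using assms(2) eventually_nhds_in_open[of "(\<lambda>t. x + t *\<^sub>R a) -` U" 0] by simp
qed

lemma dirder_cong_open:
  assumes "open U" "x \<in> U" "\<And>y. y \<in> U \<Longrightarrow> f y = g y"
  shows "dirder a f x = dirder a g x"
  unfolding dirder_def
  by (rule deriv_cong_ev[OF eventually_mono[OF eventually_line_in_open[OF assms(1,2), of a]]]) (auto simp: assms(3))

lemma has_derivative_imp_line:
  fixes f :: "'a::real_normed_vector \<Rightarrow> real"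
  assumes "(f has_derivative f') (at x)"
  shows "((\<lambda>t. f (x + t *\<^sub>R a)) has_real_derivative f' a) (at 0)"
proof -
  have "((\<lambda>t. x + t *\<^sub>R a) has_derivative (\<lambda>t. t *\<^sub>R a)) (at 0)"
    by (auto intro!: derivative_eq_intros)
  then have "((\<lambda>t. f (x + t *\<^sub>R a)) has_derivative (\<lambda>t. f' (t *\<^sub>R a))) (at 0)"
    using assms by (intro has_derivative_compose[of _ _ 0 UNIV f f']) auto
  moreover have "f' (t *\<^sub>R a) = f' a * t" for t
    using has_derivative_linear[OF assms] by (simp add: linear_cmul)
  ultimately show ?thesis by (simp add: has_field_derivative_def)
qed

lemma real_polynomial_function_inner:
  "real_polynomial_function (\<lambda>\<xi>::'a::real_inner. a \<bullet> \<xi>)"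
  by (intro real_polynomial_function.intros(1) bounded_linear_inner_right)

lemma real_polynomial_function_inner_self:
  "real_polynomial_function (\<lambda>\<xi>::real^'n::finite. \<xi> \<bullet> \<xi>)"
proof -
  have "real_polynomial_function (\<lambda>\<xi>::real^'n. \<Sum>i\<in>UNIV. \<xi> $ i * \<xi> $ i)"
    by (intro real_polynomial_function_sum real_polynomial_function.intros bounded_linear_vec_nth) auto
  then show ?thesis by (simp add: inner_vec_def)
qed

lemma real_polynomial_function_line_derivative:
  fixes N :: "'a::real_normed_vector \<Rightarrow> real"
  assumes "real_polynomial_function N"
  shows "\<exists>N'. real_polynomial_function N' \<and> (\<forall>x. ((\<lambda>t. N (x + t *\<^sub>R a)) has_real_derivative N' x) (at 0))"
  using assms
proof (induction N rule: real_polynomial_function.induct)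
  case (linear f)
  have "((\<lambda>t. f (x + t *\<^sub>R a)) has_real_derivative f a) (at 0)" for x
    by (rule has_derivative_imp_line[OF bounded_linear_imp_has_derivative[OF linear]])
  then show ?case by (intro exI[of _ "\<lambda>_. f a"]) (auto intro: real_polynomial_function.intros(2))
next
  case (const c)
  then show ?case by (intro exI[of _ "\<lambda>_. 0"]) (auto intro: real_polynomial_function.intros(2))
next
  case (add f g)
  then obtain f' g' where "real_polynomial_function f'" "real_polynomial_function g'"
    "\<And>x. ((\<lambda>t. f (x + t *\<^sub>R a)) has_real_derivative f' x) (at 0)"
    "\<And>x. ((\<lambda>t. g (x + t *\<^sub>R a)) has_real_derivative g' x) (at 0)" by blast
  then show ?case by (intro exI[of _ "\<lambda>x. f' x + g' x"]) (auto intro: real_polynomial_function.intros(3) DERIV_add)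
next
  case (mult f g)
  then obtain f' g' where fg: "real_polynomial_function f'" "real_polynomial_function g'"
    "\<And>x. ((\<lambda>t. f (x + t *\<^sub>R a)) has_real_derivative f' x) (at 0)"
    "\<And>x. ((\<lambda>t. g (x + t *\<^sub>R a)) has_real_derivative g' x) (at 0)" by blast
  have "((\<lambda>t. f (x + t *\<^sub>R a) * g (x + t *\<^sub>R a)) has_real_derivative f' x * g x + g' x * f x) (at 0)" for x
    using DERIV_mult[OF fg(3,4), of x x] by simp
  then show ?case using fg(1,2) mult.hyps
    by (intro exI[of _ "\<lambda>x. f' x * g x + g' x * f x"])
      (auto intro: real_polynomial_function.intros(3) real_polynomial_function.intros(4))
qed

text \<open>Polynomials over powers of one fixed denominator are closed under polynomial factors and
  directional derivatives. This algebraic class \<open>rat\<close> replaces smoothness on the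
  punctured space, so iterated derivatives need no higher-order calculus.\<close>

locale punctured_denominator =
  fixes D :: "'a::euclidean_space \<Rightarrow> real"
  assumes poly_D: "real_polynomial_function D" and D_nz: "\<And>\<xi>. \<xi> \<noteq> 0 \<Longrightarrow> D \<xi> \<noteq> 0"
begin

definition rat :: "('a \<Rightarrow> real) \<Rightarrow> bool" where
  "rat q \<longleftrightarrow> (\<exists>N p. real_polynomial_function N \<and> (\<forall>\<xi>. \<xi> \<noteq> 0 \<longrightarrow> q \<xi> = N \<xi> / D \<xi> ^ p))"

lemma ratI: "real_polynomial_function N \<Longrightarrow> (\<And>\<xi>. \<xi> \<noteq> 0 \<Longrightarrow> q \<xi> = N \<xi> / D \<xi> ^ p) \<Longrightarrow> rat q"
  unfolding rat_def by blast

lemma rat_mult_poly: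
  assumes "real_polynomial_function P" "rat q"
  shows "rat (\<lambda>\<xi>. P \<xi> * q \<xi>)"
proof -
  obtain N p where "real_polynomial_function N" "\<And>\<xi>. \<xi> \<noteq> 0 \<Longrightarrow> q \<xi> = N \<xi> / D \<xi> ^ p"
    using assms(2) unfolding rat_def by blast
  then show ?thesis using assms(1)
    by (intro ratI[of "\<lambda>\<xi>. P \<xi> * N \<xi>" _ p]) (auto intro: real_polynomial_function.intros(4))
qed

lemma rat_differentiable:
  assumes "rat q" "\<xi> \<noteq> 0"
  shows "q differentiable (at \<xi>)"
proof -
  obtain N p where N: "real_polynomial_function N" "\<And>\<xi>. \<xi> \<noteq> 0 \<Longrightarrow> q \<xi> = N \<xi> / D \<xi> ^ p"
    using assms(1) unfolding rat_def by blast
  have "(\<lambda>\<xi>. N \<xi> / D \<xi> ^ p) differentiable (at \<xi>)"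
    using D_nz[OF assms(2)] N(1) poly_D
    by (intro differentiable_divide differentiable_power differentiable_at_real_polynomial_function) auto
  then obtain F where "((\<lambda>\<xi>. N \<xi> / D \<xi> ^ p) has_derivative F) (at \<xi>)" unfolding differentiable_def by blast
  then have "(q has_derivative F) (at \<xi>)"
    by (rule has_derivative_transform_within_open[of _ _ _ _ "- {0}"]) (use assms(2) N(2) in auto)
  then show ?thesis unfolding differentiable_def by blast
qed

lemma rat_continuous: "rat q \<Longrightarrow> continuous_on (- {0}) q"
  using rat_differentiable by (intro continuous_at_imp_continuous_on) (auto intro: differentiable_imp_continuous_within)

lemma rat_has_derivative:
  assumes "rat q" "\<xi> \<noteq> 0"
  shows "(q has_derivative (\<lambda>a. dirder a q \<xi>)) (at \<xi>)"
proof -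
  obtain F where F: "(q has_derivative F) (at \<xi>)" using rat_differentiable[OF assms] unfolding differentiable_def by blast
  have "dirder a q \<xi> = F a" for a by (rule dirder_eqI[OF has_derivative_imp_line[OF F]])
  then show ?thesis using F by simp
qed

lemma rat_line_derivative:
  assumes "rat q" "\<eta> + t *\<^sub>R e \<noteq> 0"
  shows "((\<lambda>t. q (\<eta> + t *\<^sub>R e)) has_real_derivative dirder e q (\<eta> + t *\<^sub>R e)) (at t)"
proof -
  have "((\<lambda>s. q ((\<eta> + t *\<^sub>R e) + s *\<^sub>R e)) has_real_derivative dirder e q (\<eta> + t *\<^sub>R e)) (at 0)"
    by (rule has_derivative_imp_line[OF rat_has_derivative[OF assms]])
  then have "((\<lambda>s. q (\<eta> + (t + s) *\<^sub>R e)) has_real_derivative dirder e q (\<eta> + t *\<^sub>R e)) (at 0)"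
    by (simp add: algebra_simps)
  then show ?thesis using DERIV_at_within_shift[of "\<lambda>t. q (\<eta> + t *\<^sub>R e)" _ t 0 UNIV] by simp
qed

lemma dirder_rat:
  assumes "rat q"
  shows "rat (dirder a q)"
proof -
  obtain N p where N: "real_polynomial_function N" "\<And>\<xi>. \<xi> \<noteq> 0 \<Longrightarrow> q \<xi> = N \<xi> / D \<xi> ^ p"
    using assms(1) unfolding rat_def by blast
  obtain N' where N': "real_polynomial_function N'" "\<And>x. ((\<lambda>t. N (x + t *\<^sub>R a)) has_real_derivative N' x) (at 0)"
    using real_polynomial_function_line_derivative[OF N(1)] by blast
  obtain D' where D': "real_polynomial_function D'" "\<And>x. ((\<lambda>t. D (x + t *\<^sub>R a) ^ p) has_real_derivative D' x) (at 0)"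
    using real_polynomial_function_line_derivative[OF real_polynomial_function_power[OF poly_D]] by blast
  show ?thesis
  proof (rule ratI)
    show "real_polynomial_function (\<lambda>\<xi>. N' \<xi> * D \<xi> ^ p - N \<xi> * D' \<xi>)"
      using N(1) N'(1) D'(1) poly_D
      by (intro real_polynomial_function_diff real_polynomial_function.intros(4) real_polynomial_function_power)
    fix \<xi> :: 'a assume nz: "\<xi> \<noteq> 0"
    have "dirder a q \<xi> = dirder a (\<lambda>\<xi>. N \<xi> / D \<xi> ^ p) \<xi>"
      by (rule dirder_cong_open[of "- {0}"]) (use nz N(2) in auto)
    also have "\<dots> = (N' \<xi> * D \<xi> ^ p - N \<xi> * D' \<xi>) / (D \<xi> ^ p * D \<xi> ^ p)"
      using DERIV_divide[OF N'(2) D'(2), of \<xi> \<xi>] D_nz[OF nz] by (intro dirder_eqI) auto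
    finally show "dirder a q \<xi> = (N' \<xi> * D \<xi> ^ p - N \<xi> * D' \<xi>) / D \<xi> ^ (p + p)"
      by (simp add: power_add)
  qed
qed

lemma dirder_pow_rat: "rat q \<Longrightarrow> rat ((dirder a ^^ k) q)"
  by (induction k) (auto intro: dirder_rat)

lemma dirder_pow_cong:
  "(\<And>\<xi>. \<xi> \<noteq> 0 \<Longrightarrow> q \<xi> = r \<xi>) \<Longrightarrow> \<xi> \<noteq> 0 \<Longrightarrow> (dirder a ^^ k) q \<xi> = (dirder a ^^ k) r \<xi>"
proof (induction k arbitrary: \<xi>)
  case (Suc k)
  then show ?case using dirder_cong_open[of "- {0}" \<xi> "(dirder a ^^ k) q" "(dirder a ^^ k) r" a] by auto
qed simp

lemma rat_line0:
  assumes "rat q" "\<xi> \<noteq> 0"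
  shows "((\<lambda>t. q (\<xi> + t *\<^sub>R e)) has_real_derivative dirder e q \<xi>) (at 0)"
  using rat_line_derivative[of q \<xi> 0 e] assms by simp

lemma dirder_pow_sum:
  assumes I: "finite I" and q: "\<And>i. i \<in> I \<Longrightarrow> rat (q i)" and \<xi>: "\<xi> \<noteq> 0"
  shows "(dirder a ^^ k) (\<lambda>\<xi>. \<Sum>i\<in>I. c i * q i \<xi>) \<xi> = (\<Sum>i\<in>I. c i * (dirder a ^^ k) (q i) \<xi>)"
  using \<xi>
proof (induction k arbitrary: \<xi>)
  case (Suc k)
  have "(dirder a ^^ Suc k) (\<lambda>\<xi>. \<Sum>i\<in>I. c i * q i \<xi>) \<xi> = dirder a (\<lambda>\<xi>. \<Sum>i\<in>I. c i * (dirder a ^^ k) (q i) \<xi>) \<xi>"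
    using Suc by (simp, intro dirder_cong_open[of "- {0}"]) auto
  also have "\<dots> = (\<Sum>i\<in>I. c i * dirder a ((dirder a ^^ k) (q i)) \<xi>)"
    using Suc.prems q by (intro dirder_eqI DERIV_sum DERIV_cmult rat_line0 dirder_pow_rat)
  finally show ?case by simp
qed simp

text \<open>Leibniz' rule with a linear factor, whose derivatives beyond the first vanish. The two
  surviving terms are those that the quotient rule yields in \<open>K_deriv\<close>.\<close>

lemma dirder_pow_inner_mult:
  assumes q: "rat q" and \<xi>: "\<xi> \<noteq> 0"
  shows "(dirder e ^^ Suc k) (\<lambda>\<xi>. (a \<bullet> \<xi>) * q \<xi>) \<xi>
    = (a \<bullet> \<xi>) * (dirder e ^^ Suc k) q \<xi> + real (Suc k) * (a \<bullet> e) * (dirder e ^^ k) q \<xi>"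
  using \<xi>
proof (induction k arbitrary: \<xi>)
  case 0
  have "((\<lambda>t. (a \<bullet> (\<xi> + t *\<^sub>R e)) * q (\<xi> + t *\<^sub>R e)) has_real_derivative
      (a \<bullet> \<xi>) * dirder e q \<xi> + (a \<bullet> e) * q \<xi>) (at 0)"
    by (auto intro!: derivative_eq_intros rat_line0[OF q 0] simp: inner_add_right)
  then show ?case by (simp add: dirder_eqI)
next
  case (Suc k)
  let ?r = "\<lambda>k. (dirder e ^^ k) q"
  have "((\<lambda>t. (a \<bullet> (\<xi> + t *\<^sub>R e)) * ?r (Suc k) (\<xi> + t *\<^sub>R e) + real (Suc k) * (a \<bullet> e) * ?r k (\<xi> + t *\<^sub>R e))
      has_real_derivative (a \<bullet> \<xi>) * dirder e (?r (Suc k)) \<xi> + (a \<bullet> e) * ?r (Suc k) \<xi> + real (Suc k) * (a \<bullet> e) * dirder e (?r k) \<xi>) (at 0)"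
    by (auto intro!: derivative_eq_intros rat_line0[OF dirder_pow_rat[OF q] Suc.prems]
         rat_line0[OF dirder_rat[OF dirder_pow_rat[OF q]] Suc.prems] simp: inner_add_right)
  then have "dirder e (\<lambda>\<xi>. (a \<bullet> \<xi>) * ?r (Suc k) \<xi> + real (Suc k) * (a \<bullet> e) * ?r k \<xi>) \<xi>
      = (a \<bullet> \<xi>) * dirder e (?r (Suc k)) \<xi> + (a \<bullet> e) * ?r (Suc k) \<xi> + real (Suc k) * (a \<bullet> e) * dirder e (?r k) \<xi>"
    by (rule dirder_eqI)
  moreover have "(dirder e ^^ Suc (Suc k)) (\<lambda>\<xi>. (a \<bullet> \<xi>) * q \<xi>) \<xi>
      = dirder e (\<lambda>\<xi>. (a \<bullet> \<xi>) * ?r (Suc k) \<xi> + real (Suc k) * (a \<bullet> e) * ?r k \<xi>) \<xi>"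
    unfolding funpow.simps(2)[of "Suc k"] o_apply using Suc.prems
    by (intro dirder_cong_open[of "- {0}"]) (auto simp: Suc.IH simp del: funpow.simps)
  ultimately show ?case by (simp add: algebra_simps)
qed

end

text \<open>The head of an index list is the outermost derivative. Summing over it first gives a
  derivative along \<open>v\<close>, because the total derivative is linear in the
  direction.\<close>

lemma nabla_pow_eq_dirder_pow:
  fixes f :: "real^'n::finite \<Rightarrow> real"
  assumes "punctured_denominator D" "punctured_denominator.rat D f" "\<xi> \<noteq> 0"
  shows "nabla_pow k f \<xi> v = (dirder v ^^ k) f \<xi>"
proof -
  interpret punctured_denominator D by fact
  have rat: "rat (iterated_partial hs f)" for hs
    by (induction hs) (auto simp: iterated_partial_def partial_derivative_eq_dirder intro: dirder_rat assms(2))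
  show ?thesis using assms(3)
  proof (induction k arbitrary: \<xi>)
    case 0
    then show ?case by (simp add: nabla_pow_def iterated_partial_def)
  next
    case (Suc k)
    have fin: "finite {hs :: 'n list. length hs = k}"
      using finite_lists_length_eq[of "UNIV :: 'n set" k] by simp
    have cons: "{hs :: 'n list. length hs = Suc k} = (\<lambda>(h, hs). h # hs) ` (UNIV \<times> {hs. length hs = k})"
      by (auto simp: length_Suc_conv image_iff)
    have v: "v = (\<Sum>h\<in>UNIV. v $ h *\<^sub>R axis h 1)"
      by (simp add: vec_eq_iff axis_def if_distrib cong: if_cong)
    have dv: "dirder v g \<xi> = (\<Sum>h\<in>UNIV. v $ h * partial_derivative h g \<xi>)" if "rat g" for g
    proof -
      have lin: "linear (\<lambda>a. dirder a g \<xi>)"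
        by (rule has_derivative_linear[OF rat_has_derivative[OF that Suc.prems]])
      have "dirder v g \<xi> = dirder (\<Sum>h\<in>UNIV. v $ h *\<^sub>R axis h 1) g \<xi>" using v by simp
      also have "\<dots> = (\<Sum>h\<in>UNIV. dirder (v $ h *\<^sub>R axis h 1) g \<xi>)"
        by (rule linear_sum[OF lin])
      also have "\<dots> = (\<Sum>h\<in>UNIV. v $ h * dirder (axis h 1) g \<xi>)"
        using linear_cmul[OF lin] by simp
      finally show ?thesis by (simp add: partial_derivative_eq_dirder)
    qed
    have "nabla_pow (Suc k) f \<xi> v = (\<Sum>(h, hs)\<in>UNIV \<times> {hs. length hs = k}.
        partial_derivative h (iterated_partial hs f) \<xi> * (v $ h * (\<Prod>h\<leftarrow>hs. v $ h)))"
      unfolding nabla_pow_def cons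
      by (subst sum.reindex) (auto simp: inj_on_def iterated_partial_def intro!: sum.cong)
    also have "\<dots> = (\<Sum>hs | length hs = k. \<Sum>h\<in>UNIV. partial_derivative h (iterated_partial hs f) \<xi> * (v $ h * (\<Prod>h\<leftarrow>hs. v $ h)))"
      by (subst sum.swap) (rule sum.cartesian_product[symmetric])
    also have "\<dots> = (\<Sum>hs | length hs = k. dirder v (iterated_partial hs f) \<xi> * (\<Prod>h\<leftarrow>hs. v $ h))"
      by (intro sum.cong refl) (simp add: dv[OF rat] sum_distrib_left sum_distrib_right ac_simps)
    also have "\<dots> = dirder v (\<lambda>\<xi>. nabla_pow k f \<xi> v) \<xi>"
      unfolding nabla_pow_def
      by (intro dirder_eqI[symmetric] DERIV_sum DERIV_cmult_right rat_line0[OF rat Suc.prems])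
    also have "\<dots> = dirder v ((dirder v ^^ k) f) \<xi>"
      by (rule dirder_cong_open[of "- {0}"]) (use Suc in auto)
    finally show ?case by simp
  qed
qed

section \<open>Differentiation under the integral sign\<close>

text \<open>Differentiability is asked only almost everywhere and only at 0, with a Lipschitz
  majorant in place of a bounded derivative: |s - t| has a kink at s = t.\<close>

lemma has_derivative_integral_dominated:
  fixes \<phi> :: "real \<Rightarrow> 'a \<Rightarrow> real"
  assumes \<delta>: "\<delta> > 0"
    and int: "\<And>\<tau>. \<bar>\<tau>\<bar> < \<delta> \<Longrightarrow> integrable M (\<phi> \<tau>)"
    and w: "integrable M w" and lip: "\<And>\<tau> x. \<bar>\<tau>\<bar> < \<delta> \<Longrightarrow> x \<in> space M \<Longrightarrow> \<bar>\<phi> \<tau> x - \<phi> 0 x\<bar> \<le> w x * \<bar>\<tau>\<bar>"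
    and deriv: "AE x in M. ((\<lambda>\<tau>. \<phi> \<tau> x) has_real_derivative d x) (at 0)"
    and d: "d \<in> borel_measurable M"
  shows "((\<lambda>\<tau>. \<integral>x. \<phi> \<tau> x \<partial>M) has_real_derivative (\<integral>x. d x \<partial>M)) (at 0)"
  unfolding has_field_derivative_iff tendsto_at_iff_sequentially comp_def
proof (intro allI impI)
  fix X :: "nat \<Rightarrow> real" assume X0: "\<forall>i. X i \<in> UNIV - {0}" and X: "X \<longlonglongrightarrow> 0"
  then have "eventually (\<lambda>i. \<bar>X i\<bar> < \<delta>) sequentially"
    using \<delta> by (auto simp: tendsto_iff dist_real_def)
  then obtain k where k: "\<And>i. i \<ge> k \<Longrightarrow> \<bar>X i\<bar> < \<delta>" by (auto simp: eventually_sequentially)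
  let ?Y = "\<lambda>i. X (i + k)"
  have Y: "\<bar>?Y i\<bar> < \<delta>" "?Y i \<noteq> 0" for i using k X0 by auto
  have Y0: "?Y \<longlonglongrightarrow> 0" using X by (rule LIMSEQ_ignore_initial_segment)
  have "(\<lambda>i. \<integral>x. (\<phi> (?Y i) x - \<phi> 0 x) / ?Y i \<partial>M) \<longlonglongrightarrow> (\<integral>x. d x \<partial>M)"
  proof (rule integral_dominated_convergence[where w=w])
    show "AE x in M. (\<lambda>i. (\<phi> (?Y i) x - \<phi> 0 x) / ?Y i) \<longlonglongrightarrow> d x"
      using deriv
    proof eventually_elim
      fix x assume "((\<lambda>\<tau>. \<phi> \<tau> x) has_real_derivative d x) (at 0)"
      then have "((\<lambda>h. (\<phi> h x - \<phi> 0 x) / h) \<longlongrightarrow> d x) (at 0)" by (simp add: has_field_derivative_iff)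
      then show "(\<lambda>i. (\<phi> (?Y i) x - \<phi> 0 x) / ?Y i) \<longlonglongrightarrow> d x"
        using Y0 Y(2) unfolding tendsto_at_iff_sequentially comp_def by auto
    qed
    show "AE x in M. norm ((\<phi> (?Y i) x - \<phi> 0 x) / ?Y i) \<le> w x" for i
      using lip[OF Y(1)] Y(2) by (auto simp: divide_le_eq intro!: AE_I2)
    show "(\<lambda>x. (\<phi> (?Y i) x - \<phi> 0 x) / ?Y i) \<in> borel_measurable M" for i
      using int[OF Y(1)[of i]] int[of 0] \<delta> by (intro borel_measurable_divide borel_measurable_diff) auto
  qed (use w d in auto)
  also have "(\<lambda>i. \<integral>x. (\<phi> (?Y i) x - \<phi> 0 x) / ?Y i \<partial>M) = (\<lambda>i. ((\<integral>x. \<phi> (?Y i) x \<partial>M) - (\<integral>x. \<phi> 0 x \<partial>M)) / ?Y i)"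
    using int[OF Y(1)] int[of 0] \<delta> by (simp add: Bochner_Integration.integral_diff)
  finally have "(\<lambda>i. ((\<integral>x. \<phi> (?Y i) x \<partial>M) - (\<integral>x. \<phi> 0 x \<partial>M)) / ?Y i) \<longlonglongrightarrow> (\<integral>x. d x \<partial>M)" .
  then have "(\<lambda>i. ((\<integral>x. \<phi> (X i) x \<partial>M) - (\<integral>x. \<phi> 0 x \<partial>M)) / X i) \<longlonglongrightarrow> (\<integral>x. d x \<partial>M)"
    by (rule LIMSEQ_offset)
  then show "(\<lambda>i. ((\<integral>x. \<phi> (X i) x \<partial>M) - (\<integral>x. \<phi> 0 x \<partial>M)) / (X i - 0)) \<longlonglongrightarrow> (\<integral>x. d x \<partial>M)" by simp
qed

lemma set_integrable_continuous_compact: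
  fixes f :: "'a::{metric_space, second_countable_topology} \<Rightarrow> real"
  assumes M: "sets M = sets borel" and E: "compact E" "emeasure M E < \<infinity>" and f: "continuous_on E f"
  shows "set_integrable M E f"
proof -
  have "compact (f ` E)" using f E(1) by (rule compact_continuous_image)
  then have "bounded (f ` E)" by (rule compact_imp_bounded)
  then obtain B where B: "\<forall>x\<in>E. \<bar>f x\<bar> \<le> B"
    by (auto simp: bounded_iff)
  have "(\<lambda>x. indicator E x *\<^sub>R f x) \<in> borel_measurable borel"
    using f E(1) by (intro borel_measurable_continuous_on_indicator) (auto simp: borel_compact)
  then have [measurable]: "(\<lambda>x. indicator E x *\<^sub>R f x) \<in> borel_measurable M"
    using measurable_cong_sets[OF M refl] by blast
  show ?thesis unfolding set_integrable_def
  proof (rule Bochner_Integration.integrable_bound[of M "\<lambda>x. indicator E x * B"])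
    show "integrable M (\<lambda>x. indicator E x * B)"
      using E M by (intro integrable_mult_left integrable_real_indicator) (auto simp: borel_compact)
    show "AE x in M. norm (indicator E x *\<^sub>R f x) \<le> norm (indicator E x * B)"
      using B by (intro AE_I2) (auto simp: indicator_def intro: order_trans[OF _ abs_ge_self])
  qed fact
qed

text \<open>Compactness bounds the derivative uniformly, and the mean value inequality turns that
  bound into the Lipschitz majorant.\<close>

lemma has_derivative_set_integral_compact:
  fixes \<phi> \<phi>' :: "real \<Rightarrow> 'a::{metric_space, second_countable_topology} \<Rightarrow> real"
  assumes M: "sets M = sets borel" and E: "compact E" "emeasure M E < \<infinity>" and \<delta>: "\<delta> > 0"
    and cont: "continuous_on ({-\<delta>..\<delta>} \<times> E) (\<lambda>(\<tau>, x). \<phi> \<tau> x)"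
    and cont': "continuous_on ({-\<delta>..\<delta>} \<times> E) (\<lambda>(\<tau>, x). \<phi>' \<tau> x)"
    and deriv: "\<And>\<tau> x. \<bar>\<tau>\<bar> \<le> \<delta> \<Longrightarrow> x \<in> E \<Longrightarrow> ((\<lambda>\<tau>. \<phi> \<tau> x) has_real_derivative \<phi>' \<tau> x) (at \<tau>)"
  shows "((\<lambda>\<tau>. LINT x:E|M. \<phi> \<tau> x) has_real_derivative (LINT x:E|M. \<phi>' 0 x)) (at 0)"
proof -
  have slice: "continuous_on E (f \<tau>)"
    if "continuous_on ({-\<delta>..\<delta>} \<times> E) (\<lambda>(\<tau>, x). f \<tau> x)" "\<bar>\<tau>\<bar> \<le> \<delta>" for f :: "real \<Rightarrow> 'a \<Rightarrow> real" and \<tau>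
  proof -
    have "continuous_on E ((\<lambda>(\<tau>, x). f \<tau> x) \<circ> (\<lambda>x. (\<tau>, x)))"
      using that by (intro continuous_on_compose continuous_on_subset[OF that(1)] continuous_intros) auto
    then show ?thesis by (simp add: comp_def)
  qed
  have int: "set_integrable M E (\<phi> \<tau>)" "set_integrable M E (\<phi>' \<tau>)" if "\<bar>\<tau>\<bar> \<le> \<delta>" for \<tau>
    by (intro set_integrable_continuous_compact M E slice cont cont' that)+
  have "compact ((\<lambda>(\<tau>, x). \<phi>' \<tau> x) ` ({-\<delta>..\<delta>} \<times> E))"
    by (intro compact_continuous_image cont' compact_Times E compact_Icc)
  then obtain B where B: "\<And>\<tau> x. \<bar>\<tau>\<bar> \<le> \<delta> \<Longrightarrow> x \<in> E \<Longrightarrow> \<bar>\<phi>' \<tau> x\<bar> \<le> B"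
    by (force dest!: compact_imp_bounded simp: bounded_iff abs_le_iff)
  show ?thesis unfolding set_lebesgue_integral_def
  proof (rule has_derivative_integral_dominated[OF \<delta>, where w="\<lambda>x. indicator E x * B"])
    show "integrable M (\<lambda>x. indicator E x *\<^sub>R \<phi> \<tau> x)" if "\<bar>\<tau>\<bar> < \<delta>" for \<tau>
      using int(1)[of \<tau>] that by (simp add: set_integrable_def)
    show "integrable M (\<lambda>x. indicator E x * B)"
      using E M by (intro integrable_mult_left integrable_real_indicator) (auto simp: borel_compact)
    show "(\<lambda>x. indicator E x *\<^sub>R \<phi>' 0 x) \<in> borel_measurable M"
      using int(2)[of 0] \<delta> by (auto simp: set_integrable_def)
    show "AE x in M. ((\<lambda>\<tau>. indicator E x *\<^sub>R \<phi> \<tau> x) has_real_derivative indicator E x *\<^sub>R \<phi>' 0 x) (at 0)"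
      using deriv[of 0] \<delta> by (intro AE_I2) (auto simp: indicator_def)
    show "\<bar>indicator E x *\<^sub>R \<phi> \<tau> x - indicator E x *\<^sub>R \<phi> 0 x\<bar> \<le> indicator E x * B * \<bar>\<tau>\<bar>" if "\<bar>\<tau>\<bar> < \<delta>" for \<tau> x
    proof (cases "x \<in> E")
      case True
      have "norm (\<phi> \<tau> x - \<phi> 0 x) \<le> B * norm (\<tau> - 0)"
      proof (rule field_differentiable_bound[of "{-\<delta>..\<delta>}" "\<lambda>\<tau>. \<phi> \<tau> x" "\<lambda>\<tau>. \<phi>' \<tau> x"])
        fix \<tau> assume "\<tau> \<in> {-\<delta>..\<delta>}"
        then show "((\<lambda>\<tau>. \<phi> \<tau> x) has_real_derivative \<phi>' \<tau> x) (at \<tau> within {-\<delta>..\<delta>})" "norm (\<phi>' \<tau> x) \<le> B"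
          using deriv[of \<tau> x] B[of \<tau> x] True by (auto intro: has_field_derivative_at_within)
      qed (use that in auto)
      then show ?thesis using True by simp
    qed simp
  qed
qed

section \<open>Integrals against |s - t| and sgn (t - s) on the real line\<close>

lemma integrable_inverse_1_plus_sq: "integrable lborel (\<lambda>s::real. 1 / (1 + s\<^sup>2))"
  using integrable_inverse_1_plus_square
  by (simp add: set_integrable_def einterval_def inverse_eq_divide)

text \<open>Continuity in the parameter is demanded only for almost every \<open>s\<close>, since
  sgn (t - s) jumps at s = t.\<close>

lemma continuous_on_integral_dominated:
  fixes f :: "'p::metric_space \<Rightarrow> 'a \<Rightarrow> real"
  assumes meas: "\<And>p. p \<in> S \<Longrightarrow> f p \<in> borel_measurable M" and w: "integrable M w"
    and bd: "\<And>p s. p \<in> S \<Longrightarrow> \<bar>f p s\<bar> \<le> w s"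
    and cont: "\<And>p. p \<in> S \<Longrightarrow> AE s in M. continuous (at p within S) (\<lambda>p. f p s)"
  shows "continuous_on S (\<lambda>p. \<integral>s. f p s \<partial>M)"
  unfolding continuous_on_sequentially
proof (intro allI ballI impI, unfold comp_def)
  fix x a assume a: "a \<in> S" and x: "(\<forall>n. x n \<in> S) \<and> x \<longlonglongrightarrow> a"
  show "(\<lambda>n. \<integral>s. f (x n) s \<partial>M) \<longlonglongrightarrow> (\<integral>s. f a s \<partial>M)"
  proof (rule integral_dominated_convergence[where w=w])
    show "AE s in M. (\<lambda>n. f (x n) s) \<longlonglongrightarrow> f a s"
      using cont[OF a]
      by eventually_elim (use x in \<open>auto simp: continuous_within_sequentially comp_def\<close>)
  qed (use meas a x w bd in \<open>auto\<close>)
qed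

text \<open>On the cylinder, |\<eta> + s e|^4 = (1 + s^2)^2. Multiplying by |s - t| costs one order
  of decay and still leaves an integrable bound of order 1 / (1 + s^2).\<close>

definition quartic_decay :: "(real \<Rightarrow> real) \<Rightarrow> real \<Rightarrow> bool" where
  "quartic_decay g C \<longleftrightarrow> (\<forall>s. \<bar>g s\<bar> \<le> C / (1 + s\<^sup>2)\<^sup>2)"

lemma quartic_decay_bounds:
  assumes "quartic_decay g C"
  shows "\<bar>\<bar>s - t\<bar> * g s\<bar> \<le> (1 + \<bar>t\<bar>) * C * (1 / (1 + s\<^sup>2))" "\<bar>g s\<bar> \<le> C * (1 / (1 + s\<^sup>2))"
proof -
  have p: "1 + s\<^sup>2 > 0" by (simp add: add_pos_nonneg)
  have C: "C \<ge> 0" using assms[unfolded quartic_decay_def, rule_format, of 0] by simp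
  have g: "\<bar>g s\<bar> \<le> C / (1 + s\<^sup>2)\<^sup>2" using assms by (simp add: quartic_decay_def)
  have "C / (1 + s\<^sup>2)\<^sup>2 \<le> C / (1 + s\<^sup>2)"
    using C p by (intro divide_left_mono self_le_power mult_pos_pos) auto
  then show "\<bar>g s\<bar> \<le> C * (1 / (1 + s\<^sup>2))" using g by simp
  have "\<bar>s\<bar> \<le> 1 + s\<^sup>2"
    using power2_sum[of "\<bar>s\<bar> - 1" 0] zero_le_power2[of "\<bar>s\<bar> - 1"] by (simp add: power2_eq_square algebra_simps abs_if split: if_splits)
  then have "\<bar>s - t\<bar> \<le> (1 + \<bar>t\<bar>) * (1 + s\<^sup>2)"
    using abs_triangle_ineq4[of s t] mult_nonneg_nonneg[of "\<bar>t\<bar>" "s\<^sup>2"] by (simp add: algebra_simps del: mult_nonneg_nonneg)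
  then have "\<bar>s - t\<bar> * \<bar>g s\<bar> \<le> ((1 + \<bar>t\<bar>) * (1 + s\<^sup>2)) * (C / (1 + s\<^sup>2)\<^sup>2)"
    using g by (intro mult_mono) (auto intro: mult_nonneg_nonneg)
  also have "\<dots> = (1 + \<bar>t\<bar>) * C * (1 / (1 + s\<^sup>2))" using p by (simp add: power2_eq_square)
  finally show "\<bar>\<bar>s - t\<bar> * g s\<bar> \<le> (1 + \<bar>t\<bar>) * C * (1 / (1 + s\<^sup>2))" by (simp add: abs_mult)
qed

context
  fixes g :: "real \<Rightarrow> real" and C :: real
  assumes g: "continuous_on UNIV g" and dec: "quartic_decay g C"
begin

lemma quartic_decay_measurable [measurable]: "g \<in> borel_measurable borel"
  using g by (rule borel_measurable_continuous_onI)

lemma quartic_decay_integrable: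
  "integrable lborel (\<lambda>s. \<bar>s - t\<bar> * g s)" "integrable lborel g" "integrable lborel (\<lambda>s. sgn (t - s) * g s)"
proof -
  note [measurable] = quartic_decay_measurable
  show "integrable lborel (\<lambda>s. \<bar>s - t\<bar> * g s)"
  proof (rule Bochner_Integration.integrable_bound[OF integrable_mult_right[OF integrable_inverse_1_plus_sq, of "(1 + \<bar>t\<bar>) * C"]])
    show "AE s in lborel. norm (\<bar>s - t\<bar> * g s) \<le> norm ((1 + \<bar>t\<bar>) * C * (1 / (1 + s\<^sup>2)))"
      using order_trans[OF quartic_decay_bounds(1)[OF dec] abs_ge_self] by (intro AE_I2) (simp only: real_norm_def)
  qed auto
  show i: "integrable lborel g"
  proof (rule Bochner_Integration.integrable_bound[OF integrable_mult_right[OF integrable_inverse_1_plus_sq, of C]])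
    show "AE s in lborel. norm (g s) \<le> norm (C * (1 / (1 + s\<^sup>2)))"
      using order_trans[OF quartic_decay_bounds(2)[OF dec] abs_ge_self] by (intro AE_I2) (simp only: real_norm_def)
  qed auto
  show "integrable lborel (\<lambda>s. sgn (t - s) * g s)"
    by (rule Bochner_Integration.integrable_bound[OF i]) (auto intro!: AE_I2 simp: abs_mult sgn_if)
qed

text \<open>The kink occupies a single point s = t, and the absolute value is 1-Lipschitz, so |g|
  dominates the difference quotients.\<close>

lemma deriv_integral_abs:
  "((\<lambda>t. \<integral>s. \<bar>s - t\<bar> * g s \<partial>lborel) has_real_derivative (\<integral>s. sgn (t - s) * g s \<partial>lborel)) (at t)"
proof -
  note [measurable] = quartic_decay_measurable
  have "((\<lambda>\<tau>. \<integral>s. \<bar>s - (t + \<tau>)\<bar> * g s \<partial>lborel) has_real_derivative (\<integral>s. sgn (t - s) * g s \<partial>lborel)) (at 0)"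
  proof (rule has_derivative_integral_dominated[of 1 _ _ "\<lambda>s. \<bar>g s\<bar>"])
    show "\<bar>\<bar>s - (t + \<tau>)\<bar> * g s - \<bar>s - (t + 0)\<bar> * g s\<bar> \<le> \<bar>g s\<bar> * \<bar>\<tau>\<bar>" for \<tau> s
    proof -
      have "\<bar>\<bar>s - (t + \<tau>)\<bar> * g s - \<bar>s - (t + 0)\<bar> * g s\<bar> = \<bar>\<bar>s - (t + \<tau>)\<bar> - \<bar>s - (t + 0)\<bar>\<bar> * \<bar>g s\<bar>"
        by (simp only: abs_mult[symmetric] left_diff_distrib)
      also have "\<dots> \<le> \<bar>\<tau>\<bar> * \<bar>g s\<bar>" by (intro mult_right_mono) auto
      finally show ?thesis by (simp add: mult.commute)
    qed
    show "AE s in lborel. ((\<lambda>\<tau>. \<bar>s - (t + \<tau>)\<bar> * g s) has_real_derivative sgn (t - s) * g s) (at 0)"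
      using AE_lborel_singleton[of t]
    proof eventually_elim
      fix s assume "s \<noteq> t"
      then have "((\<lambda>\<tau>. \<bar>s - (t + \<tau>)\<bar>) has_real_derivative sgn (s - t) * (- 1)) (at 0)"
      proof -
        have "((\<lambda>\<tau>. sgn (s - t) * (s - (t + \<tau>))) has_real_derivative sgn (s - t) * (- 1)) (at 0)"
          by (auto intro!: derivative_eq_intros)
        then show ?thesis
          by (rule has_field_derivative_transform_within_open[of _ _ _ "ball 0 \<bar>s - t\<bar>"])
            (use \<open>s \<noteq> t\<close> in \<open>auto simp: sgn_if abs_if split: if_splits\<close>)
      qed
      moreover have "sgn (s - t) * (- 1) = sgn (t - s)" by (simp add: sgn_if)
      ultimately show "((\<lambda>\<tau>. \<bar>s - (t + \<tau>)\<bar> * g s) has_real_derivative sgn (t - s) * g s) (at 0)"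
        using DERIV_cmult_right[of "\<lambda>\<tau>. \<bar>s - (t + \<tau>)\<bar>" "sgn (s - t) * (- 1)" 0 UNIV "g s"] by simp
    qed
  qed (auto simp: quartic_decay_integrable)
  then show ?thesis using DERIV_at_within_shift[of "\<lambda>t. \<integral>s. \<bar>s - t\<bar> * g s \<partial>lborel" _ t 0 UNIV] by simp
qed

text \<open>This replaces the identity that the second derivative of the absolute value is twice the
  delta: moving the jump from a to r changes the integral by twice the integral of \<open>g\<close>
  over the interval between them.\<close>

lemma deriv_integral_sgn:
  "((\<lambda>t. \<integral>s. sgn (t - s) * g s \<partial>lborel) has_real_derivative 2 * g t) (at t)"
proof -
  note [measurable] = quartic_decay_measurable
  \<comment> \<open>Any base point left of \<open>t\<close> would do; it only has to make
    \<open>t\<close> interior to the interval.\<close>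
  define a where "a = t - 1"
  let ?S = "\<lambda>t. \<integral>s. sgn (t - s) * g s \<partial>lborel"
  have eq: "?S r = ?S a + 2 * integral {a..r} g" if "r \<ge> a" for r
  proof -
    have si: "set_integrable lborel {a..r} g"
      using quartic_decay_integrable(2) unfolding set_integrable_def by (intro integrable_mult_indicator) auto
    have "?S r - ?S a = (\<integral>s. sgn (r - s) * g s - sgn (a - s) * g s \<partial>lborel)"
      by (simp add: quartic_decay_integrable)
    also have "\<dots> = (\<integral>s. 2 * (indicator {a..r} s *\<^sub>R g s) \<partial>lborel)"
    proof (rule integral_cong_AE)
      show "AE s in lborel. sgn (r - s) * g s - sgn (a - s) * g s = 2 * (indicator {a..r} s *\<^sub>R g s)"
        using AE_lborel_singleton[of a] AE_lborel_singleton[of r]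
        by eventually_elim (use that in \<open>auto simp: indicator_def sgn_if\<close>)
    qed auto
    also have "\<dots> = 2 * integral {a..r} g"
      using set_borel_integral_eq_integral(2)[OF si] by (simp add: set_lebesgue_integral_def)
    finally show ?thesis by simp
  qed
  have "((\<lambda>r. integral {a..r} g) has_real_derivative g t) (at t within {a..t+1})"
    by (rule integral_has_real_derivative) (auto simp: a_def intro: continuous_on_subset[OF g])
  then have "((\<lambda>r. integral {a..r} g) has_real_derivative g t) (at t)"
    by (subst (asm) at_within_interior) (auto simp: a_def)
  then have "((\<lambda>r. ?S a + 2 * integral {a..r} g) has_real_derivative 2 * g t) (at t)"
    by (auto intro!: derivative_eq_intros)
  then show ?thesis
  proof (rule has_field_derivative_transform_within_open[of _ _ _ "{a<..}"])
    show "?S a + 2 * integral {a..r} g = ?S r" if "r \<in> {a<..}" for r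
      using eq[of r] that by (simp only: greaterThan_iff less_imp_le)
  qed (auto simp: a_def)
qed

end

section \<open>Derivatives of integrals over the equator\<close>

text \<open>\<open>M\<close> will be the Hausdorff measure of dimension n - 2, and \<open>E\<close>
  its carrier of finite measure; the direction \<open>e\<close> stays fixed while the point z
  varies.\<close>

locale equator = punctured_denominator D for D :: "'a::euclidean_space \<Rightarrow> real" +
  fixes e x :: 'a and M :: "'a measure" and E :: "'a set"
  assumes e: "norm e = 1" and sets_M: "sets M = sets borel"
    and E_def: "E = {\<xi>. norm \<xi> = 1 \<and> e \<bullet> \<xi> = 0}" and E_fin: "emeasure M E < \<infinity>"
begin

text \<open>\<^term>\<open>crossing z \<eta>\<close> is the parameter \<open>s\<close> at which the line \<open>\<eta> + s e\<close> meets the hyperplane orthogonal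
  to \<open>x - z\<close>. Formally \<open>K k q z\<close> is \<open>(- 1) ^ k\<close> times the integral of \<open>\<delta>\<^sup>(\<^sup>k\<^sup>) ((x - z) \<bullet> \<xi>) * q \<xi>\<close> over the
  cylinder \<open>\<xi> = \<eta> + s e\<close>, and \<open>K_deriv\<close> below is the chain rule for \<open>\<delta>\<^sup>(\<^sup>k\<^sup>)\<close>.\<close>
definition height :: "'a \<Rightarrow> real" where "height z = (x - z) \<bullet> e"
definition crossing :: "'a \<Rightarrow> 'a \<Rightarrow> real" where "crossing z \<eta> = - ((x - z) \<bullet> \<eta>) / height z"
definition W :: "'a set" where "W = {z. height z > 0}"
definition K :: "nat \<Rightarrow> ('a \<Rightarrow> real) \<Rightarrow> 'a \<Rightarrow> real" where
  "K k q z = (LINT \<eta>:E|M. (dirder e ^^ k) q (\<eta> + crossing z \<eta> *\<^sub>R e) / height z ^ (k + 1))"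

lemma compact_E: "compact E"
proof -
  have "E = sphere 0 1 \<inter> {\<xi>. e \<bullet> \<xi> = 0}" by (auto simp: E_def)
  then show ?thesis by (simp add: compact_Int_closed closed_hyperplane)
qed

lemma norm_line: "\<eta> \<in> E \<Longrightarrow> (norm (\<eta> + s *\<^sub>R e))\<^sup>2 = 1 + s\<^sup>2"
  using e norm_add_Pythagorean[of \<eta> "s *\<^sub>R e"] by (simp add: E_def orthogonal_def inner_commute)

lemma line_nz: "\<eta> \<in> E \<Longrightarrow> \<eta> + s *\<^sub>R e \<noteq> 0"
  using norm_line[of \<eta> s] zero_le_power2[of s] by (metis add_pos_nonneg less_irrefl norm_zero power_zero_numeral zero_less_one)

lemma open_W: "open W"
  unfolding W_def height_def by (intro open_Collect_less continuous_intros)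

lemma height_line: "height (z + \<tau> *\<^sub>R a) = height z - \<tau> * (a \<bullet> e)"
  by (simp add: height_def inner_diff_left inner_add_left)

lemma height_pos_near:
  assumes "z \<in> W"
  obtains \<delta> where "\<delta> > 0" "\<And>\<tau>. \<bar>\<tau>\<bar> \<le> \<delta> \<Longrightarrow> height (z + \<tau> *\<^sub>R a) > 0"
proof
  have z: "height z > 0" using assms by (simp add: W_def)
  \<comment> \<open>The height then drops by at most half of its value; the added 1 covers
    directions orthogonal to \<open>e\<close>.\<close>
  let ?\<delta> = "height z / (2 * (\<bar>a \<bullet> e\<bar> + 1))"
  show "?\<delta> > 0" using z by simp
  fix \<tau> assume "\<bar>\<tau>\<bar> \<le> ?\<delta>"
  then have "\<bar>\<tau>\<bar> * (\<bar>a \<bullet> e\<bar> + 1) \<le> height z / 2" by (simp add: field_simps)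
  moreover have "\<tau> * (a \<bullet> e) \<le> \<bar>\<tau>\<bar> * (\<bar>a \<bullet> e\<bar> + 1)"
    using abs_ge_self[of "\<tau> * (a \<bullet> e)"] by (simp add: abs_mult algebra_simps)
  ultimately show "height (z + \<tau> *\<^sub>R a) > 0" using z unfolding height_line by linarith
qed

lemma continuous_crossing:
  assumes "\<And>\<tau>. \<tau> \<in> T \<Longrightarrow> height (z + \<tau> *\<^sub>R a) > 0"
  shows "continuous_on (T \<times> E) (\<lambda>p. crossing (z + fst p *\<^sub>R a) (snd p))"
    "continuous_on (T \<times> E) (\<lambda>p. height (z + fst p *\<^sub>R a))"
proof -
  show h: "continuous_on (T \<times> E) (\<lambda>p. height (z + fst p *\<^sub>R a))"
    unfolding height_def by (intro continuous_intros)
  have "height (z + fst p *\<^sub>R a) \<noteq> 0" if "p \<in> T \<times> E" for p using assms[of "fst p"] that by auto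
  then show "continuous_on (T \<times> E) (\<lambda>p. crossing (z + fst p *\<^sub>R a) (snd p))"
    unfolding crossing_def by (intro continuous_intros h) auto
qed

lemma continuous_rat_crossing:
  assumes q: "rat q" and pos: "\<And>\<tau>. \<tau> \<in> T \<Longrightarrow> height (z + \<tau> *\<^sub>R a) > 0"
  shows "continuous_on (T \<times> E) (\<lambda>(\<tau>, \<eta>). q (\<eta> + crossing (z + \<tau> *\<^sub>R a) \<eta> *\<^sub>R e) / height (z + \<tau> *\<^sub>R a) ^ k)"
proof -
  note c = continuous_crossing[of T z a, OF pos]
  have nz: "height (z + fst p *\<^sub>R a) \<noteq> 0" if "p \<in> T \<times> E" for p using pos[of "fst p"] that by auto
  have "continuous_on (T \<times> E) (\<lambda>p. q (snd p + crossing (z + fst p *\<^sub>R a) (snd p) *\<^sub>R e))"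
    by (rule continuous_on_compose2[OF rat_continuous[OF q]]) (use line_nz in \<open>auto intro!: continuous_intros c\<close>)
  then show ?thesis unfolding split_def
    using nz by (intro continuous_on_divide continuous_on_power c) auto
qed

lemma integrable_rat_crossing:
  assumes q: "rat q" and z: "z \<in> W"
  shows "set_integrable M E (\<lambda>\<eta>. q (\<eta> + crossing z \<eta> *\<^sub>R e) / height z ^ k)"
proof (rule set_integrable_continuous_compact[OF sets_M compact_E E_fin])
  have c: "continuous_on ({0} \<times> E) (\<lambda>(\<tau>, \<eta>). q (\<eta> + crossing (z + \<tau> *\<^sub>R 0) \<eta> *\<^sub>R e) / height (z + \<tau> *\<^sub>R 0) ^ k)"
    using z by (intro continuous_rat_crossing q) (auto simp: W_def)
  have "continuous_on E (\<lambda>\<eta>. (0::real, \<eta>))" by (intro continuous_intros)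
  from continuous_on_compose2[OF c this]
  show "continuous_on E (\<lambda>\<eta>. q (\<eta> + crossing z \<eta> *\<^sub>R e) / height z ^ k)" by auto
qed

lemma height_deriv: "((\<lambda>\<tau>. height (z + \<tau> *\<^sub>R a)) has_real_derivative - (a \<bullet> e)) (at \<tau>)"
  unfolding height_line by (auto intro!: derivative_eq_intros)

lemma crossing_deriv:
  assumes "height (z + \<tau> *\<^sub>R a) > 0"
  shows "((\<lambda>\<tau>. crossing (z + \<tau> *\<^sub>R a) \<eta>) has_real_derivative
    (a \<bullet> \<eta> + crossing (z + \<tau> *\<^sub>R a) \<eta> * (a \<bullet> e)) / height (z + \<tau> *\<^sub>R a)) (at \<tau>)"
proof -
  have "((\<lambda>\<tau>. - ((x - (z + \<tau> *\<^sub>R a)) \<bullet> \<eta>)) has_real_derivative (a \<bullet> \<eta>)) (at \<tau>)"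
    unfolding inner_diff_left inner_add_left inner_scaleR_left by (auto intro!: derivative_eq_intros)
  moreover have nz: "height (z + \<tau> *\<^sub>R a) \<noteq> 0" using assms by simp
  ultimately show ?thesis unfolding crossing_def
    by (rule DERIV_cong[OF DERIV_divide[OF _ height_deriv]]) (use nz in \<open>simp add: field_simps\<close>)
qed

lemma K_deriv:
  assumes q: "rat q" and z: "z \<in> W"
  shows "((\<lambda>\<tau>. K k q (z + \<tau> *\<^sub>R a)) has_real_derivative K (Suc k) (\<lambda>\<xi>. (a \<bullet> \<xi>) * q \<xi>) z) (at 0)"
proof -
  let ?q = "(dirder e ^^ k) q" and ?q' = "(dirder e ^^ Suc k) (\<lambda>\<xi>. (a \<bullet> \<xi>) * q \<xi>)"
  note poly = real_polynomial_function_inner[of a]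
  obtain \<delta> where \<delta>: "\<delta> > 0" "\<And>\<tau>. \<bar>\<tau>\<bar> \<le> \<delta> \<Longrightarrow> height (z + \<tau> *\<^sub>R a) > 0"
    using height_pos_near[OF z] by blast
  have pos: "height (z + \<tau> *\<^sub>R a) > 0" if "\<tau> \<in> {-\<delta>..\<delta>}" for \<tau> using \<delta>(2) that by auto
  have "((\<lambda>\<tau>. LINT \<eta>:E|M. ?q (\<eta> + crossing (z + \<tau> *\<^sub>R a) \<eta> *\<^sub>R e) / height (z + \<tau> *\<^sub>R a) ^ (k + 1)) has_real_derivative
    (LINT \<eta>:E|M. ?q' (\<eta> + crossing (z + 0 *\<^sub>R a) \<eta> *\<^sub>R e) / height (z + 0 *\<^sub>R a) ^ (Suc k + 1))) (at 0)"
  proof (rule has_derivative_set_integral_compact[OF sets_M compact_E E_fin \<delta>(1)])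
    show "continuous_on ({-\<delta>..\<delta>} \<times> E) (\<lambda>(\<tau>, \<eta>). ?q (\<eta> + crossing (z + \<tau> *\<^sub>R a) \<eta> *\<^sub>R e) / height (z + \<tau> *\<^sub>R a) ^ (k + 1))"
      by (intro continuous_rat_crossing dirder_pow_rat q pos)
    show "continuous_on ({-\<delta>..\<delta>} \<times> E) (\<lambda>(\<tau>, \<eta>). ?q' (\<eta> + crossing (z + \<tau> *\<^sub>R a) \<eta> *\<^sub>R e) / height (z + \<tau> *\<^sub>R a) ^ (Suc k + 1))"
      by (intro continuous_rat_crossing dirder_pow_rat rat_mult_poly poly q pos)
    fix \<tau> \<eta> assume \<tau>: "\<bar>\<tau>\<bar> \<le> \<delta>" and \<eta>: "\<eta> \<in> E"
    define h where "h = height (z + \<tau> *\<^sub>R a)"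
    define t where "t = crossing (z + \<tau> *\<^sub>R a) \<eta>"
    have h: "h > 0" using \<delta>(2)[OF \<tau>] by (simp add: h_def)
    have tD: "((\<lambda>\<tau>. crossing (z + \<tau> *\<^sub>R a) \<eta>) has_real_derivative (a \<bullet> \<eta> + t * (a \<bullet> e)) / h) (at \<tau>)"
      using crossing_deriv[OF \<delta>(2)[OF \<tau>]] by (simp add: h_def t_def)
    have qD: "((\<lambda>t. ?q (\<eta> + t *\<^sub>R e)) has_real_derivative dirder e ?q (\<eta> + t *\<^sub>R e)) (at t)"
      by (rule rat_line_derivative[OF dirder_pow_rat[OF q] line_nz[OF \<eta>]])
    have numD: "((\<lambda>\<tau>. ?q (\<eta> + crossing (z + \<tau> *\<^sub>R a) \<eta> *\<^sub>R e)) has_real_derivative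
        dirder e ?q (\<eta> + t *\<^sub>R e) * ((a \<bullet> \<eta> + t * (a \<bullet> e)) / h)) (at \<tau>)"
      using DERIV_chain2[OF qD[unfolded t_def] tD] by (simp add: t_def)
    have denD: "((\<lambda>\<tau>. height (z + \<tau> *\<^sub>R a) ^ (k + 1)) has_real_derivative
        real (k + 1) * h ^ k * (- (a \<bullet> e))) (at \<tau>)"
      by (rule DERIV_cong[OF DERIV_power[OF height_deriv[of z a \<tau>], of "k + 1"]]) (simp add: h_def)
    have "((\<lambda>\<tau>. ?q (\<eta> + crossing (z + \<tau> *\<^sub>R a) \<eta> *\<^sub>R e) / height (z + \<tau> *\<^sub>R a) ^ (k + 1)) has_real_derivative
      (dirder e ?q (\<eta> + t *\<^sub>R e) * ((a \<bullet> \<eta> + t * (a \<bullet> e)) / h) * h ^ (k + 1)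
        - ?q (\<eta> + t *\<^sub>R e) * (real (k + 1) * h ^ k * (- (a \<bullet> e)))) / (h ^ (k + 1) * h ^ (k + 1))) (at \<tau>)"
      using DERIV_divide[OF numD denD] h by (simp add: h_def t_def)
    \<comment> \<open>The first term comes from the moving crossing point, the second from the
      changing height. Together they are the two Leibniz terms, since \<open>a\<close> has inner
      product \<open>a \<bullet> \<eta> + t * (a \<bullet> e)\<close> with the crossing
      point.\<close>
    moreover have "(dirder e ?q (\<eta> + t *\<^sub>R e) * ((a \<bullet> \<eta> + t * (a \<bullet> e)) / h) * h ^ (k + 1)
        - ?q (\<eta> + t *\<^sub>R e) * (real (k + 1) * h ^ k * (- (a \<bullet> e)))) / (h ^ (k + 1) * h ^ (k + 1))
      = ?q' (\<eta> + t *\<^sub>R e) / h ^ (Suc k + 1)"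
    proof -
      have "?q' (\<eta> + t *\<^sub>R e) = (a \<bullet> \<eta> + t * (a \<bullet> e)) * dirder e ?q (\<eta> + t *\<^sub>R e)
          + real (Suc k) * (a \<bullet> e) * ?q (\<eta> + t *\<^sub>R e)"
        using dirder_pow_inner_mult[OF q line_nz[OF \<eta>, of t], where e=e and k=k and a=a] by (simp add: inner_add_right)
      moreover have "(A * (B / h) * h ^ (k + 1) - C * (N * h ^ k * (- \<beta>))) / (h ^ (k + 1) * h ^ (k + 1))
          = (B * A + N * \<beta> * C) / h ^ (Suc k + 1)" for A B C N \<beta> :: real
        using h by (simp add: field_simps)
      ultimately show ?thesis by simp
    qed
    ultimately show "((\<lambda>\<tau>. ?q (\<eta> + crossing (z + \<tau> *\<^sub>R a) \<eta> *\<^sub>R e) / height (z + \<tau> *\<^sub>R a) ^ (k + 1)) has_real_derivative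
      ?q' (\<eta> + crossing (z + \<tau> *\<^sub>R a) \<eta> *\<^sub>R e) / height (z + \<tau> *\<^sub>R a) ^ (Suc k + 1)) (at \<tau>)"
      by (simp only: h_def t_def)
  qed
  then show ?thesis unfolding K_def by simp
qed

lemma K_sum:
  assumes I: "finite I" and q: "\<And>i. i \<in> I \<Longrightarrow> rat (q i)" and z: "z \<in> W"
  shows "K k (\<lambda>\<xi>. \<Sum>i\<in>I. c i * q i \<xi>) z = (\<Sum>i\<in>I. c i * K k (q i) z)"
proof -
  have int: "set_integrable M E (\<lambda>\<eta>. (dirder e ^^ k) (q i) (\<eta> + crossing z \<eta> *\<^sub>R e) / height z ^ (k + 1))" if "i \<in> I" for i
    by (intro integrable_rat_crossing dirder_pow_rat q z that)
  define h where "h i \<eta> = indicator E \<eta> *\<^sub>R ((dirder e ^^ k) (q i) (\<eta> + crossing z \<eta> *\<^sub>R e) / height z ^ (k + 1))" for i \<eta>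
  have h: "integrable M (h i)" if "i \<in> I" for i
    using int[OF that] by (simp only: h_def[abs_def] set_integrable_def)
  have "K k (\<lambda>\<xi>. \<Sum>i\<in>I. c i * q i \<xi>) z = (\<integral>\<eta>. (\<Sum>i\<in>I. c i * h i \<eta>) \<partial>M)"
    unfolding K_def set_lebesgue_integral_def h_def
    by (intro Bochner_Integration.integral_cong refl)
      (auto simp: indicator_def dirder_pow_sum[OF I q line_nz] sum_divide_distrib)
  also have "\<dots> = (\<Sum>i\<in>I. c i * (\<integral>\<eta>. h i \<eta> \<partial>M))"
    using h by (simp add: Bochner_Integration.integral_sum)
  finally show ?thesis unfolding K_def set_lebesgue_integral_def h_def .
qed

lemma K_cmult:
  assumes "rat q" "z \<in> W"
  shows "K k (\<lambda>\<xi>. c * q \<xi>) z = c * K k q z"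
  using K_sum[of "{()}" "\<lambda>_. q" z k "\<lambda>_. c"] assms by simp

lemma K_cong: "(\<And>\<xi>. \<xi> \<noteq> 0 \<Longrightarrow> q \<xi> = r \<xi>) \<Longrightarrow> K k q z = K k r z"
  unfolding K_def set_lebesgue_integral_def
  by (intro Bochner_Integration.integral_cong refl) (auto simp: indicator_def intro!: dirder_pow_cong line_nz)

end

text \<open>\<open>g\<close> will be 1 / (Q |\<xi>|^(2j+2)). Its decay is required only outside the
  open unit ball, where the whole cylinder lies.\<close>

locale equator_kernel = equator D e x M E for D e x M E +
  fixes g :: "'a \<Rightarrow> real" and C :: real
  assumes g: "rat g" and g_decay: "\<And>\<xi>. norm \<xi> \<ge> 1 \<Longrightarrow> \<bar>g \<xi>\<bar> \<le> C / norm \<xi> ^ 4"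
begin

text \<open>\<open>F\<close> is the integral of \<open>\<bar>(x - z) \<bullet> \<xi>\<bar> * g \<xi>\<close> over the cylinder, with \<open>height z\<close> pulled out of the
  absolute value.\<close>
definition A :: "'a \<Rightarrow> real \<Rightarrow> real" where "A \<eta> t = (\<integral>s. \<bar>s - t\<bar> * g (\<eta> + s *\<^sub>R e) \<partial>lborel)"
definition A' :: "'a \<Rightarrow> real \<Rightarrow> real" where "A' \<eta> t = (\<integral>s. sgn (t - s) * g (\<eta> + s *\<^sub>R e) \<partial>lborel)"
definition F :: "'a \<Rightarrow> real" where "F z = (LINT \<eta>:E|M. height z * A \<eta> (crossing z \<eta>))"
definition F' :: "'a \<Rightarrow> 'a \<Rightarrow> real" where
  "F' a z = (LINT \<eta>:E|M. (a \<bullet> \<eta> + crossing z \<eta> * (a \<bullet> e)) * A' \<eta> (crossing z \<eta>) - (a \<bullet> e) * A \<eta> (crossing z \<eta>))"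

lemma g_line_cont: "\<eta> \<in> E \<Longrightarrow> continuous_on UNIV (\<lambda>s. g (\<eta> + s *\<^sub>R e))"
  by (rule continuous_on_compose2[OF rat_continuous[OF g]]) (use line_nz in \<open>auto intro!: continuous_intros\<close>)

lemma g_line_decay: "\<eta> \<in> E \<Longrightarrow> quartic_decay (\<lambda>s. g (\<eta> + s *\<^sub>R e)) C"
proof -
  assume \<eta>: "\<eta> \<in> E"
  have "norm (\<eta> + s *\<^sub>R e) ^ 4 = (1 + s\<^sup>2)\<^sup>2" for s
    using norm_line[OF \<eta>, of s] by (simp flip: power_mult add: norm_line[OF \<eta>, symmetric])
  moreover have "norm (\<eta> + s *\<^sub>R e) \<ge> 1" for s
    using norm_line[OF \<eta>, of s] by (intro power2_le_imp_le[of 1]) auto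
  ultimately show ?thesis using g_decay unfolding quartic_decay_def by metis
qed

lemma A_deriv: "\<eta> \<in> E \<Longrightarrow> (A \<eta> has_real_derivative A' \<eta> t) (at t)"
  using deriv_integral_abs[OF g_line_cont g_line_decay] unfolding A_def[abs_def] A'_def .

lemma A'_deriv: "\<eta> \<in> E \<Longrightarrow> (A' \<eta> has_real_derivative 2 * g (\<eta> + t *\<^sub>R e)) (at t)"
  using deriv_integral_sgn[OF g_line_cont g_line_decay] unfolding A'_def[abs_def] .

text \<open>The crossing parameter is bounded on the compact set \<open>T \<times> E\<close>, which
  supplies one integrable majorant for all parameters; the jump of sgn affects a single
  \<open>s\<close> for each of them.\<close>

lemma continuous_A_crossing:
  assumes T: "compact T" and pos: "\<And>\<tau>. \<tau> \<in> T \<Longrightarrow> height (z + \<tau> *\<^sub>R a) > 0"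
  shows "continuous_on (T \<times> E) (\<lambda>p. A (snd p) (crossing (z + fst p *\<^sub>R a) (snd p)))"
    and "continuous_on (T \<times> E) (\<lambda>p. A' (snd p) (crossing (z + fst p *\<^sub>R a) (snd p)))"
proof -
  note c = continuous_crossing[of T z a, OF pos]
  let ?r = "\<lambda>p. crossing (z + fst p *\<^sub>R a) (snd p)"
  have "bounded (?r ` (T \<times> E))"
    by (intro compact_imp_bounded compact_continuous_image c compact_Times T compact_E)
  then obtain B where B: "\<And>p. p \<in> T \<times> E \<Longrightarrow> \<bar>?r p\<bar> \<le> B" by (auto simp: bounded_iff) blast
  have gm: "(\<lambda>s. g (\<eta> + s *\<^sub>R e)) \<in> borel_measurable lborel" if "\<eta> \<in> E" for \<eta>
    using borel_measurable_continuous_onI[OF g_line_cont[OF that]] by simp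
  have gc: "continuous_on (T \<times> E) (\<lambda>p. g (snd p + s *\<^sub>R e))" for s
    by (rule continuous_on_compose2[OF rat_continuous[OF g]]) (use line_nz in \<open>auto intro!: continuous_intros\<close>)
  show "continuous_on (T \<times> E) (\<lambda>p. A (snd p) (?r p))"
    unfolding A_def
  proof (rule continuous_on_integral_dominated)
    show "(\<lambda>s. \<bar>s - ?r p\<bar> * g (snd p + s *\<^sub>R e)) \<in> borel_measurable lborel" if "p \<in> T \<times> E" for p
      using that by (intro borel_measurable_times gm) auto
    show "integrable lborel (\<lambda>s::real. (1 + B) * C * (1 / (1 + s\<^sup>2)))"
      by (intro integrable_mult_right integrable_inverse_1_plus_sq)
    show "\<bar>\<bar>s - ?r p\<bar> * g (snd p + s *\<^sub>R e)\<bar> \<le> (1 + B) * C * (1 / (1 + s\<^sup>2))" if p: "p \<in> T \<times> E" for p s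
    proof -
      have dec: "quartic_decay (\<lambda>s. g (snd p + s *\<^sub>R e)) C" using g_line_decay p by auto
      have "C \<ge> 0" using dec[unfolded quartic_decay_def, rule_format, of 0] by simp
      have "\<bar>\<bar>s - ?r p\<bar> * g (snd p + s *\<^sub>R e)\<bar> \<le> (1 + \<bar>?r p\<bar>) * C * (1 / (1 + s\<^sup>2))"
        by (rule quartic_decay_bounds(1)[OF dec])
      also have "\<dots> \<le> (1 + B) * C * (1 / (1 + s\<^sup>2))"
        using B[OF p] \<open>C \<ge> 0\<close> by (intro mult_right_mono) (auto simp: add_nonneg_nonneg)
      finally show ?thesis .
    qed
    have "continuous_on (T \<times> E) (\<lambda>p. \<bar>s - ?r p\<bar> * g (snd p + s *\<^sub>R e))" for s
      by (intro continuous_intros c gc)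
    then show "AE s in lborel. continuous (at p within T \<times> E) (\<lambda>p. \<bar>s - ?r p\<bar> * g (snd p + s *\<^sub>R e))"
      if "p \<in> T \<times> E" for p
      using that by (intro AE_I2) (simp only: continuous_on_eq_continuous_within)
  qed
  show "continuous_on (T \<times> E) (\<lambda>p. A' (snd p) (?r p))"
    unfolding A'_def
  proof (rule continuous_on_integral_dominated)
    show "(\<lambda>s. sgn (?r p - s) * g (snd p + s *\<^sub>R e)) \<in> borel_measurable lborel" if "p \<in> T \<times> E" for p
      using that by (intro borel_measurable_times gm) auto
    show "integrable lborel (\<lambda>s::real. C * (1 / (1 + s\<^sup>2)))"
      by (intro integrable_mult_right integrable_inverse_1_plus_sq)
    show "\<bar>sgn (?r p - s) * g (snd p + s *\<^sub>R e)\<bar> \<le> C * (1 / (1 + s\<^sup>2))" if p: "p \<in> T \<times> E" for p s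
    proof -
      have "quartic_decay (\<lambda>s. g (snd p + s *\<^sub>R e)) C" using g_line_decay p by auto
      from quartic_decay_bounds(2)[OF this, of s] have "\<bar>g (snd p + s *\<^sub>R e)\<bar> \<le> C * (1 / (1 + s\<^sup>2))" .
      moreover have "\<bar>sgn (?r p - s) * g (snd p + s *\<^sub>R e)\<bar> \<le> \<bar>g (snd p + s *\<^sub>R e)\<bar>"
        by (auto simp: sgn_if)
      ultimately show ?thesis by linarith
    qed
    fix p assume p: "p \<in> T \<times> E"
    show "AE s in lborel. continuous (at p within T \<times> E) (\<lambda>p. sgn (?r p - s) * g (snd p + s *\<^sub>R e))"
      using AE_lborel_singleton[of "?r p"]
    proof eventually_elim
      fix s assume "s \<noteq> ?r p"
      have "(?r \<longlongrightarrow> ?r p) (at p within T \<times> E)" "((\<lambda>p. g (snd p + s *\<^sub>R e)) \<longlongrightarrow> g (snd p + s *\<^sub>R e)) (at p within T \<times> E)"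
        using c(1) gc[of s] p by (auto simp: continuous_on_def)
      then show "continuous (at p within T \<times> E) (\<lambda>p. sgn (?r p - s) * g (snd p + s *\<^sub>R e))"
        unfolding continuous_within using \<open>s \<noteq> ?r p\<close> by (intro tendsto_intros) auto
    qed
  qed
qed

text \<open>The height in front of \<open>A\<close> cancels the denominator in
  \<open>crossing_deriv\<close>, so the product rule leaves no quotient.\<close>

lemma F_deriv:
  assumes z: "z \<in> W"
  shows "((\<lambda>\<tau>. F (z + \<tau> *\<^sub>R a)) has_real_derivative F' a z) (at 0)"
proof -
  obtain \<delta> where \<delta>: "\<delta> > 0" "\<And>\<tau>. \<bar>\<tau>\<bar> \<le> \<delta> \<Longrightarrow> height (z + \<tau> *\<^sub>R a) > 0"
    using height_pos_near[OF z] by blast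
  have pos: "height (z + \<tau> *\<^sub>R a) > 0" if "\<tau> \<in> {-\<delta>..\<delta>}" for \<tau> using \<delta>(2) that by auto
  note c = continuous_crossing[of "{-\<delta>..\<delta>}" z a, OF pos] continuous_A_crossing[of "{-\<delta>..\<delta>}" z a, OF compact_Icc pos]
  let ?r = "\<lambda>\<tau> \<eta>. crossing (z + \<tau> *\<^sub>R a) \<eta>"
  have "((\<lambda>\<tau>. LINT \<eta>:E|M. height (z + \<tau> *\<^sub>R a) * A \<eta> (?r \<tau> \<eta>)) has_real_derivative
    (LINT \<eta>:E|M. (a \<bullet> \<eta> + ?r 0 \<eta> * (a \<bullet> e)) * A' \<eta> (?r 0 \<eta>) - (a \<bullet> e) * A \<eta> (?r 0 \<eta>))) (at 0)"
  proof (rule has_derivative_set_integral_compact[OF sets_M compact_E E_fin \<delta>(1)])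
    show "continuous_on ({-\<delta>..\<delta>} \<times> E) (\<lambda>(\<tau>, \<eta>). height (z + \<tau> *\<^sub>R a) * A \<eta> (?r \<tau> \<eta>))"
      unfolding split_def by (intro continuous_intros c)
    show "continuous_on ({-\<delta>..\<delta>} \<times> E) (\<lambda>(\<tau>, \<eta>). (a \<bullet> \<eta> + ?r \<tau> \<eta> * (a \<bullet> e)) * A' \<eta> (?r \<tau> \<eta>) - (a \<bullet> e) * A \<eta> (?r \<tau> \<eta>))"
      unfolding split_def by (intro continuous_intros c)
    fix \<tau> \<eta> assume \<tau>: "\<bar>\<tau>\<bar> \<le> \<delta>" and \<eta>: "\<eta> \<in> E"
    have "((\<lambda>\<tau>. A \<eta> (?r \<tau> \<eta>)) has_real_derivative A' \<eta> (?r \<tau> \<eta>) * ((a \<bullet> \<eta> + ?r \<tau> \<eta> * (a \<bullet> e)) / height (z + \<tau> *\<^sub>R a))) (at \<tau>)"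
      by (rule DERIV_chain2[OF A_deriv[OF \<eta>] crossing_deriv[OF \<delta>(2)[OF \<tau>]]])
    from DERIV_mult[OF height_deriv[of z a \<tau>] this] \<delta>(2)[OF \<tau>]
    show "((\<lambda>\<tau>. height (z + \<tau> *\<^sub>R a) * A \<eta> (?r \<tau> \<eta>)) has_real_derivative
        (a \<bullet> \<eta> + ?r \<tau> \<eta> * (a \<bullet> e)) * A' \<eta> (?r \<tau> \<eta>) - (a \<bullet> e) * A \<eta> (?r \<tau> \<eta>)) (at \<tau>)"
      by (elim DERIV_cong) (auto simp: field_simps)
  qed
  then show ?thesis unfolding F_def F'_def by simp
qed

text \<open>Both contributions containing \<open>A'\<close> cancel. Only the derivative of
  \<open>A'\<close> itself remains, which evaluates \<open>g\<close> at the crossing point with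
  weight \<sigma>^2 / height, where \<sigma> is the inner product of \<open>a\<close> with that
  point.\<close>

lemma F'_deriv:
  assumes z: "z \<in> W"
  shows "((\<lambda>\<tau>. F' a (z + \<tau> *\<^sub>R a)) has_real_derivative 2 * K 0 (\<lambda>\<xi>. (a \<bullet> \<xi>) * ((a \<bullet> \<xi>) * g \<xi>)) z) (at 0)"
proof -
  obtain \<delta> where \<delta>: "\<delta> > 0" "\<And>\<tau>. \<bar>\<tau>\<bar> \<le> \<delta> \<Longrightarrow> height (z + \<tau> *\<^sub>R a) > 0"
    using height_pos_near[OF z] by blast
  have pos: "height (z + \<tau> *\<^sub>R a) > 0" if "\<tau> \<in> {-\<delta>..\<delta>}" for \<tau> using \<delta>(2) that by auto
  note c = continuous_crossing[of "{-\<delta>..\<delta>}" z a, OF pos] continuous_A_crossing[of "{-\<delta>..\<delta>}" z a, OF compact_Icc pos]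
  let ?r = "\<lambda>\<tau> \<eta>. crossing (z + \<tau> *\<^sub>R a) \<eta>"
  let ?q = "\<lambda>\<xi>. (a \<bullet> \<xi>) * ((a \<bullet> \<xi>) * g \<xi>)"
  note poly = real_polynomial_function_inner[of a]
  have rq: "rat ?q" by (intro rat_mult_poly poly g)
  have "((\<lambda>\<tau>. LINT \<eta>:E|M. (a \<bullet> \<eta> + ?r \<tau> \<eta> * (a \<bullet> e)) * A' \<eta> (?r \<tau> \<eta>) - (a \<bullet> e) * A \<eta> (?r \<tau> \<eta>)) has_real_derivative
    (LINT \<eta>:E|M. 2 * (?q (\<eta> + ?r 0 \<eta> *\<^sub>R e) / height (z + 0 *\<^sub>R a) ^ 1))) (at 0)"
  proof (rule has_derivative_set_integral_compact[OF sets_M compact_E E_fin \<delta>(1)])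
    show "continuous_on ({-\<delta>..\<delta>} \<times> E) (\<lambda>(\<tau>, \<eta>). (a \<bullet> \<eta> + ?r \<tau> \<eta> * (a \<bullet> e)) * A' \<eta> (?r \<tau> \<eta>) - (a \<bullet> e) * A \<eta> (?r \<tau> \<eta>))"
      unfolding split_def by (intro continuous_intros c)
    show "continuous_on ({-\<delta>..\<delta>} \<times> E) (\<lambda>(\<tau>, \<eta>). 2 * (?q (\<eta> + ?r \<tau> \<eta> *\<^sub>R e) / height (z + \<tau> *\<^sub>R a) ^ 1))"
      using continuous_rat_crossing[OF rq pos, where k=1] unfolding split_def by (intro continuous_on_mult_left)
    fix \<tau> \<eta> assume \<tau>: "\<bar>\<tau>\<bar> \<le> \<delta>" and \<eta>: "\<eta> \<in> E"
    define h where "h = height (z + \<tau> *\<^sub>R a)"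
    define t where "t = ?r \<tau> \<eta>"
    have h: "h > 0" using \<delta>(2)[OF \<tau>] by (simp add: h_def)
    define \<sigma> where "\<sigma> = a \<bullet> \<eta> + t * (a \<bullet> e)"
    have rD: "((\<lambda>\<tau>. ?r \<tau> \<eta>) has_real_derivative \<sigma> / h) (at \<tau>)"
      using crossing_deriv[OF \<delta>(2)[OF \<tau>]] by (simp add: h_def t_def \<sigma>_def)
    have AD: "((\<lambda>\<tau>. A \<eta> (?r \<tau> \<eta>)) has_real_derivative A' \<eta> t * (\<sigma> / h)) (at \<tau>)"
      using DERIV_chain2[OF A_deriv[OF \<eta>] rD] by (simp add: t_def)
    have AD': "((\<lambda>\<tau>. A' \<eta> (?r \<tau> \<eta>)) has_real_derivative 2 * g (\<eta> + t *\<^sub>R e) * (\<sigma> / h)) (at \<tau>)"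
      using DERIV_chain2[OF A'_deriv[OF \<eta>] rD] by (simp add: t_def)
    have "((\<lambda>\<tau>. (a \<bullet> \<eta> + ?r \<tau> \<eta> * (a \<bullet> e)) * A' \<eta> (?r \<tau> \<eta>) - (a \<bullet> e) * A \<eta> (?r \<tau> \<eta>)) has_real_derivative
       (\<sigma> / h * (a \<bullet> e)) * A' \<eta> t + 2 * g (\<eta> + t *\<^sub>R e) * (\<sigma> / h) * \<sigma> - (a \<bullet> e) * (A' \<eta> t * (\<sigma> / h))) (at \<tau>)"
      by (rule DERIV_cong[OF DERIV_diff[OF DERIV_mult[OF DERIV_add[OF DERIV_const DERIV_cmult_right[OF rD]] AD'] DERIV_cmult[OF AD]]])
        (simp add: t_def \<sigma>_def)
    moreover have "(\<sigma> / h * (a \<bullet> e)) * A' \<eta> t + 2 * g (\<eta> + t *\<^sub>R e) * (\<sigma> / h) * \<sigma> - (a \<bullet> e) * (A' \<eta> t * (\<sigma> / h))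
        = 2 * (?q (\<eta> + t *\<^sub>R e) / h ^ 1)"
      using h by (simp add: \<sigma>_def inner_add_right field_simps)
    ultimately show "((\<lambda>\<tau>. (a \<bullet> \<eta> + ?r \<tau> \<eta> * (a \<bullet> e)) * A' \<eta> (?r \<tau> \<eta>) - (a \<bullet> e) * A \<eta> (?r \<tau> \<eta>)) has_real_derivative
      2 * (?q (\<eta> + ?r \<tau> \<eta> *\<^sub>R e) / height (z + \<tau> *\<^sub>R a) ^ 1)) (at \<tau>)"
      by (simp only: t_def h_def)
  qed
  then show ?thesis unfolding F'_def K_def by simp
qed

end

section \<open>Laplacians of the cylinder integrals\<close>

lemma partial_derivative_eqI_open:
  assumes "open U" "z \<in> U" "\<And>y. y \<in> U \<Longrightarrow> f y = h y"
    and "((\<lambda>\<tau>. h (z + \<tau> *\<^sub>R axis i 1)) has_real_derivative d) (at 0)"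
  shows "partial_derivative i f z = d"
proof -
  have "dirder (axis i 1) f z = dirder (axis i 1) h z"
    by (rule dirder_cong_open[OF assms(1,2)]) (rule assms(3))
  then show ?thesis by (simp add: partial_derivative_eq_dirder dirder_eqI[OF assms(4)])
qed

text \<open>Each second partial derivative inserts the square of a coordinate of \<xi> by
  \<open>K_deriv\<close>, and the squares sum to \<open>\<xi> \<bullet> \<xi>\<close>. Agreement on
  the open set \<open>W\<close> is enough because partial derivatives are local.\<close>

lemma laplacian_K:
  fixes D :: "real^'n::finite \<Rightarrow> real" and x z :: "real^'n"
  assumes "equator D e M E"
    and q: "punctured_denominator.rat D q"
    and f: "\<And>z. z \<in> equator.W e x \<Longrightarrow> f z = equator.K e x M E k q z" and z: "z \<in> equator.W e x"
  shows "laplacian f z = equator.K e x M E (k + 2) (\<lambda>\<xi>. (\<xi> \<bullet> \<xi>) * q \<xi>) z"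
proof -
  interpret equator D e x M E by fact
  have rat: "rat (\<lambda>\<xi>. (axis i 1 \<bullet> \<xi>) * q \<xi>)" "rat (\<lambda>\<xi>. (axis i 1 \<bullet> \<xi>) * ((axis i 1 \<bullet> \<xi>) * q \<xi>))" for i
    by (intro rat_mult_poly real_polynomial_function_inner q)+
  have 1: "partial_derivative i f z = K (Suc k) (\<lambda>\<xi>. (axis i 1 \<bullet> \<xi>) * q \<xi>) z" if "z \<in> W" for i z
    by (rule partial_derivative_eqI_open[OF open_W that f K_deriv[OF q that]])
  have 2: "partial_derivative i (partial_derivative i f) z = K (k + 2) (\<lambda>\<xi>. (axis i 1 \<bullet> \<xi>) * ((axis i 1 \<bullet> \<xi>) * q \<xi>)) z" for i
    using partial_derivative_eqI_open[OF open_W z 1 K_deriv[OF rat(1) z]] by simp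
  have "laplacian f z = (\<Sum>i\<in>UNIV. 1 * K (k + 2) (\<lambda>\<xi>. (axis i 1 \<bullet> \<xi>) * ((axis i 1 \<bullet> \<xi>) * q \<xi>)) z)"
    unfolding laplacian_def by (simp add: 2)
  also have "\<dots> = K (k + 2) (\<lambda>\<xi>. \<Sum>i\<in>UNIV. 1 * ((axis i 1 \<bullet> \<xi>) * ((axis i 1 \<bullet> \<xi>) * q \<xi>))) z"
    using z by (intro K_sum[symmetric] rat(2)) auto
  also have "(\<lambda>\<xi>. \<Sum>i\<in>UNIV. 1 * ((axis i 1 \<bullet> \<xi>) * ((axis i 1 \<bullet> \<xi>) * q \<xi>))) = (\<lambda>\<xi>. (\<xi> \<bullet> \<xi>) * q \<xi>)"
    by (simp add: inner_vec_def[of "\<xi>" "\<xi>" for \<xi>] inner_axis' sum_distrib_right mult.assoc)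
  finally show ?thesis .
qed

lemma laplacian_F:
  fixes D :: "real^'n::finite \<Rightarrow> real" and x z :: "real^'n"
  assumes "equator_kernel D e M E g C"
    and f: "\<And>z. z \<in> equator.W e x \<Longrightarrow> f z = equator_kernel.F e x M E g z" and z: "z \<in> equator.W e x"
  shows "laplacian f z = 2 * equator.K e x M E 0 (\<lambda>\<xi>. (\<xi> \<bullet> \<xi>) * g \<xi>) z"
proof -
  interpret equator_kernel D e x M E g C by fact
  have rat: "rat (\<lambda>\<xi>. (axis i 1 \<bullet> \<xi>) * ((axis i 1 \<bullet> \<xi>) * g \<xi>))" for i
    by (intro rat_mult_poly real_polynomial_function_inner g)
  have 1: "partial_derivative i f z = F' (axis i 1) z" if "z \<in> W" for i z
    by (rule partial_derivative_eqI_open[OF open_W that f F_deriv[OF that]])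
  have 2: "partial_derivative i (partial_derivative i f) z = 2 * K 0 (\<lambda>\<xi>. (axis i 1 \<bullet> \<xi>) * ((axis i 1 \<bullet> \<xi>) * g \<xi>)) z" for i
    by (rule partial_derivative_eqI_open[OF open_W z 1 F'_deriv[OF z]])
  have "laplacian f z = (\<Sum>i\<in>UNIV. 2 * K 0 (\<lambda>\<xi>. (axis i 1 \<bullet> \<xi>) * ((axis i 1 \<bullet> \<xi>) * g \<xi>)) z)"
    unfolding laplacian_def by (simp add: 2)
  also have "\<dots> = 2 * (\<Sum>i\<in>UNIV. 1 * K 0 (\<lambda>\<xi>. (axis i 1 \<bullet> \<xi>) * ((axis i 1 \<bullet> \<xi>) * g \<xi>)) z)"
    by (simp add: sum_distrib_left)
  also have "\<dots> = 2 * K 0 (\<lambda>\<xi>. \<Sum>i\<in>UNIV. 1 * ((axis i 1 \<bullet> \<xi>) * ((axis i 1 \<bullet> \<xi>) * g \<xi>))) z"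
    using z by (intro arg_cong[where f="(*) 2"] K_sum[symmetric] rat) auto
  also have "(\<lambda>\<xi>. \<Sum>i\<in>UNIV. 1 * ((axis i 1 \<bullet> \<xi>) * ((axis i 1 \<bullet> \<xi>) * g \<xi>))) = (\<lambda>\<xi>. (\<xi> \<bullet> \<xi>) * g \<xi>)"
    by (simp add: inner_vec_def[of "\<xi>" "\<xi>" for \<xi>] inner_axis' sum_distrib_right mult.assoc)
  finally show ?thesis .
qed

text \<open>The first Laplacian turns the integral \<open>F\<close> into order 0 and brings the
  factor 2; every later one raises the order by two. Hence the order is 2 i after i + 1
  Laplacians.\<close>

lemma iterated_laplacian_F:
  fixes D :: "real^'n::finite \<Rightarrow> real" and x z :: "real^'n"
  assumes ek: "equator_kernel D e M E g C"
    and f: "\<And>z. z \<in> equator.W e x \<Longrightarrow> f z = equator_kernel.F e x M E g z" and z: "z \<in> equator.W e x"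
  shows "((\<lambda>f z. - laplacian f z) ^^ Suc i) f z
    = equator.K e x M E (2 * i) (\<lambda>\<xi>. ((-1) ^ Suc i * 2) * ((\<xi> \<bullet> \<xi>) ^ Suc i * g \<xi>)) z"
  using z
proof (induction i arbitrary: z)
  interpret equator_kernel D e x M E g C by fact
  note polyp = real_polynomial_function_power[OF real_polynomial_function_inner_self]
  have rat: "rat (\<lambda>\<xi>. (\<xi> \<bullet> \<xi>) ^ k * g \<xi>)" for k by (intro rat_mult_poly polyp g)
  {
    case 0
    then show ?case using laplacian_F[OF ek f 0] K_cmult[OF rat[of 1] 0, of 0 "-2"] by simp
  next
    case (Suc i)
    let ?q = "\<lambda>\<xi>. ((-1) ^ Suc i * 2) * ((\<xi> \<bullet> \<xi>) ^ Suc i * g \<xi>)"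
    have rq: "rat ?q"
      by (rule rat_mult_poly[OF real_polynomial_function.intros(2) rat])
    have rq': "rat (\<lambda>\<xi>. (\<xi> \<bullet> \<xi>) * ?q \<xi>)" using rat_mult_poly[OF polyp[of 1] rq] by simp
    have "laplacian (((\<lambda>f z. - laplacian f z) ^^ Suc i) f) z = K (2 * i + 2) (\<lambda>\<xi>. (\<xi> \<bullet> \<xi>) * ?q \<xi>) z"
      using laplacian_K[OF equator_axioms rq] Suc by simp
    then have "((\<lambda>f z. - laplacian f z) ^^ Suc (Suc i)) f z = - K (2 * i + 2) (\<lambda>\<xi>. (\<xi> \<bullet> \<xi>) * ?q \<xi>) z"
      by simp
    also have "\<dots> = K (2 * i + 2) (\<lambda>\<xi>. - 1 * ((\<xi> \<bullet> \<xi>) * ?q \<xi>)) z"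
      using Suc.prems by (subst K_cmult[OF rq']) auto
    also have "(\<lambda>\<xi>. - 1 * ((\<xi> \<bullet> \<xi>) * ?q \<xi>)) = (\<lambda>\<xi>. ((-1) ^ Suc (Suc i) * 2) * ((\<xi> \<bullet> \<xi>) ^ Suc (Suc i) * g \<xi>))"
      by (simp add: fun_eq_iff ac_simps)
    finally show ?case by simp
  }
qed

text \<open>Bridge to the change of surface, which is stated for nonnegative integrals, whereas
  \<open>F\<close> is a Bochner integral suited to differentiation.\<close>

lemma (in equator_kernel) F_eq_nn_integral:
  assumes z: "z \<in> W" and g0: "\<And>\<xi>. \<xi> \<noteq> 0 \<Longrightarrow> g \<xi> \<ge> 0"
  shows "F z = enn2real (\<integral>\<^sup>+\<eta>. (\<integral>\<^sup>+s. ennreal (\<bar>(x - z) \<bullet> (\<eta> + s *\<^sub>R e)\<bar> * g (\<eta> + s *\<^sub>R e)) \<partial>lborel) * indicator E \<eta> \<partial>M)"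
proof -
  have h: "height z > 0" using z by (simp add: W_def)
  have A0: "A \<eta> t \<ge> 0" if "\<eta> \<in> E" for \<eta> t
    unfolding A_def using g0[OF line_nz[OF that]] by (intro Bochner_Integration.integral_nonneg) auto
  have inner: "(\<integral>\<^sup>+s. ennreal (\<bar>(x - z) \<bullet> (\<eta> + s *\<^sub>R e)\<bar> * g (\<eta> + s *\<^sub>R e)) \<partial>lborel) = ennreal (height z * A \<eta> (crossing z \<eta>))"
    if \<eta>: "\<eta> \<in> E" for \<eta>
  proof -
    have "\<bar>(x - z) \<bullet> (\<eta> + s *\<^sub>R e)\<bar> = height z * \<bar>s - crossing z \<eta>\<bar>" for s
    proof -
      have "(x - z) \<bullet> (\<eta> + s *\<^sub>R e) = height z * (s - crossing z \<eta>)"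
        using h by (simp add: crossing_def inner_add_right height_def[symmetric] field_simps)
      then show ?thesis using h by (simp add: abs_mult)
    qed
    then have "(\<integral>\<^sup>+s. ennreal (\<bar>(x - z) \<bullet> (\<eta> + s *\<^sub>R e)\<bar> * g (\<eta> + s *\<^sub>R e)) \<partial>lborel)
        = (\<integral>\<^sup>+s. ennreal (height z * (\<bar>s - crossing z \<eta>\<bar> * g (\<eta> + s *\<^sub>R e))) \<partial>lborel)"
      by (simp add: mult.assoc)
    also have "\<dots> = ennreal (\<integral>s. height z * (\<bar>s - crossing z \<eta>\<bar> * g (\<eta> + s *\<^sub>R e)) \<partial>lborel)"
      using h g0[OF line_nz[OF \<eta>]] quartic_decay_integrable(1)[OF g_line_cont[OF \<eta>] g_line_decay[OF \<eta>]]
      by (intro nn_integral_eq_integral) auto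
    finally show ?thesis by (simp add: A_def)
  qed
  have c: "continuous_on ({0} \<times> E) (\<lambda>p. A (snd p) (crossing (z + fst p *\<^sub>R 0) (snd p)))"
    using h by (intro continuous_A_crossing) auto
  have "continuous_on E (\<lambda>\<eta>. (0::real, \<eta>))" by (intro continuous_intros)
  from continuous_on_compose2[OF c this]
  have "continuous_on E (\<lambda>\<eta>. A \<eta> (crossing z \<eta>))" by auto
  then have "set_integrable M E (\<lambda>\<eta>. height z * A \<eta> (crossing z \<eta>))"
    by (intro set_integrable_continuous_compact[OF sets_M compact_E E_fin] continuous_intros)
  then have meas: "(\<lambda>\<eta>. indicator E \<eta> *\<^sub>R (height z * A \<eta> (crossing z \<eta>))) \<in> borel_measurable M"
    by (simp only: set_integrable_def borel_measurable_integrable)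
  have "F z = enn2real (\<integral>\<^sup>+\<eta>. ennreal (indicator E \<eta> *\<^sub>R (height z * A \<eta> (crossing z \<eta>))) \<partial>M)"
    unfolding F_def set_lebesgue_integral_def
    using h A0 by (intro integral_eq_nn_integral meas AE_I2) (auto simp: indicator_def)
  also have "(\<lambda>\<eta>. ennreal (indicator E \<eta> *\<^sub>R (height z * A \<eta> (crossing z \<eta>))))
      = (\<lambda>\<eta>. (\<integral>\<^sup>+s. ennreal (\<bar>(x - z) \<bullet> (\<eta> + s *\<^sub>R e)\<bar> * g (\<eta> + s *\<^sub>R e)) \<partial>lborel) * indicator E \<eta>)"
    by (auto simp: indicator_def inner)
  finally show ?thesis .
qed

section \<open>Homogeneous symbols and the formula for the fundamental solution\<close>

lemma homogeneous_form_properties: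
  fixes Q :: "real^'n::finite \<Rightarrow> real"
  assumes "\<And>\<xi>. Q \<xi> = (\<Sum>is | length is = d. A is * (\<Prod>i\<leftarrow>is. \<xi> $ i))"
  shows "real_polynomial_function Q" and "Q (c *\<^sub>R \<xi>) = c ^ d * Q \<xi>"
proof -
  have prod: "real_polynomial_function (\<lambda>\<xi>::real^'n. \<Prod>i\<leftarrow>is. \<xi> $ i)" for "is"
    by (induction "is") (auto intro!: real_polynomial_function.intros(2,4)
        real_polynomial_function.intros(1)[OF bounded_linear_vec_nth])
  have "finite {is :: 'n list. length is = d}"
    using finite_lists_length_eq[of "UNIV :: 'n set" d] by simp
  then show "real_polynomial_function Q"
    unfolding assms[abs_def]
    by (intro real_polynomial_function_sum real_polynomial_function.intros(4) real_polynomial_function.intros(2) prod)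
  have scale: "(\<Prod>i\<leftarrow>is. (c *\<^sub>R \<xi>) $ i) = c ^ length is * (\<Prod>i\<leftarrow>is. \<xi> $ i)" for "is" :: "'n list"
    by (induction "is") auto
  show "Q (c *\<^sub>R \<xi>) = c ^ d * Q \<xi>"
    unfolding assms scale by (auto simp: sum_distrib_left ac_simps intro!: sum.cong)
qed

theorem theorem1p2:
  fixes m :: nat
    and L :: "(real^'n::finite \<Rightarrow> real) \<Rightarrow> real^'n \<Rightarrow> real"
    and Q :: "real^'n \<Rightarrow> real"
    and x y :: "real^'n"
  assumes "m \<ge> 1"
    and "odd CARD('n)"
    and "CARD('n) \<ge> 2 * m + 1"
    and "has_symbol m L Q"
    and "uniformly_elliptic m Q"
    and "x \<noteq> y"
  shows "john_fundamental_solution m Q x y =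
    (-1) ^ ((CARD('n) - 2 * m - 1) div 2)
      / (2 ^ CARD('n) * pi ^ (CARD('n) - 1) * norm (x - y) ^ (CARD('n) - 2 * m))
      * (LINT \<xi>:{\<xi>. norm \<xi> = 1 \<and> (x - y) \<bullet> \<xi> = 0}|hausdorff_measure (CARD('n) - 2).
           nabla_pow (CARD('n) - 2 * m - 1) (\<lambda>\<xi>. 1 / Q \<xi>) \<xi> ((x - y) /\<^sub>R norm (x - y)))"
proof -
  define j where "j = (CARD('n) - 2 * m - 1) div 2"
  \<comment> \<open>Oddness of n makes n - 2m - 1 even, so the division in \<open>j_def\<close>
    loses nothing.\<close>
  have n: "CARD('n) = 2 * m + 2 * j + 1" using assms(2,3) unfolding j_def by presburger
  have n3: "CARD('n) \<ge> 3" using n assms(1) by simp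
  obtain A where Q: "\<And>\<xi>. Q \<xi> = (\<Sum>is | length is = 2 * m. A is * (\<Prod>i\<leftarrow>is. \<xi> $ i))"
    using assms(4) unfolding has_symbol_def by blast
  note Qpoly = homogeneous_form_properties(1)[OF Q] and Qhom = homogeneous_form_properties(2)[OF Q]
  obtain l where l: "l > 0" "\<And>\<xi>. Q \<xi> \<ge> l * norm \<xi> ^ (2 * m)" using assms(5) unfolding uniformly_elliptic_def by blast
  have Qpos: "Q \<xi> > 0" if "\<xi> \<noteq> 0" for \<xi>
    using l(2)[of \<xi>] l(1) that by (meson less_le_trans mult_pos_pos zero_less_norm_iff zero_less_power)
  \<comment> \<open>With this extra factor a single denominator serves both 1 / Q, as
    \<open>(\<xi> \<bullet> \<xi>) / D \<xi>\<close>, and \<open>g\<close>, as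
    \<open>Q \<xi> ^ j / D \<xi> ^ Suc j\<close>.\<close>
  define D where "D \<xi> = Q \<xi> * (\<xi> \<bullet> \<xi>)" for \<xi>
  define g where "g \<xi> = 1 / (Q \<xi> * (\<xi> \<bullet> \<xi>) ^ Suc j)" for \<xi>
  define r where "r = norm (x - y)"
  define e where "e = (x - y) /\<^sub>R r"
  define E where "E = {\<xi>. norm \<xi> = 1 \<and> e \<bullet> \<xi> = 0}"
  let ?M = "hausdorff_measure (CARD('n) - 2) :: (real^'n) measure"
  have r: "r > 0" using assms(6) by (simp add: r_def)
  have e: "norm e = 1" using r by (simp add: e_def r_def)
  interpret punctured_denominator D
  proof
    show "real_polynomial_function D" unfolding D_def by (intro real_polynomial_function.intros(4) Qpoly real_polynomial_function_inner_self)
    show "D \<xi> \<noteq> 0" if "\<xi> \<noteq> 0" for \<xi> using Qpos[OF that] that by (simp add: D_def)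
  qed
  have rg: "rat g"
  proof (rule ratI)
    show "real_polynomial_function (\<lambda>\<xi>. Q \<xi> ^ j)" by (intro real_polynomial_function_power Qpoly)
    show "g \<xi> = Q \<xi> ^ j / D \<xi> ^ Suc j" if "\<xi> \<noteq> 0" for \<xi>
      using Qpos[OF that] that by (simp add: g_def D_def power_mult_distrib field_simps)
  qed
  have rQ: "rat (\<lambda>\<xi>. 1 / Q \<xi>)"
    using real_polynomial_function_inner_self by (rule ratI[where p=1]) (simp add: D_def)
  have E_fin: "emeasure ?M E < \<infinity>" unfolding E_def by (rule hausdorff_sphere_cylinder(1)[OF n3 e])
  interpret equator D e x ?M E
    by unfold_locales (use e E_fin in \<open>auto simp: E_def\<close>)
  interpret equator_kernel D e x ?M E g "1 / l"
  proof
    show "rat g" by (rule rg)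
    show "\<bar>g \<xi>\<bar> \<le> 1 / l / norm \<xi> ^ 4" if \<xi>: "norm \<xi> \<ge> 1" for \<xi>
    proof -
      have nz: "\<xi> \<noteq> 0" using \<xi> by auto
      \<comment> \<open>The exponent is at least 4 because m >= 1, and the norm is at least
        1.\<close>
      have "l * norm \<xi> ^ 4 \<le> l * norm \<xi> ^ (2 * m + 2 * Suc j)"
        using \<xi> l(1) assms(1) by (intro mult_left_mono power_increasing) auto
      also have "\<dots> = l * norm \<xi> ^ (2 * m) * (\<xi> \<bullet> \<xi>) ^ Suc j"
        by (simp add: power_add power_mult dot_square_norm power2_eq_square)
      also have "\<dots> \<le> Q \<xi> * (\<xi> \<bullet> \<xi>) ^ Suc j" using l(2) by (intro mult_right_mono) auto
      finally have "1 / (Q \<xi> * (\<xi> \<bullet> \<xi>) ^ Suc j) \<le> 1 / (l * norm \<xi> ^ 4)"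
        using l(1) nz by (intro divide_left_mono) (auto intro!: mult_pos_pos Qpos)
      then show ?thesis using Qpos[OF nz] by (simp add: g_def)
    qed
  qed
  define G where "G z = (LINT \<xi>:{\<xi>. norm \<xi> = 1}|hausdorff_measure (CARD('n) - 1). \<bar>(x - z) \<bullet> \<xi>\<bar> / Q \<xi>)" for z
  have contQ: "continuous_on UNIV Q" by (intro differentiable_imp_continuous_on differentiable_on_real_polynomial_function Qpoly)
  then have [measurable]: "Q \<in> borel_measurable borel" by (rule borel_measurable_continuous_onI)
  have [measurable]: "g \<in> borel_measurable borel" unfolding g_def by measurable
  \<comment> \<open>The identity is needed on all of \<open>W\<close>, not merely at
    \<open>y\<close>, because it is differentiated 2 (j + 1) times.\<close>
  have GF: "G z = F z" if z: "z \<in> W" for z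
  proof -
    let ?h = "\<lambda>\<xi>. ennreal (\<bar>(x - z) \<bullet> \<xi>\<bar> * g \<xi>)"
    have hom: "?h (c *\<^sub>R \<xi>) = ennreal (1 / c ^ CARD('n)) * ?h \<xi>" if c: "c > 0" for c \<xi>
    proof -
      have "g (c *\<^sub>R \<xi>) = 1 / c ^ (2 * m + 2 * Suc j) * g \<xi>"
        unfolding g_def Qhom by (simp add: power_mult_distrib power_add power_mult power2_eq_square)
      then have "\<bar>(x - z) \<bullet> (c *\<^sub>R \<xi>)\<bar> * g (c *\<^sub>R \<xi>) = c / c ^ (2 * m + 2 * Suc j) * (\<bar>(x - z) \<bullet> \<xi>\<bar> * g \<xi>)"
        using c by (simp add: abs_mult)
      also have "c / c ^ (2 * m + 2 * Suc j) = 1 / c ^ CARD('n)" using c by (simp add: n field_simps)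
      finally have "?h (c *\<^sub>R \<xi>) = ennreal (1 / c ^ CARD('n) * (\<bar>(x - z) \<bullet> \<xi>\<bar> * g \<xi>))" by (rule arg_cong)
      also have "\<dots> = ennreal (1 / c ^ CARD('n)) * ?h \<xi>" using c by (intro ennreal_mult') simp
      finally show ?thesis .
    qed
    have "G z = enn2real (\<integral>\<^sup>+\<xi>. ennreal (indicator {\<xi>. norm \<xi> = 1} \<xi> *\<^sub>R (\<bar>(x - z) \<bullet> \<xi>\<bar> / Q \<xi>)) \<partial>hausdorff_measure (CARD('n) - 1))"
      unfolding G_def set_lebesgue_integral_def
    proof (rule integral_eq_nn_integral)
      show "AE \<xi> in hausdorff_measure (CARD('n) - 1). 0 \<le> indicator {\<xi>. norm \<xi> = 1} \<xi> *\<^sub>R (\<bar>(x - z) \<bullet> \<xi>\<bar> / Q \<xi>)"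
        by (intro AE_I2) (auto simp: indicator_def intro!: divide_nonneg_pos Qpos)
    qed measurable
    also have "(\<lambda>\<xi>. ennreal (indicator {\<xi>. norm \<xi> = 1} \<xi> *\<^sub>R (\<bar>(x - z) \<bullet> \<xi>\<bar> / Q \<xi>)))
        = (\<lambda>\<xi>. ?h \<xi> * indicator {\<xi>. norm \<xi> = 1} \<xi>)"
      by (auto simp: indicator_def g_def dot_square_norm)
    also have "(\<integral>\<^sup>+\<xi>. ?h \<xi> * indicator {\<xi>. norm \<xi> = 1} \<xi> \<partial>hausdorff_measure (CARD('n) - 1))
        = (\<integral>\<^sup>+\<eta>. (\<integral>\<^sup>+s. ?h (\<eta> + s *\<^sub>R e) \<partial>lborel) * indicator E \<eta> \<partial>?M)"
      unfolding E_def by (rule hausdorff_sphere_cylinder(2)[OF n3 e _ hom]) measurable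
    also have "enn2real \<dots> = F z"
      by (rule F_eq_nn_integral[OF z, symmetric])
        (use Qpos in \<open>auto simp: g_def intro!: divide_nonneg_nonneg mult_nonneg_nonneg less_imp_le\<close>)
    finally show ?thesis .
  qed
  have hty: "height y = r"
  proof -
    have "height y = ((x - y) \<bullet> (x - y)) / r" unfolding height_def by (simp add: e_def divide_inverse)
    also have "\<dots> = r" using r by (simp add: dot_square_norm r_def power2_eq_square)
    finally show ?thesis .
  qed
  have yW: "y \<in> W" using r hty by (simp add: W_def)
  have "((\<lambda>f z. - laplacian f z) ^^ Suc j) G y = K (2 * j) (\<lambda>\<xi>. ((-1) ^ Suc j * 2) * ((\<xi> \<bullet> \<xi>) ^ Suc j * g \<xi>)) y"
    by (rule iterated_laplacian_F[OF equator_kernel_axioms GF yW])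
  also have "\<dots> = K (2 * j) (\<lambda>\<xi>. ((-1) ^ Suc j * 2) * (1 / Q \<xi>)) y"
    by (rule K_cong) (simp add: g_def)
  also have "\<dots> = ((-1) ^ Suc j * 2) * K (2 * j) (\<lambda>\<xi>. 1 / Q \<xi>) y"
    by (rule K_cmult[OF rQ yW])
  also have "K (2 * j) (\<lambda>\<xi>. 1 / Q \<xi>) y
      = (LINT \<eta>:E|?M. nabla_pow (2 * j) (\<lambda>\<xi>. 1 / Q \<xi>) \<eta> e) / r ^ (2 * j + 1)"
  proof -
    \<comment> \<open>At z = y the vector x - z is parallel to \<open>e\<close>, so the integrand is
      evaluated on the equator itself.\<close>
    have "crossing y \<eta> = 0" if "\<eta> \<in> E" for \<eta>
    proof -
      have "e \<bullet> \<eta> = 0" using that by (simp add: E_def)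
      then have "(x - y) \<bullet> \<eta> = 0" using r by (simp add: e_def)
      then show ?thesis by (simp add: crossing_def)
    qed
    moreover have "nabla_pow (2 * j) (\<lambda>\<xi>. 1 / Q \<xi>) \<eta> e = (dirder e ^^ (2 * j)) (\<lambda>\<xi>. 1 / Q \<xi>) \<eta>" if "\<eta> \<in> E" for \<eta>
      using line_nz[OF that, of 0] by (intro nabla_pow_eq_dirder_pow[OF punctured_denominator_axioms rQ]) simp
    ultimately have "K (2 * j) (\<lambda>\<xi>. 1 / Q \<xi>) y = (LINT \<eta>:E|?M. nabla_pow (2 * j) (\<lambda>\<xi>. 1 / Q \<xi>) \<eta> e / r ^ (2 * j + 1))"
      unfolding K_def set_lebesgue_integral_def hty
      by (intro Bochner_Integration.integral_cong refl) (auto simp: indicator_def)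
    then show ?thesis by simp
  qed
  finally have lap: "((\<lambda>f z. - laplacian f z) ^^ Suc j) G y
      = ((-1) ^ Suc j * 2) * ((LINT \<eta>:E|?M. nabla_pow (2 * j) (\<lambda>\<xi>. 1 / Q \<xi>) \<eta> e) / r ^ (2 * j + 1))" .
  have E': "{\<xi>. norm \<xi> = 1 \<and> (x - y) \<bullet> \<xi> = 0} = E"
    using r by (auto simp: E_def e_def)
  have idx: "(CARD('n) + 1 - 2 * m) div 2 = Suc j" "CARD('n) - 2 * m - 1 = 2 * j" "CARD('n) - 2 * m = 2 * j + 1"
    using n by auto
  have "john_fundamental_solution m Q x y = - 1 / (4 * (2 * pi) ^ (CARD('n) - 1)) * ((\<lambda>f z. - laplacian f z) ^^ Suc j) G y"
    unfolding john_fundamental_solution_def idx G_def ..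
  \<comment> \<open>Here 2 / (4 * 2^(n-1)) is 1 / 2^n, and the leading minus sign absorbs one factor
    of (-1)^(j+1).\<close>
  also have "\<dots> = (-1) ^ j / (2 ^ CARD('n) * pi ^ (CARD('n) - 1) * r ^ (2 * j + 1))
      * (LINT \<eta>:E|?M. nabla_pow (2 * j) (\<lambda>\<xi>. 1 / Q \<xi>) \<eta> e)"
    unfolding lap using n r by (simp add: power_mult_distrib field_simps)
  finally show ?thesis unfolding idx E' r_def[symmetric] e_def[symmetric] by simp
qed

end
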